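(* Let $m\ge1$, let $\alpha_1<\cdots<\alpha_m$ and $\beta_1,\ldots,\beta_m$ be real numbers, let $\boldsymbol n=(n_1,\ldots,n_m)$ with integers $n_i\ge0$, and let $\hat{\mathcal{D}}_{\boldsymbol n}$ be as defined in the context. (i) We have $$\hat{\mathcal{D}}_{\boldsymbol n}=\prod_{i=1}^m\prod_{\ell_i=1}^{n_i}\left(\int_{\Gamma_{i,\mathrm{L}}^{\mathrm{in}}}\frac{\mathrm{d}u_{\ell_i}^{(i)}}{2\pi\mathrm{i}}\int_{\Gamma_{i,\mathrm{R}}^{\mathrm{out}}}\frac{\mathrm{d}v_{\ell_i}^{(i)}}{2\pi\mathrm{i}}\right)\mathrm{C}(V^{(1)};U^{(1)})\cdot\prod_{i=1}^m\mathrm{C}(U^{(i)}\sqcup V^{(i+1)};V^{(i)}\sqcup U^{(i+1)})\cdot\prod_{i=1}^m\prod_{\ell_i=1}^{n_i}\frac{F_i(u_{\ell_i}^{(i)})}{F_i(v_{\ell_i}^{(i)})}.$$ (ii) If $n_1\ge\cdots\ge n_m$, then, with $n_{m+1}=0$, $k_i=n_i-n_{i+1}$ and $\hat V^{(i)}=(\hat v_1^{(i)},\ldots,\hat v_{k_i}^{(i)})$ for $1\le i\le m$, $$\begin{aligned}\hat{\mathcal{D}}_{\boldsymbol n}=&\prod_{i=1}^{m-1}\frac{n_i!}{k_i!}\ \prod_{i=1}^m\prod_{\ell_i=1}^{n_i}\int_{\Gamma_{i,\mathrm{L}}^{\mathrm{in}}}\frac{\mathrm{d}u_{\ell_i}^{(i)}}{2\pi\mathrm{i}}\cdot\prod_{i=1}^m\prod_{\hat\ell_i=1}^{k_i}\int_{\Gamma_{1,\mathrm{R}}}\frac{\mathrm{d}\hat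 v_{\hat\ell_i}^{(i)}}{2\pi\mathrm{i}}\\ &\ \mathrm{C}(\hat V^{(m)}\sqcup\cdots\sqcup\hat V^{(1)};U^{(1)})\cdot\prod_{i=1}^m\mathrm{C}(U^{(i)};U^{(i+1)}\sqcup\hat V^{(i)})\cdot\prod_{i=1}^m\frac{\prod_{\ell_i=1}^{n_i}F_i(u_{\ell_i}^{(i)})}{\prod_{\hat\ell_i=1}^{k_i}f_i(\hat v_{\hat\ell_i}^{(i)})}.\end{aligned}$$ Moreover, for all other $\boldsymbol n$ (i.e. those not satisfying $n_1\ge\cdots\ge n_m$) we have $\hat{\mathcal{D}}_{\boldsymbol n}=0$.
   Context: Empty products, integrals and determinants equal $1$. $\oint_0$ denotes integration along a small counterclockwise circle around the origin (radius less than $1$). Functions: $f_i(w)=e^{-\frac13w^3+\alpha_iw^2+\beta_iw}$ for $1\le i\le m$; $F_1=f_1$ and $F_i=f_i/f_{i-1}$ for $2\le i\le m$. Cauchy determinant: for $W,\tilde W\in\mathbb{C}^n$, $\mathrm{C}(W;\tilde W)=\det[1/(w_i-\tilde w_j)]_{i,j=1}^n$. $W\sqcup W'$ denotes concatenation of vectors. $U^{(i)}=(u_1^{(i)},\ldots,u_{n_i}^{(i)})$, $V^{(i)}=(v_1^{(i)},\ldots,v_{n_i}^{(i)})$ for $1\le i\le m$; $U^{(m+1)},V^{(m+1)}$ are empty vectors. Contours: $\Gamma_{m,\mathrm{L}}^{\mathrm{in}},\ldots,\Gamma_{2,\mathrm{L}}^{\mathrm{in}},\Gamma_{1,\mathrm{L}},\Gamma_{2,\mathrm{L}}^{\mathrm{out}},\ldots,\Gamma_{m,\mathrm{L}}^{\mathrm{out}}$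 are $2m-1$ disjoint contours in the left half plane, ordered from left to right, each going from $\infty e^{-2\pi\mathrm{i}/3}$ to $\infty e^{2\pi\mathrm{i}/3}$. $\Gamma_{m,\mathrm{R}}^{\mathrm{in}},\ldots,\Gamma_{2,\mathrm{R}}^{\mathrm{in}},\Gamma_{1,\mathrm{R}},\Gamma_{2,\mathrm{R}}^{\mathrm{out}},\ldots,\Gamma_{m,\mathrm{R}}^{\mathrm{out}}$ are $2m-1$ disjoint contours in the right half plane, ordered from right to left, each going from $\infty e^{-\pi\mathrm{i}/5}$ to $\infty e^{\pi\mathrm{i}/5}$. Also $\Gamma_{1,\mathrm{L}}^{\mathrm{in}}:=\Gamma_{1,\mathrm{L}}$ and $\Gamma_{1,\mathrm{R}}^{\mathrm{out}}:=\Gamma_{1,\mathrm{R}}$. Definition of $\hat{\mathcal{D}}_{\boldsymbol n}$: $\hat{\mathcal{D}}_{\boldsymbol n}=\oint_0\cdots\oint_0\mathcal{D}_{\boldsymbol n}(z_1,\ldots,z_{m-1})\prod_{i=1}^{m-1}\frac{\mathrm{d}z_i}{2\pi\mathrm{i}z_i(1-z_i)}$, where $$\begin{aligned}\mathcal{D}_{\boldsymbol n}=&\prod_{i=1}^{m-1}(1-z_i)^{n_i}(1-z_i^{-1})^{n_{i+1}}\\ &\cdot\prod_{i=2}^m\prod_{\ell_i=1}^{n_i}\left(\frac{1}{1-z_{i-1}}\int_{\Gamma_{i,\mathrm{L}}^{\mathrm{in}}}\frac{\mathrm{d}u_{\ell_i}^{(i)}}{2\pi\mathrm{i}}-\frac{z_{i-1}}{1-z_{i-1}}\int_{\Gamma_{i,\mathrm{L}}^{\mathrm{out}}}\frac{\mathrm{d}u_{\ell_i}^{(i)}}{2\pi\mathrm{i}}\right)\prod_{\ell_1=1}^{n_1}\int_{\Gamma_{1,\mathrm{L}}}\frac{\mathrm{d}u_{\ell_1}^{(1)}}{2\pi\mathrm{i}}\\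 &\cdot\prod_{i=2}^m\prod_{\ell_i=1}^{n_i}\left(\frac{1}{1-z_{i-1}}\int_{\Gamma_{i,\mathrm{R}}^{\mathrm{in}}}\frac{\mathrm{d}v_{\ell_i}^{(i)}}{2\pi\mathrm{i}}-\frac{z_{i-1}}{1-z_{i-1}}\int_{\Gamma_{i,\mathrm{R}}^{\mathrm{out}}}\frac{\mathrm{d}v_{\ell_i}^{(i)}}{2\pi\mathrm{i}}\right)\prod_{\ell_1=1}^{n_1}\int_{\Gamma_{1,\mathrm{R}}}\frac{\mathrm{d}v_{\ell_1}^{(1)}}{2\pi\mathrm{i}}\\ &\ \mathrm{C}(V^{(1)};U^{(1)})\cdot\prod_{i=1}^m\mathrm{C}(U^{(i)}\sqcup V^{(i+1)};V^{(i)}\sqcup U^{(i+1)})\cdot\prod_{i=1}^m\prod_{\ell_i=1}^{n_i}\frac{F_i(u_{\ell_i}^{(i)})}{F_i(v_{\ell_i}^{(i)})}.\end{aligned}$$ *)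

theory Defs
  imports
    "HOL-Complex_Analysis.Contour_Integration"
    "Jordan_Normal_Form.Determinant"
begin

definition cauchy_det :: "complex list \<Rightarrow> complex list \<Rightarrow> complex" where
  "cauchy_det W W' =
     Determinant.det (Matrix.mat (length W) (length W') (\<lambda>(i, j). 1 / (W ! i - W' ! j)))"


subsection \<open>Unbounded contours\<close>

text \<open>
  A contour going from \<open>\<infinity> e\<^bsup>-i\<theta>\<^esup>\<close> to \<open>\<infinity> e\<^bsup>i\<theta>\<^esup>\<close>: only the asymptotic direction of the two
  ends is prescribed.  The last clause allows the arc length to grow at most exponentially in
  the modulus.  It does not depend on the parametrization and holds, for instance, for all curves
  that are eventually straight; it makes every function of Gaussian decay absolutely integrable
  along the curve.
\<close>

definition unbounded_contour :: "real \<Rightarrow> (real \<Rightarrow> complex) \<Rightarrow> bool" where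
  "unbounded_contour \<theta> \<gamma> \<longleftrightarrow>
     (\<forall>a b. \<gamma> piecewise_C1_differentiable_on {a..b}) \<and>
     filterlim \<gamma> at_infinity at_bot \<and> ((\<lambda>t. sgn (\<gamma> t)) \<longlongrightarrow> cis (- \<theta>)) at_bot \<and>
     filterlim \<gamma> at_infinity at_top \<and> ((\<lambda>t. sgn (\<gamma> t)) \<longlongrightarrow> cis \<theta>) at_top \<and>
     (\<exists>K. integrable lborel (\<lambda>t. exp (- K * norm (\<gamma> t)) * norm (vector_derivative \<gamma> (at t))))"

definition line_integral :: "(real \<Rightarrow> complex) \<Rightarrow> (complex \<Rightarrow> complex) \<Rightarrow> complex" where
  "line_integral \<gamma> g = (\<integral>t. g (\<gamma> t) * vector_derivative \<gamma> (at t) \<partial>lborel)"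

text \<open>
  For \<open>0 < \<theta> < \<pi>\<close>, a contour as above does not meet the real axis far out; its left (right) side is
  the component of its complement containing all sufficiently large negative (positive) reals.
\<close>

definition left_side :: "(real \<Rightarrow> complex) \<Rightarrow> complex set" where
  "left_side \<gamma> =
     {w. eventually (\<lambda>x. connected_component (- range \<gamma>) w (complex_of_real x)) at_bot}"

definition right_side :: "(real \<Rightarrow> complex) \<Rightarrow> complex set" where
  "right_side \<gamma> =
     {w. eventually (\<lambda>x. connected_component (- range \<gamma>) w (complex_of_real x)) at_top}"

text \<open>This entails that the two curves are disjoint.\<close>

definition left_of :: "(real \<Rightarrow> complex) \<Rightarrow> (real \<Rightarrow> complex) \<Rightarrow> bool" where
  "left_of \<gamma> \<gamma>' \<longleftrightarrow> range \<gamma> \<subseteq> left_side \<gamma>' \<and> range \<gamma>' \<subseteq> right_side \<gamma>"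

text \<open>
  Disjoint curves with the same asymptotic directions may approach each other at infinity.  If
  they do so fast enough, the Cauchy kernel \<open>1 / (w - w')\<close> times a function of Gaussian decay is not
  absolutely integrable on the product of the two curves, and the multiple integral has no meaning.
  This is excluded by asking that the curves do not approach faster than exponentially; it is
  automatic for disjoint curves that are eventually straight.
\<close>

definition tamely_separated :: "(real \<Rightarrow> complex) \<Rightarrow> (real \<Rightarrow> complex) \<Rightarrow> bool" where
  "tamely_separated \<gamma> \<gamma>' \<longleftrightarrow>
     (\<exists>c>0. \<exists>K. \<forall>s t. c * exp (- K * norm (\<gamma> s)) \<le> dist (\<gamma> s) (\<gamma>' t))"

text \<open>
  The curves \<open>\<Gamma>\<^sub>1\<^sub>,\<^sub>L\<close> and \<open>\<Gamma>\<^sub>1\<^sub>,\<^sub>R\<close> are \<open>Lin 1\<close> and \<open>Rout 1\<close>; the values \<open>Lout 1\<close> and \<open>Rin 1\<close> are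
  never used.  The lists run from left to right, and from right to left, respectively.
\<close>

definition left_contours ::
    "nat \<Rightarrow> (nat \<Rightarrow> real \<Rightarrow> complex) \<Rightarrow> (nat \<Rightarrow> real \<Rightarrow> complex) \<Rightarrow> bool" where
  "left_contours m Lin Lout \<longleftrightarrow>
     (let \<Gamma>s = map Lin (rev [1..<Suc m]) @ map Lout [2..<Suc m] in
       (\<forall>\<gamma>\<in>set \<Gamma>s. unbounded_contour (2 * pi / 3) \<gamma> \<and> range \<gamma> \<subseteq> {w. Re w < 0}) \<and>
       sorted_wrt (\<lambda>\<gamma> \<gamma>'. left_of \<gamma> \<gamma>' \<and> tamely_separated \<gamma> \<gamma>') \<Gamma>s)"

definition right_contours ::
    "nat \<Rightarrow> (nat \<Rightarrow> real \<Rightarrow> complex) \<Rightarrow> (nat \<Rightarrow> real \<Rightarrow> complex) \<Rightarrow> bool" where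
  "right_contours m Rin Rout \<longleftrightarrow>
     (let \<Gamma>s = map Rin (rev [2..<Suc m]) @ map Rout [1..<Suc m] in
       (\<forall>\<gamma>\<in>set \<Gamma>s. unbounded_contour (pi / 5) \<gamma> \<and> range \<gamma> \<subseteq> {w. Re w > 0}) \<and>
       sorted_wrt (\<lambda>\<gamma> \<gamma>'. left_of \<gamma>' \<gamma> \<and> tamely_separated \<gamma> \<gamma>') \<Gamma>s)"


subsection \<open>Iterated integrals\<close>

text \<open>
  \<open>J a\<close> is the functional (an integral, or a linear combination of integrals) acting on the
  variable \<open>a\<close>; the head of the list is the outermost one.  The argument \<open>x\<close> only
  serves variables outside the list.
\<close>

primrec iterated_integral ::
    "('a \<Rightarrow> (complex \<Rightarrow> complex) \<Rightarrow> complex) \<Rightarrow> 'a list \<Rightarrow> (('a \<Rightarrow> complex) \<Rightarrow> complex) \<Rightarrow>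
     ('a \<Rightarrow> complex) \<Rightarrow> complex" where
  "iterated_integral J [] G x = G x"
| "iterated_integral J (a # as) G x = J a (\<lambda>w. iterated_integral J as G (x(a := w)))"


subsection \<open>The integrands\<close>

definition f_fun :: "(nat \<Rightarrow> real) \<Rightarrow> (nat \<Rightarrow> real) \<Rightarrow> nat \<Rightarrow> complex \<Rightarrow> complex" where
  "f_fun \<alpha> \<beta> i w = exp (- (1 / 3) * w ^ 3 + of_real (\<alpha> i) * w ^ 2 + of_real (\<beta> i) * w)"

definition F_fun :: "(nat \<Rightarrow> real) \<Rightarrow> (nat \<Rightarrow> real) \<Rightarrow> nat \<Rightarrow> complex \<Rightarrow> complex" where
  "F_fun \<alpha> \<beta> i w = (if i = 1 then f_fun \<alpha> \<beta> 1 w else f_fun \<alpha> \<beta> i w / f_fun \<alpha> \<beta> (i - 1) w)"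

text \<open>\<open>U i l\<close> and \<open>V i l\<close> name the variables with upper index \<open>i\<close> and lower index \<open>l\<close>.\<close>

datatype var = U nat nat | V nat nat

text \<open>The tuple \<open>(n\<^sub>1, \<dots>, n\<^sub>m)\<close> extended by \<open>n\<^sub>m\<^sub>+\<^sub>1 = 0\<close>.\<close>

definition ext :: "nat \<Rightarrow> (nat \<Rightarrow> nat) \<Rightarrow> nat \<Rightarrow> nat" where
  "ext m n i = (if i \<le> m then n i else 0)"

definition gap :: "nat \<Rightarrow> (nat \<Rightarrow> nat) \<Rightarrow> nat \<Rightarrow> nat" where
  "gap m n i = ext m n i - ext m n (Suc i)"

definition Uvec :: "(var \<Rightarrow> complex) \<Rightarrow> nat \<Rightarrow> nat \<Rightarrow> complex list" where
  "Uvec x N i = map (\<lambda>l. x (U i l)) [1..<Suc N]"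

definition Vvec :: "(var \<Rightarrow> complex) \<Rightarrow> nat \<Rightarrow> nat \<Rightarrow> complex list" where
  "Vvec x N i = map (\<lambda>l. x (V i l)) [1..<Suc N]"

definition integrand ::
    "nat \<Rightarrow> (nat \<Rightarrow> nat) \<Rightarrow> (nat \<Rightarrow> real) \<Rightarrow> (nat \<Rightarrow> real) \<Rightarrow> (var \<Rightarrow> complex) \<Rightarrow> complex" where
  "integrand m n \<alpha> \<beta> x =
     (let Us = (\<lambda>i. Uvec x (ext m n i) i); Vs = (\<lambda>i. Vvec x (ext m n i) i) in
       cauchy_det (Vs 1) (Us 1)
       * (\<Prod>i=1..m. cauchy_det (Us i @ Vs (Suc i)) (Vs i @ Us (Suc i)))
       * (\<Prod>i=1..m. \<Prod>l=1..n i. F_fun \<alpha> \<beta> i (x (U i l)) / F_fun \<alpha> \<beta> i (x (V i l))))"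

text \<open>Here \<open>V i l\<close>, for \<open>1 \<le> l \<le> gap m n i\<close>, are the coordinates of the vectors written with a hat.\<close>

definition reduced_integrand ::
    "nat \<Rightarrow> (nat \<Rightarrow> nat) \<Rightarrow> (nat \<Rightarrow> real) \<Rightarrow> (nat \<Rightarrow> real) \<Rightarrow> (var \<Rightarrow> complex) \<Rightarrow> complex" where
  "reduced_integrand m n \<alpha> \<beta> x =
     (let Us = (\<lambda>i. Uvec x (ext m n i) i); Vs = (\<lambda>i. Vvec x (gap m n i) i) in
       cauchy_det (concat (map Vs (rev [1..<Suc m]))) (Us 1)
       * (\<Prod>i=1..m. cauchy_det (Us i) (Us (Suc i) @ Vs i))
       * (\<Prod>i=1..m. (\<Prod>l=1..n i. F_fun \<alpha> \<beta> i (x (U i l)))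
                     / (\<Prod>l=1..gap m n i. f_fun \<alpha> \<beta> i (x (V i l)))))"


subsection \<open>The quantity \<open>D\<close> and its contour integral\<close>

definition mixed_integral ::
    "complex \<Rightarrow> (real \<Rightarrow> complex) \<Rightarrow> (real \<Rightarrow> complex) \<Rightarrow> (complex \<Rightarrow> complex) \<Rightarrow> complex" where
  "mixed_integral z \<gamma>in \<gamma>out g =
     1 / (1 - z) * (line_integral \<gamma>in g / (2 * of_real pi * \<i>))
     - z / (1 - z) * (line_integral \<gamma>out g / (2 * of_real pi * \<i>))"

definition D_fun ::
    "nat \<Rightarrow> (nat \<Rightarrow> nat) \<Rightarrow> (nat \<Rightarrow> real) \<Rightarrow> (nat \<Rightarrow> real) \<Rightarrow>
     (nat \<Rightarrow> real \<Rightarrow> complex) \<Rightarrow> (nat \<Rightarrow> real \<Rightarrow> complex) \<Rightarrow>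
     (nat \<Rightarrow> real \<Rightarrow> complex) \<Rightarrow> (nat \<Rightarrow> real \<Rightarrow> complex) \<Rightarrow> (nat \<Rightarrow> complex) \<Rightarrow> complex" where
  "D_fun m n \<alpha> \<beta> Lin Lout Rin Rout z =
     (\<Prod>i=1..<m. (1 - z i) ^ n i * (1 - inverse (z i)) ^ n (Suc i))
     * iterated_integral
         (\<lambda>a g. case a of
            U i l \<Rightarrow> if i = 1 then line_integral (Lin 1) g / (2 * of_real pi * \<i>)
                     else mixed_integral (z (i - 1)) (Lin i) (Lout i) g
          | V i l \<Rightarrow> if i = 1 then line_integral (Rout 1) g / (2 * of_real pi * \<i>)
                     else mixed_integral (z (i - 1)) (Rin i) (Rout i) g)
         ([U i l. i \<leftarrow> [2..<Suc m], l \<leftarrow> [1..<Suc (n i)]] @ [U 1 l. l \<leftarrow> [1..<Suc (n 1)]]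
          @ [V i l. i \<leftarrow> [2..<Suc m], l \<leftarrow> [1..<Suc (n i)]] @ [V 1 l. l \<leftarrow> [1..<Suc (n 1)]])
         (integrand m n \<alpha> \<beta>) (\<lambda>_. 0)"

text \<open>The radius of the circle on which \<open>z\<^sub>i\<close> runs is \<open>r i\<close>.\<close>

definition D_hat ::
    "nat \<Rightarrow> (nat \<Rightarrow> nat) \<Rightarrow> (nat \<Rightarrow> real) \<Rightarrow> (nat \<Rightarrow> real) \<Rightarrow>
     (nat \<Rightarrow> real \<Rightarrow> complex) \<Rightarrow> (nat \<Rightarrow> real \<Rightarrow> complex) \<Rightarrow>
     (nat \<Rightarrow> real \<Rightarrow> complex) \<Rightarrow> (nat \<Rightarrow> real \<Rightarrow> complex) \<Rightarrow> (nat \<Rightarrow> real) \<Rightarrow> complex" where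
  "D_hat m n \<alpha> \<beta> Lin Lout Rin Rout r =
     iterated_integral (\<lambda>i. contour_integral (circlepath 0 (r i))) [1..<m]
       (\<lambda>z. D_fun m n \<alpha> \<beta> Lin Lout Rin Rout z
            * (\<Prod>i=1..<m. 1 / (2 * of_real pi * \<i> * z i * (1 - z i)))) (\<lambda>_. 0)"

end

theory Submission
  imports Defs "HOL-Complex_Analysis.Cauchy_Integral_Formula" "HOL-Real_Asymp.Real_Asymp"
begin

text \<open>
  Fix the variables \<open>U\<close>, which lie in the left half plane, and integrate out \<open>V\<^sup>(\<^sup>m\<^sup>)\<close>, then
  \<open>V\<^sup>(\<^sup>m\<^sup>-\<^sup>1\<^sup>)\<close>, and so on down to \<open>V\<^sup>(\<^sup>2\<^sup>)\<close>.  In the right half plane the integrand, as a function of a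
  variable of the current top level \<open>i\<close>, decays like a Gaussian in a sector and has poles only at
  the variables of level \<open>i - 1\<close>.  Pushing its contour to \<open>+\<infinity>\<close> therefore gives \<open>0\<close> for the \<open>in\<close>
  contour and minus the sum of the residues for the \<open>out\<close> contour.  Collecting the residues of the
  Cauchy determinant, one is left with an antisymmetrized integrand of the same shape at level
  \<open>i - 1\<close>, or with \<open>0\<close> if \<open>n\<^sub>i > n\<^sub>i\<^sub>-\<^sub>1\<close>.

  Hence only the \<open>out\<close> contours matter for \<open>V\<close>, and the total power of \<open>1 - 1/z\<^sub>i\<close> cancels.  The
  integrand in \<open>z\<^sub>i\<close> that goes with a choice of contours for \<open>U\<close> is then \<open>1/z\<^sub>i\<close> times a function
  which is holomorphic in the unit disc and vanishes at \<open>0\<close> as soon as some \<open>U\<^sup>(\<^sup>i\<^sup>+\<^sup>1\<^sup>)\<close> runs over an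
  \<open>out\<close> contour, so that only the \<open>in\<close> contours survive.  Undoing the antisymmetrization at level
  \<open>1\<close> gives the second formula.
\<close>

section \<open>Iterated integrals as integrals over a product space\<close>

text \<open>\<open>D_fun\<close> fixes an order of integration, whereas residues have to be taken
  with the highest level of V innermost. Reordering needs absolute integrability: by tame separation
  each Cauchy kernel costs at most a factor
  \<open>exp (\<kappa> * |w|) * exp (\<kappa> * |w'|)\<close>, and the factors F decay faster than
  every exponential along the contours. The coefficients of the contours depend on z alone, so
  expanding into a finite sum over choices of contours separates z from U and V, with no exchange of
  circle and line integrals. The descent stops at level 2 for a reason. For \<open>i \<ge> 2\<close>
  the cubic terms cancel in \<open>F_i\<close>, so that \<open>1 / F_i\<close> decays throughout a
  sector containing the tails of the right contours and the chords between them;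
  \<open>1 / F_1\<close> keeps \<open>exp (w^3 / 3)\<close>, which decays at the angles pi/5 and
  -pi/5 but explodes on the positive axis. Level 1 in turn has a single contour on the right, so its
  variables can be permuted freely and the sum over permutations collapses to a multiple of one
  term.\<close>

definition path_integral :: "(real \<Rightarrow> complex) \<Rightarrow> (real \<Rightarrow> complex) \<Rightarrow> (complex \<Rightarrow> complex) \<Rightarrow> complex" where
  "path_integral p q g = (\<integral>t. g (p t) * q t \<partial>lborel)"

abbreviation assignments :: "('a \<Rightarrow> complex) measure" where
  "assignments \<equiv> Pi\<^sub>M UNIV (\<lambda>_. borel)"

text \<open>A bound by a product of one-variable functions reduces integrability over the product
  space to integrability in each coordinate. \<open>K a\<close> collects all values that the
  variable \<open>a\<close> may take, so that one bound serves every choice of contours; the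
  coordinates outside \<open>A\<close> stay frozen at \<open>x\<close>, on which the constant may
  depend.\<close>

definition dominated ::
    "('a \<Rightarrow> complex set) \<Rightarrow> ('a \<Rightarrow> complex \<Rightarrow> real) \<Rightarrow> 'a set \<Rightarrow> (('a \<Rightarrow> complex) \<Rightarrow> complex) \<Rightarrow>
     ('a \<Rightarrow> complex) \<Rightarrow> bool" where
  "dominated K \<phi> A G x \<longleftrightarrow>
     (\<exists>C. \<forall>y. (\<forall>a\<in>A. y a \<in> K a) \<and> (\<forall>a. a \<notin> A \<longrightarrow> y a = x a) \<longrightarrow> norm (G y) \<le> C * (\<Prod>a\<in>A. \<phi> a (y a)))"

section \<open>Formal rules for iterated integrals\<close>

lemma iterated_integral_Nil_fun: "iterated_integral J [] G = G"
  by (rule HOL.ext) simp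

lemma iterated_integral_append:
  "iterated_integral J (as @ bs) G x = iterated_integral J as (iterated_integral J bs G) x"
  by (induction as arbitrary: x) auto

text \<open>This admits under the integrals facts that hold only for points on the contours.\<close>

lemma iterated_integral_cong:
  assumes "\<And>a g h. a \<in> set as \<Longrightarrow> (\<And>w. w \<in> K a \<Longrightarrow> g w = h w) \<Longrightarrow> J a g = J' a h"
    and "\<And>y. (\<And>a. a \<in> set as \<Longrightarrow> y a \<in> K a) \<Longrightarrow> (\<And>a. a \<notin> set as \<Longrightarrow> y a = x a) \<Longrightarrow> G y = H y"
  shows "iterated_integral J as G x = iterated_integral J' as H x"
  using assms
proof (induction as arbitrary: x)
  case (Cons a as)
  show ?case
  proof (simp, rule Cons.prems(1))
    fix w assume w: "w \<in> K a"
    show "iterated_integral J as G (x(a := w)) = iterated_integral J' as H (x(a := w))"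
    proof (rule Cons.IH)
      show "J b g = J' b h" if "b \<in> set as" "\<And>w. w \<in> K b \<Longrightarrow> g w = h w" for b g h
        using Cons.prems(1)[of b g h] that by auto
      show "G y = H y" if y: "\<And>b. b \<in> set as \<Longrightarrow> y b \<in> K b" "\<And>b. b \<notin> set as \<Longrightarrow> y b = (x(a := w)) b" for y
      proof (rule Cons.prems(2))
        fix b show "b \<in> set (a # as) \<Longrightarrow> y b \<in> K b" using y w by (cases "b \<in> set as") auto
        show "b \<notin> set (a # as) \<Longrightarrow> y b = x b" using y(2)[of b] by auto
      qed
    qed
  qed auto
qed simp

text \<open>Besides the integrated variables, \<open>D\<close> contains those that the integrand
  merely reads. Injectivity of \<open>f\<close> on \<open>D\<close> ensures that updating
  \<open>f a\<close> leaves \<open>f b\<close> untouched for every other \<open>b\<close> in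
  \<open>D\<close>.\<close>

lemma iterated_integral_rename:
  assumes "inj_on f D" "set as \<subseteq> D"
    and "\<And>a. a \<in> set as \<Longrightarrow> J (f a) = J' a"
    and "\<And>x y. (\<And>a. a \<in> D \<Longrightarrow> y a = x (f a)) \<Longrightarrow> P x \<Longrightarrow> G x = H y"
    and "\<And>a. a \<in> D - set as \<Longrightarrow> y a = x (f a)"
    and "P x" and "\<And>x a w. a \<in> set as \<Longrightarrow> P x \<Longrightarrow> P (x(f a := w))"
  shows "iterated_integral J (map f as) G x = iterated_integral J' as H y"
  using assms(2-3,5-7)
proof (induction as arbitrary: x y)
  case Nil
  then show ?case using assms(4)[of y x] by simp
next
  case (Cons a as)
  have "iterated_integral J (map f as) G (x(f a := w)) = iterated_integral J' as H (y(a := w))" for w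
  proof (rule Cons.IH)
    fix b assume b: "b \<in> D - set as"
    show "(y(a := w)) b = (x(f a := w)) (f b)"
    proof (cases "b = a")
      case False
      then have "f b \<noteq> f a" using assms(1) b Cons.prems(1) by (auto simp: inj_on_def)
      then show ?thesis using False b Cons.prems(3) by auto
    qed simp
  qed (use Cons.prems in auto)
  then show ?case using Cons.prems(2)[of a] by simp
qed

section \<open>Domination and measurability\<close>

lemma dominatedI:
  assumes "\<And>y. (\<And>a. a \<in> A \<Longrightarrow> y a \<in> K a) \<Longrightarrow> (\<And>a. a \<notin> A \<Longrightarrow> y a = x a) \<Longrightarrow>
     norm (G y) \<le> C * (\<Prod>a\<in>A. \<phi> a (y a))"
  shows "dominated K \<phi> A G x"
  unfolding dominated_def using assms by blast

text \<open>The factors of the newly frozen variables become part of the constant.\<close>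

lemma dominated_fix:
  assumes "dominated K \<phi> A G x" "B \<subseteq> A" "finite A"
    and "\<And>a. a \<in> A - B \<Longrightarrow> y a \<in> K a" "\<And>a. a \<notin> A \<Longrightarrow> y a = x a"
  shows "dominated K \<phi> B G y"
proof -
  obtain C where C: "\<And>y. (\<And>a. a \<in> A \<Longrightarrow> y a \<in> K a) \<Longrightarrow> (\<And>a. a \<notin> A \<Longrightarrow> y a = x a) \<Longrightarrow>
     norm (G y) \<le> C * (\<Prod>a\<in>A. \<phi> a (y a))"
    using assms(1) unfolding dominated_def by blast
  show ?thesis
  proof (rule dominatedI[where C = "C * (\<Prod>a\<in>A-B. \<phi> a (y a))"])
    fix z assume z: "\<And>a. a \<in> B \<Longrightarrow> z a \<in> K a" "\<And>a. a \<notin> B \<Longrightarrow> z a = y a"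
    have "norm (G z) \<le> C * (\<Prod>a\<in>A. \<phi> a (z a))"
    proof (rule C)
      fix a
      show "a \<in> A \<Longrightarrow> z a \<in> K a"
        using z assms(2,4) by (cases "a \<in> B") auto
      show "z a = x a" if "a \<notin> A" using z(2)[of a] assms(2) assms(5)[OF that] that by auto
    qed
    also have "(\<Prod>a\<in>A. \<phi> a (z a)) = (\<Prod>a\<in>A-B. \<phi> a (z a)) * (\<Prod>a\<in>B. \<phi> a (z a))"
      using assms(2,3) by (rule prod.subset_diff)
    also have "(\<Prod>a\<in>A-B. \<phi> a (z a)) = (\<Prod>a\<in>A-B. \<phi> a (y a))"
      using z by (intro prod.cong) auto
    finally show "norm (G z) \<le> C * (\<Prod>a\<in>A-B. \<phi> a (y a)) * (\<Prod>a\<in>B. \<phi> a (z a))"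
      by (simp add: mult.assoc)
  qed
qed

lemma measurable_update [measurable]:
  assumes [measurable]: "p \<in> borel_measurable borel"
  shows "(\<lambda>(y, t). y(a := p t)) \<in> measurable (assignments \<Otimes>\<^sub>M lborel) assignments"
proof (rule measurable_PiM_single')
  fix i
  show "(\<lambda>u. (case u of (y, t) \<Rightarrow> y(a := p t)) i) \<in> borel_measurable (assignments \<Otimes>\<^sub>M lborel)"
    by (cases "i = a") (auto simp: case_prod_beta)
qed (auto simp: space_PiM)

lemma measurable_path_integral:
  assumes [measurable]: "p \<in> borel_measurable borel" "q \<in> borel_measurable borel"
    "G \<in> borel_measurable assignments"
  shows "(\<lambda>y. path_integral p q (\<lambda>w. G (y(a := w)))) \<in> borel_measurable assignments"
proof -
  have "(\<lambda>u. G (case u of (y, t) \<Rightarrow> y(a := p t))) \<in> borel_measurable (assignments \<Otimes>\<^sub>M lborel)"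
    by measurable
  then have "(\<lambda>(y, t). G (y(a := p t)) * q t) \<in> borel_measurable (assignments \<Otimes>\<^sub>M lborel)"
    by (auto simp: case_prod_beta intro!: borel_measurable_times)
  then show ?thesis
    unfolding path_integral_def
    by (intro sigma_finite_measure.borel_measurable_lebesgue_integral) (auto intro: sigma_finite_lborel)
qed

lemma measurable_iterated_integral:
  assumes "\<And>a. a \<in> set as \<Longrightarrow> p a \<in> borel_measurable borel"
    "\<And>a. a \<in> set as \<Longrightarrow> q a \<in> borel_measurable borel"
    and "G \<in> borel_measurable assignments"
  shows "iterated_integral (\<lambda>a. path_integral (p a) (q a)) as G \<in> borel_measurable assignments"
  using assms
proof (induction as)
  case (Cons a as)
  then show ?case
    using measurable_path_integral[of "p a" "q a" "iterated_integral (\<lambda>a. path_integral (p a) (q a)) as G" a]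
    by simp
qed (auto simp: iterated_integral_Nil_fun)

lemma measurable_section:
  assumes "G \<in> borel_measurable assignments" "p \<in> borel_measurable borel"
  shows "(\<lambda>t. G (y(a := p t))) \<in> borel_measurable borel"
proof -
  have "(\<lambda>t. y(a := p t)) \<in> measurable borel assignments"
  proof (rule measurable_PiM_single')
    fix i show "(\<lambda>t. (y(a := p t)) i) \<in> borel_measurable borel"
      using assms(2) by (cases "i = a") auto
  qed (auto simp: space_PiM)
  from measurable_compose[OF this assms(1)] show ?thesis .
qed

text \<open>The one-variable data behind Fubini. The paths \<open>p\<close> and weights
  \<open>q\<close> vary with the choice of contours, while \<open>K\<close> and
  \<open>\<phi>\<close> stay fixed; a domination proved once applies to all choices.\<close>

locale paths =
  fixes K :: "'a \<Rightarrow> complex set" and \<phi> :: "'a \<Rightarrow> complex \<Rightarrow> real"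
    and p q :: "'a \<Rightarrow> real \<Rightarrow> complex" and A :: "'a set"
  assumes finite_A: "finite A"
    and measurable_p: "\<And>a. a \<in> A \<Longrightarrow> p a \<in> borel_measurable borel"
    and measurable_q: "\<And>a. a \<in> A \<Longrightarrow> q a \<in> borel_measurable borel"
    and p_in: "\<And>a t. a \<in> A \<Longrightarrow> p a t \<in> K a"
    and integrable_\<phi>: "\<And>a. a \<in> A \<Longrightarrow> integrable lborel (\<lambda>t. \<phi> a (p a t) * norm (q a t))"
begin

abbreviation "J \<equiv> \<lambda>a. path_integral (p a) (q a)"

lemma integrable_section:
  assumes "dominated K \<phi> {a} G x" "a \<in> A" "G \<in> borel_measurable assignments"
  shows "integrable lborel (\<lambda>t. G (x(a := p a t)) * q a t)"
proof -
  obtain C where C: "\<And>y. (\<forall>b\<in>{a}. y b \<in> K b) \<and> (\<forall>b. b \<notin> {a} \<longrightarrow> y b = x b) \<longrightarrow>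
     norm (G y) \<le> C * (\<Prod>b\<in>{a}. \<phi> b (y b))"
    using assms(1) unfolding dominated_def by blast
  have le: "norm (G (x(a := p a t))) \<le> C * \<phi> a (p a t)" for t
    using C[of "x(a := p a t)"] p_in[OF assms(2)] by simp
  show ?thesis
  proof (rule Bochner_Integration.integrable_bound)
    show "integrable lborel (\<lambda>t. C * (\<phi> a (p a t) * norm (q a t)))"
      using integrable_\<phi>[OF assms(2)] by (rule integrable_mult_right)
    show "(\<lambda>t. G (x(a := p a t)) * q a t) \<in> borel_measurable lborel"
      using measurable_section[OF assms(3) measurable_p[OF assms(2)]] measurable_q[OF assms(2)] by measurable
    have "norm (G (x(a := p a t)) * q a t) \<le> norm (C * (\<phi> a (p a t) * norm (q a t)))" for t
      using mult_right_mono[OF le[of t], of "norm (q a t)"] by (simp add: norm_mult mult.assoc)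
    then show "AE t in lborel. norm (G (x(a := p a t)) * q a t) \<le> norm (C * (\<phi> a (p a t) * norm (q a t)))"
      by simp
  qed
qed

text \<open>The constant is multiplied by the integral of \<open>\<phi> a\<close> along the path, so
  domination survives the integration of one variable and is available for the outer ones.\<close>

lemma dominated_path_integral:
  assumes "dominated K \<phi> (insert a B) G x" "a \<notin> B" "finite B" "a \<in> A" "G \<in> borel_measurable assignments"
  shows "dominated K \<phi> B (\<lambda>y. J a (\<lambda>w. G (y(a := w)))) x"
proof -
  obtain C where C: "\<And>y. (\<forall>b\<in>insert a B. y b \<in> K b) \<and> (\<forall>b. b \<notin> insert a B \<longrightarrow> y b = x b) \<longrightarrow>
     norm (G y) \<le> C * (\<Prod>b\<in>insert a B. \<phi> b (y b))"
    using assms(1) unfolding dominated_def by blast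
  show ?thesis
  proof (rule dominatedI[where C = "C * (\<integral>t. \<phi> a (p a t) * norm (q a t) \<partial>lborel)"])
    fix y assume y: "\<And>b. b \<in> B \<Longrightarrow> y b \<in> K b" "\<And>b. b \<notin> B \<Longrightarrow> y b = x b"
    define c where "c = C * (\<Prod>b\<in>B. \<phi> b (y b))"
    have le: "norm (G (y(a := w))) \<le> c * \<phi> a w" if "w \<in> K a" for w
    proof -
      have "norm (G (y(a := w))) \<le> C * (\<Prod>b\<in>insert a B. \<phi> b ((y(a := w)) b))"
        using C[of "y(a := w)"] y that by auto
      also have "(\<Prod>b\<in>insert a B. \<phi> b ((y(a := w)) b)) = \<phi> a w * (\<Prod>b\<in>B. \<phi> b (y b))"
        using assms(2,3) by (subst prod.insert) (auto intro!: prod.cong)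
      finally show ?thesis unfolding c_def by (simp only: mult.assoc mult.commute mult.left_commute)
    qed
    have "dominated K \<phi> {a} G y"
    proof (rule dominatedI[where C = c])
      fix z :: "'a \<Rightarrow> complex" assume z: "\<And>b. b \<in> {a} \<Longrightarrow> z b \<in> K b" "\<And>b. b \<notin> {a} \<Longrightarrow> z b = y b"
      then have "z = y(a := z a)" by (intro ext) auto
      then show "norm (G z) \<le> c * (\<Prod>b\<in>{a}. \<phi> b (z b))" using le[of "z a"] z by auto
    qed
    then have int: "integrable lborel (\<lambda>t. G (y(a := p a t)) * q a t)"
      using assms(4,5) by (intro integrable_section) auto
    have "norm (J a (\<lambda>w. G (y(a := w)))) \<le> (\<integral>t. c * (\<phi> a (p a t) * norm (q a t)) \<partial>lborel)"
      unfolding path_integral_def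
    proof (rule Bochner_Integration.integral_norm_bound_integral[OF int])
      show "norm (G (y(a := p a t)) * q a t) \<le> c * (\<phi> a (p a t) * norm (q a t))" for t
        using mult_right_mono[OF le[OF p_in[OF assms(4)], of t], of "norm (q a t)"] by (simp add: norm_mult mult.assoc)
    qed (intro integrable_mult_right integrable_\<phi> assms)
    then show "norm (J a (\<lambda>w. G (y(a := w)))) \<le>
        C * (\<integral>t. \<phi> a (p a t) * norm (q a t) \<partial>lborel) * (\<Prod>b\<in>B. \<phi> b (y b))"
      unfolding c_def integral_mult_right_zero by (simp only: mult.assoc mult.left_commute mult.commute)
  qed
qed

lemma dominated_iterated_integral:
  assumes "dominated K \<phi> (set as \<union> B) G x" "set as \<inter> B = {}" "distinct as" "finite B" "set as \<subseteq> A"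
    "G \<in> borel_measurable assignments"
  shows "dominated K \<phi> B (iterated_integral J as G) x"
  using assms
proof (induction as arbitrary: B)
  case (Cons a as)
  have "dominated K \<phi> (insert a B) (iterated_integral J as G) x"
    using Cons.prems by (intro Cons.IH) auto
  then have "dominated K \<phi> B (\<lambda>y. J a (\<lambda>w. iterated_integral J as G (y(a := w)))) x"
    using Cons.prems
    by (intro dominated_path_integral measurable_iterated_integral measurable_p measurable_q) auto
  then show ?case by simp
qed (simp add: iterated_integral_Nil_fun)

lemma integrable_product:
  assumes "dominated K \<phi> B G x" "B \<subseteq> A" "G \<in> borel_measurable assignments"
  shows "integrable (Pi\<^sub>M B (\<lambda>_. lborel)) (\<lambda>T. G (\<lambda>a. if a \<in> B then p a (T a) else x a) * (\<Prod>a\<in>B. q a (T a)))"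
proof -
  interpret product_sigma_finite "\<lambda>_::'a. lborel :: real measure"
    by (rule product_sigma_finite.intro) (rule sigma_finite_lborel)
  have fin: "finite B" using assms(2) finite_A finite_subset by blast
  obtain C where C: "\<And>y. (\<forall>b\<in>B. y b \<in> K b) \<and> (\<forall>b. b \<notin> B \<longrightarrow> y b = x b) \<longrightarrow>
     norm (G y) \<le> C * (\<Prod>b\<in>B. \<phi> b (y b))"
    using assms(1) unfolding dominated_def by blast
  have upd: "(\<lambda>T a. if a \<in> B then p a (T a) else x a) \<in> measurable (Pi\<^sub>M B (\<lambda>_. lborel)) assignments"
  proof (rule measurable_PiM_single')
    fix i
    show "(\<lambda>T. if i \<in> B then p i (T i) else x i) \<in> borel_measurable (Pi\<^sub>M B (\<lambda>_. lborel))"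
    proof (cases "i \<in> B")
      case True
      have "p i \<in> borel_measurable lborel" using measurable_p[of i] True assms(2) by auto
      from measurable_compose[OF measurable_component_singleton[OF True] this] True show ?thesis by simp
    qed simp
  qed (auto simp: space_PiM)
  show ?thesis
  proof (rule Bochner_Integration.integrable_bound)
    show "integrable (Pi\<^sub>M B (\<lambda>_. lborel)) (\<lambda>T. C * (\<Prod>a\<in>B. \<phi> a (p a (T a)) * norm (q a (T a))))"
      using integrable_\<phi> assms(2) fin by (intro integrable_mult_right product_integrable_prod) auto
    have qm: "(\<lambda>T. q a (T a)) \<in> borel_measurable (Pi\<^sub>M B (\<lambda>_. lborel))" if "a \<in> B" for a
    proof -
      have "q a \<in> borel_measurable lborel" using measurable_q[of a] that assms(2) by auto
      from measurable_compose[OF measurable_component_singleton[OF that] this] show ?thesis .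
    qed
    show "(\<lambda>T. G (\<lambda>a. if a \<in> B then p a (T a) else x a) * (\<Prod>a\<in>B. q a (T a)))
      \<in> borel_measurable (Pi\<^sub>M B (\<lambda>_. lborel))"
      using measurable_compose[OF upd assms(3)] qm by (intro borel_measurable_times borel_measurable_prod) auto
    have "norm (G (\<lambda>a. if a \<in> B then p a (T a) else x a) * (\<Prod>a\<in>B. q a (T a)))
       \<le> norm (C * (\<Prod>a\<in>B. \<phi> a (p a (T a)) * norm (q a (T a))))" for T
    proof -
      have "norm (G (\<lambda>a. if a \<in> B then p a (T a) else x a)) \<le> C * (\<Prod>b\<in>B. \<phi> b (if b \<in> B then p b (T b) else x b))"
        using C[of "\<lambda>a. if a \<in> B then p a (T a) else x a"] p_in assms(2) by auto
      also have "(\<Prod>b\<in>B. \<phi> b (if b \<in> B then p b (T b) else x b)) = (\<Prod>b\<in>B. \<phi> b (p b (T b)))"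
        by (intro prod.cong) auto
      finally have "norm (G (\<lambda>a. if a \<in> B then p a (T a) else x a)) * (\<Prod>a\<in>B. norm (q a (T a)))
          \<le> C * (\<Prod>b\<in>B. \<phi> b (p b (T b))) * (\<Prod>a\<in>B. norm (q a (T a)))"
        by (intro mult_right_mono prod_nonneg) auto
      then show ?thesis by (simp add: norm_mult prod_norm[symmetric] prod.distrib mult.assoc)
    qed
    then show "AE T in Pi\<^sub>M B (\<lambda>_. lborel). norm (G (\<lambda>a. if a \<in> B then p a (T a) else x a) * (\<Prod>a\<in>B. q a (T a)))
       \<le> norm (C * (\<Prod>a\<in>B. \<phi> a (p a (T a)) * norm (q a (T a))))" by simp
  qed
qed

text \<open>Induction from the inside: removing the last variable turns the innermost integral into
  a dominated function of the others, and the product measure gains that coordinate as its inner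
  integral.\<close>

lemma iterated_integral_eq_product:
  assumes "dominated K \<phi> (set as) G x" "set as \<subseteq> A" "distinct as" "G \<in> borel_measurable assignments"
  shows "iterated_integral J as G x =
    (\<integral>T. G (\<lambda>a. if a \<in> set as then p a (T a) else x a) * (\<Prod>a\<in>set as. q a (T a)) \<partial>Pi\<^sub>M (set as) (\<lambda>_. lborel))"
  using assms
proof (induction as arbitrary: G rule: rev_induct)
  case Nil
  then show ?case by (simp add: PiM_empty lebesgue_integral_count_space_finite)
next
  case (snoc a as)
  interpret product_sigma_finite "\<lambda>_::'a. lborel :: real measure"
    by (rule product_sigma_finite.intro) (rule sigma_finite_lborel)
  let ?G = "\<lambda>y. J a (\<lambda>w. G (y(a := w)))"
  have dom: "dominated K \<phi> (set as) ?G x"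
    using snoc.prems by (intro dominated_path_integral) auto
  have "iterated_integral J (as @ [a]) G x = iterated_integral J as ?G x"
    by (simp only: iterated_integral_append iterated_integral.simps[abs_def])
  also have "\<dots> = (\<integral>T. ?G (\<lambda>b. if b \<in> set as then p b (T b) else x b) * (\<Prod>b\<in>set as. q b (T b)) \<partial>Pi\<^sub>M (set as) (\<lambda>_. lborel))"
    using snoc.prems by (intro snoc.IH dom measurable_path_integral measurable_p measurable_q) auto
  also have "\<dots> = (\<integral>T. (\<integral>t. G (\<lambda>b. if b \<in> set (as @ [a]) then p b ((T(a := t)) b) else x b) *
       (\<Prod>b\<in>set (as @ [a]). q b ((T(a := t)) b)) \<partial>lborel) \<partial>Pi\<^sub>M (set as) (\<lambda>_. lborel))"
  proof (intro Bochner_Integration.integral_cong refl)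
    fix T :: "'a \<Rightarrow> real"
    have 1: "(\<lambda>b. if b \<in> set as then p b (T b) else x b)(a := p a t) =
        (\<lambda>b. if b \<in> set (as @ [a]) then p b ((T(a := t)) b) else x b)" for t
      using snoc.prems(3) by auto
    have 2: "(\<Prod>b\<in>set (as @ [a]). q b ((T(a := t)) b)) = q a t * (\<Prod>b\<in>set as. q b (T b))" for t
    proof -
      have "(\<Prod>b\<in>set as. q b ((T(a := t)) b)) = (\<Prod>b\<in>set as. q b (T b))"
        using snoc.prems(3) by (intro prod.cong) auto
      then show ?thesis using snoc.prems(3) by simp
    qed
    show "?G (\<lambda>b. if b \<in> set as then p b (T b) else x b) * (\<Prod>b\<in>set as. q b (T b)) =
      (\<integral>t. G (\<lambda>b. if b \<in> set (as @ [a]) then p b ((T(a := t)) b) else x b) *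
       (\<Prod>b\<in>set (as @ [a]). q b ((T(a := t)) b)) \<partial>lborel)"
      unfolding path_integral_def 1 2 integral_mult_left_zero[symmetric] by (simp add: mult.assoc)
  qed
  also have "\<dots> = (\<integral>T. G (\<lambda>b. if b \<in> set (as @ [a]) then p b (T b) else x b) * (\<Prod>b\<in>set (as @ [a]). q b (T b))
      \<partial>Pi\<^sub>M (insert a (set as)) (\<lambda>_. lborel))"
  proof (subst product_integral_insert)
    have "insert a (set as) = set (as @ [a])" by auto
    then show "integrable (Pi\<^sub>M (insert a (set as)) (\<lambda>_. lborel))
       (\<lambda>T. G (\<lambda>b. if b \<in> set (as @ [a]) then p b (T b) else x b) * (\<Prod>b\<in>set (as @ [a]). q b (T b)))"
      using integrable_product[of "set (as @ [a])" G x] snoc.prems by metis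
  qed (use snoc.prems in auto)
  finally show ?case by simp
qed

text \<open>Fubini: the product measure knows only the set of variables, not their order.\<close>

lemma iterated_integral_reorder:
  assumes "dominated K \<phi> (set as) G x" "set as \<subseteq> A" "distinct as" "G \<in> borel_measurable assignments"
    and "set bs = set as" "distinct bs"
  shows "iterated_integral J bs G x = iterated_integral J as G x"
  using assms by (simp add: iterated_integral_eq_product)

text \<open>Bochner integrals are additive on integrable functions, hence the domination of every
  summand.\<close>

lemma iterated_integral_sum:
  assumes "\<And>i. i \<in> I \<Longrightarrow> dominated K \<phi> (set as) (G i) x" "set as \<subseteq> A" "distinct as"
    "\<And>i. i \<in> I \<Longrightarrow> G i \<in> borel_measurable assignments"
  shows "iterated_integral J as (\<lambda>y. \<Sum>i\<in>I. G i y) x = (\<Sum>i\<in>I. iterated_integral J as (G i) x)"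
  using assms(1,4)
proof (induction I rule: infinite_finite_induct)
  have zero: "iterated_integral J as (\<lambda>y. 0) x = 0"
    by (induction as arbitrary: x) (auto simp: path_integral_def)
  case (infinite I) then show ?case using zero by simp
next
  have zero: "iterated_integral J as (\<lambda>y. 0) x = 0"
    by (induction as arbitrary: x) (auto simp: path_integral_def)
  case empty then show ?case using zero by simp
next
  case (insert i I)
  have dom_sum: "dominated K \<phi> (set as) (\<lambda>y. \<Sum>i\<in>I. G i y) x"
  proof -
    have "\<forall>i\<in>I. \<exists>C. \<forall>y. (\<forall>a\<in>set as. y a \<in> K a) \<and> (\<forall>a. a \<notin> set as \<longrightarrow> y a = x a) \<longrightarrow>
       norm (G i y) \<le> C * (\<Prod>a\<in>set as. \<phi> a (y a))"
      using insert.prems(1) unfolding dominated_def by blast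
    then obtain C where C: "\<And>i y. i \<in> I \<Longrightarrow> (\<forall>a\<in>set as. y a \<in> K a) \<and> (\<forall>a. a \<notin> set as \<longrightarrow> y a = x a) \<Longrightarrow>
       norm (G i y) \<le> C i * (\<Prod>a\<in>set as. \<phi> a (y a))"
      by metis
    show ?thesis
    proof (rule dominatedI[where C = "\<Sum>i\<in>I. C i"])
      fix y assume "\<And>a. a \<in> set as \<Longrightarrow> y a \<in> K a" "\<And>a. a \<notin> set as \<Longrightarrow> y a = x a"
      then have "norm (\<Sum>i\<in>I. G i y) \<le> (\<Sum>i\<in>I. C i * (\<Prod>a\<in>set as. \<phi> a (y a)))"
        by (intro sum_norm_le C) auto
      then show "norm (\<Sum>i\<in>I. G i y) \<le> (\<Sum>i\<in>I. C i) * (\<Prod>a\<in>set as. \<phi> a (y a))"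
        by (simp add: sum_distrib_right)
    qed
  qed
  have dom_all: "dominated K \<phi> (set as) (\<lambda>y. G i y + (\<Sum>i\<in>I. G i y)) x"
  proof -
    obtain C where C: "\<And>y. (\<forall>a\<in>set as. y a \<in> K a) \<and> (\<forall>a. a \<notin> set as \<longrightarrow> y a = x a) \<Longrightarrow>
       norm (G i y) \<le> C * (\<Prod>a\<in>set as. \<phi> a (y a))"
      using insert.prems(1)[of i] unfolding dominated_def by blast
    obtain C' where C': "\<And>y. (\<forall>a\<in>set as. y a \<in> K a) \<and> (\<forall>a. a \<notin> set as \<longrightarrow> y a = x a) \<Longrightarrow>
       norm (\<Sum>i\<in>I. G i y) \<le> C' * (\<Prod>a\<in>set as. \<phi> a (y a))"
      using dom_sum unfolding dominated_def by blast
    show ?thesis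
    proof (rule dominatedI[where C = "C + C'"])
      fix y assume "\<And>a. a \<in> set as \<Longrightarrow> y a \<in> K a" "\<And>a. a \<notin> set as \<Longrightarrow> y a = x a"
      then show "norm (G i y + (\<Sum>i\<in>I. G i y)) \<le> (C + C') * (\<Prod>a\<in>set as. \<phi> a (y a))"
        using norm_triangle_mono[OF C C', of y y] by (simp add: distrib_right)
    qed
  qed
  have meas_sum: "(\<lambda>y. \<Sum>i\<in>I. G i y) \<in> borel_measurable assignments"
    using insert.prems(2) by (intro borel_measurable_sum) auto
  have "iterated_integral J as (\<lambda>y. G i y + (\<Sum>i\<in>I. G i y)) x =
      iterated_integral J as (G i) x + iterated_integral J as (\<lambda>y. \<Sum>i\<in>I. G i y) x"
    using insert.prems dom_sum dom_all meas_sum assms(2,3)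
      Bochner_Integration.integral_add[OF integrable_product[OF insert.prems(1)[of i] assms(2) insert.prems(2)]
        integrable_product[OF dom_sum assms(2) meas_sum]]
    by (simp add: iterated_integral_eq_product distrib_right borel_measurable_add)
  then show ?case using insert by simp
qed

end

text \<open>Multilinear expansion: \<open>S\<close> is the set of variables that take the second
  path. The paths are required to be admissible for every \<open>S\<close> because each inner
  integral of the expansion has to be integrable in the next variable.\<close>

lemma iterated_integral_mixed:
  assumes A: "finite A" "set as \<subseteq> A" "distinct as"
    and P: "\<And>S. paths K \<phi> (\<lambda>a. if a \<in> S then p1 a else p0 a) (\<lambda>a. if a \<in> S then q1 a else q0 a) A"
    and G: "dominated K \<phi> (set as) G x" "G \<in> borel_measurable assignments"
  shows "iterated_integral (\<lambda>a g. k0 a * path_integral (p0 a) (q0 a) g + k1 a * path_integral (p1 a) (q1 a) g) as G x =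
    (\<Sum>S\<in>Pow (set as). (\<Prod>a\<in>set as. if a \<in> S then k1 a else k0 a) *
       iterated_integral (\<lambda>a. path_integral (if a \<in> S then p1 a else p0 a) (if a \<in> S then q1 a else q0 a)) as G x)"
  using A(2,3) G
proof (induction as arbitrary: x)
  case (Cons a as)
  let ?I = "\<lambda>S. iterated_integral (\<lambda>a. path_integral (if a \<in> S then p1 a else p0 a) (if a \<in> S then q1 a else q0 a))"
  let ?c = "\<lambda>S. \<Prod>a\<in>set as. if a \<in> S then k1 a else k0 a"
  interpret P0: paths K \<phi> p0 q0 A using P[of "{}"] by simp
  interpret P1: paths K \<phi> p1 q1 A using P[of UNIV] by simp
  have a: "a \<in> A" "a \<notin> set as" using Cons.prems by auto
  have IH: "iterated_integral (\<lambda>a g. k0 a * path_integral (p0 a) (q0 a) g + k1 a * path_integral (p1 a) (q1 a) g) as G (x(a := w)) =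
      (\<Sum>S\<in>Pow (set as). ?c S * ?I S as G (x(a := w)))" if "w \<in> K a" for w
  proof (rule Cons.IH)
    show "dominated K \<phi> (set as) G (x(a := w))"
      by (rule dominated_fix[OF Cons.prems(3)]) (use that in auto)
  qed (use Cons.prems in auto)
  have dom: "dominated K \<phi> {a} (?I S as G) x" and meas: "?I S as G \<in> borel_measurable assignments" for S
  proof -
    interpret S: paths K \<phi> "\<lambda>a. if a \<in> S then p1 a else p0 a" "\<lambda>a. if a \<in> S then q1 a else q0 a" A
      by (rule P)
    show "dominated K \<phi> {a} (?I S as G) x"
      using Cons.prems by (intro S.dominated_iterated_integral) auto
    show "?I S as G \<in> borel_measurable assignments"
      using Cons.prems by (intro measurable_iterated_integral S.measurable_p S.measurable_q) auto
  qed
  have lin: "path_integral p q (\<lambda>w. iterated_integral (\<lambda>a g. k0 a * path_integral (p0 a) (q0 a) g + k1 a * path_integral (p1 a) (q1 a) g) as G (x(a := w)))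
     = (\<Sum>S\<in>Pow (set as). ?c S * path_integral p q (\<lambda>w. ?I S as G (x(a := w))))"
    if "\<And>t. p t \<in> K a" "\<And>S. integrable lborel (\<lambda>t. ?I S as G (x(a := p t)) * q t)" for p q
  proof -
    have "path_integral p q (\<lambda>w. iterated_integral (\<lambda>a g. k0 a * path_integral (p0 a) (q0 a) g + k1 a * path_integral (p1 a) (q1 a) g) as G (x(a := w)))
      = (\<integral>t. (\<Sum>S\<in>Pow (set as). ?c S * (?I S as G (x(a := p t)) * q t)) \<partial>lborel)"
      unfolding path_integral_def[of p q] by (simp only: IH[OF that(1)] sum_distrib_right mult.assoc)
    also have "\<dots> = (\<Sum>S\<in>Pow (set as). (\<integral>t. ?c S * (?I S as G (x(a := p t)) * q t) \<partial>lborel))"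
      by (rule Bochner_Integration.integral_sum) (rule integrable_mult_right[OF that(2)])
    finally show ?thesis unfolding path_integral_def[of p q] by (simp only: integral_mult_right_zero)
  qed
  have lin0: "path_integral (p0 a) (q0 a) (\<lambda>w. iterated_integral (\<lambda>a g. k0 a * path_integral (p0 a) (q0 a) g + k1 a * path_integral (p1 a) (q1 a) g) as G (x(a := w)))
     = (\<Sum>S\<in>Pow (set as). ?c S * path_integral (p0 a) (q0 a) (\<lambda>w. ?I S as G (x(a := w))))"
    by (rule lin[OF P0.p_in[OF a(1)] P0.integrable_section[OF dom a(1) meas]])
  have lin1: "path_integral (p1 a) (q1 a) (\<lambda>w. iterated_integral (\<lambda>a g. k0 a * path_integral (p0 a) (q0 a) g + k1 a * path_integral (p1 a) (q1 a) g) as G (x(a := w)))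
     = (\<Sum>S\<in>Pow (set as). ?c S * path_integral (p1 a) (q1 a) (\<lambda>w. ?I S as G (x(a := w))))"
    by (rule lin[OF P1.p_in[OF a(1)] P1.integrable_section[OF dom a(1) meas]])
  \<comment> \<open>The subsets of \<open>set (a # as)\<close> fall into those without
    \<open>a\<close> and their images under \<open>insert a\<close>; the inner integrals do not
    notice \<open>a\<close>, which is not among their variables.\<close>
  have disj: "Pow (set as) \<inter> insert a ` Pow (set as) = {}" using a by auto
  have inj: "inj_on (insert a) (Pow (set as))" using a by (intro inj_onI) (metis PowD insert_ident subsetD)
  have I_insert: "?I (insert a S) as G y = ?I S as G y" for S y
  proof (rule iterated_integral_cong[where K = "\<lambda>_. UNIV"])
    fix b and g h :: "complex \<Rightarrow> complex" assume "b \<in> set as" "\<And>w. w \<in> UNIV \<Longrightarrow> g w = h w"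
    moreover from this have "g = h" by auto
    ultimately show "path_integral (if b \<in> insert a S then p1 b else p0 b) (if b \<in> insert a S then q1 b else q0 b) g =
       path_integral (if b \<in> S then p1 b else p0 b) (if b \<in> S then q1 b else q0 b) h" using a by auto
  qed auto
  have c_insert: "?c (insert a S) = ?c S" for S
    using a by (intro prod.cong) auto
  have "(\<Sum>S\<in>Pow (set (a # as)). (\<Prod>b\<in>set (a # as). if b \<in> S then k1 b else k0 b) * ?I S (a # as) G x)
     = (\<Sum>S\<in>Pow (set as). (\<Prod>b\<in>set (a # as). if b \<in> S then k1 b else k0 b) * ?I S (a # as) G x)
     + (\<Sum>S\<in>Pow (set as). (\<Prod>b\<in>set (a # as). if b \<in> insert a S then k1 b else k0 b) * ?I (insert a S) (a # as) G x)"
    using disj inj by (simp add: Pow_insert sum.union_disjoint sum.reindex)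
  also have "(\<Sum>S\<in>Pow (set as). (\<Prod>b\<in>set (a # as). if b \<in> S then k1 b else k0 b) * ?I S (a # as) G x)
     = k0 a * (\<Sum>S\<in>Pow (set as). ?c S * path_integral (p0 a) (q0 a) (\<lambda>w. ?I S as G (x(a := w))))"
    unfolding sum_distrib_left using a by (intro sum.cong) auto
  also have "(\<Sum>S\<in>Pow (set as). (\<Prod>b\<in>set (a # as). if b \<in> insert a S then k1 b else k0 b) * ?I (insert a S) (a # as) G x)
     = k1 a * (\<Sum>S\<in>Pow (set as). ?c S * path_integral (p1 a) (q1 a) (\<lambda>w. ?I S as G (x(a := w))))"
    unfolding sum_distrib_left
  proof (intro sum.cong refl)
    fix S
    have "(\<Prod>b\<in>set (a # as). if b \<in> insert a S then k1 b else k0 b) = k1 a * ?c S"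
      using a c_insert[of S] by simp
    moreover have "?I (insert a S) (a # as) G x = path_integral (p1 a) (q1 a) (\<lambda>w. ?I S as G (x(a := w)))"
      by (simp only: iterated_integral.simps I_insert) simp
    ultimately show "(\<Prod>b\<in>set (a # as). if b \<in> insert a S then k1 b else k0 b) * ?I (insert a S) (a # as) G x
        = k1 a * (?c S * path_integral (p1 a) (q1 a) (\<lambda>w. ?I S as G (x(a := w))))"
      by (simp only: mult.assoc)
  qed
  finally show ?case by (simp only: iterated_integral.simps lin0 lin1)
qed simp

text \<open>
  No integrability is needed beyond that behind \<open>lin\<close>: every inner integral is available in closed form.
\<close>

lemma iterated_integral_sum_prod:
  assumes "finite P" "distinct as"
    and lin: "\<And>a k h. a \<in> set as \<Longrightarrow> (\<And>i. i \<in> P \<Longrightarrow> good a (h i)) \<Longrightarrow>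
       J a (\<lambda>w. \<Sum>i\<in>P. k i * e i a w * h i w) = (\<Sum>i\<in>P. k i * \<kappa> i a * h i (b i a))"
    and H: "\<And>a y. a \<in> set as \<Longrightarrow> (\<And>c. c \<notin> set as \<Longrightarrow> y c = x c) \<Longrightarrow> good a (\<lambda>w. H (y(a := w)))"
  shows "iterated_integral J as (\<lambda>y. \<Sum>i\<in>P. k i * (\<Prod>a\<in>set as. e i a (y a)) * H y) x =
    (\<Sum>i\<in>P. k i * (\<Prod>a\<in>set as. \<kappa> i a) * H (\<lambda>c. if c \<in> set as then b i c else x c))"
  using assms(2) lin H
proof (induction as arbitrary: x k)
  case (Cons a as)
  have a: "a \<notin> set as" using Cons.prems by simp
  let ?y = "\<lambda>i. \<lambda>c. if c \<in> set as then b i c else x c"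
  have "iterated_integral J as (\<lambda>y. \<Sum>i\<in>P. k i * (\<Prod>c\<in>set (a # as). e i c (y c)) * H y) (x(a := w))
      = (\<Sum>i\<in>P. (k i * (\<Prod>c\<in>set as. \<kappa> i c)) * e i a w * H ((?y i)(a := w)))" for w
  proof -
    \<comment> \<open>With the outer variable fixed at \<open>w\<close>, its factor
      \<open>e i a w\<close> joins the coefficient; this is why the induction runs over arbitrary
      \<open>k\<close>.\<close>
    have "iterated_integral J as (\<lambda>y. \<Sum>i\<in>P. k i * (\<Prod>c\<in>set (a # as). e i c (y c)) * H y) (x(a := w))
       = iterated_integral J as (\<lambda>y. \<Sum>i\<in>P. (k i * e i a w) * (\<Prod>c\<in>set as. e i c (y c)) * H y) (x(a := w))"
    proof (rule iterated_integral_cong[where K = "\<lambda>_. UNIV"])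
      fix c and g h :: "complex \<Rightarrow> complex" assume "c \<in> set as" "\<And>w. w \<in> UNIV \<Longrightarrow> g w = h w"
      moreover from this have "g = h" by auto
      ultimately show "J c g = J c h" by simp
    next
      fix y assume "\<And>c. c \<notin> set as \<Longrightarrow> y c = (x(a := w)) c"
      then have "y a = w" using a by simp
      then show "(\<Sum>i\<in>P. k i * (\<Prod>c\<in>set (a # as). e i c (y c)) * H y) =
          (\<Sum>i\<in>P. k i * e i a w * (\<Prod>c\<in>set as. e i c (y c)) * H y)"
        using a by (simp add: mult.assoc)
    qed
    also have "\<dots> = (\<Sum>i\<in>P. (k i * e i a w) * (\<Prod>c\<in>set as. \<kappa> i c) * H (\<lambda>c. if c \<in> set as then b i c else (x(a := w)) c))"
    proof (rule Cons.IH)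
      fix c y assume "c \<in> set as" "\<And>d. d \<notin> set as \<Longrightarrow> y d = (x(a := w)) d"
      then show "good c (\<lambda>w. H (y(c := w)))" by (intro Cons.prems(3)) auto
    qed (use Cons.prems in auto)
    also have "\<dots> = (\<Sum>i\<in>P. (k i * (\<Prod>c\<in>set as. \<kappa> i c)) * e i a w * H ((?y i)(a := w)))"
    proof (intro sum.cong refl)
      fix i
      have "(\<lambda>c. if c \<in> set as then b i c else (x(a := w)) c) = (?y i)(a := w)"
        using a by auto
      then show "(k i * e i a w) * (\<Prod>c\<in>set as. \<kappa> i c) * H (\<lambda>c. if c \<in> set as then b i c else (x(a := w)) c) =
        (k i * (\<Prod>c\<in>set as. \<kappa> i c)) * e i a w * H ((?y i)(a := w))" by (simp add: ac_simps)
    qed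
    finally show ?thesis .
  qed
  then have "iterated_integral J (a # as) (\<lambda>y. \<Sum>i\<in>P. k i * (\<Prod>c\<in>set (a # as). e i c (y c)) * H y) x
     = J a (\<lambda>w. \<Sum>i\<in>P. (k i * (\<Prod>c\<in>set as. \<kappa> i c)) * e i a w * H ((?y i)(a := w)))"
    by simp
  also have "\<dots> = (\<Sum>i\<in>P. (k i * (\<Prod>c\<in>set as. \<kappa> i c)) * \<kappa> i a * H ((?y i)(a := b i a)))"
    by (rule Cons.prems(2)) (auto intro: Cons.prems(3))
  also have "\<dots> = (\<Sum>i\<in>P. k i * (\<Prod>c\<in>set (a # as). \<kappa> i c) * H (\<lambda>c. if c \<in> set (a # as) then b i c else x c))"
  proof (intro sum.cong refl)
    fix i
    have "(?y i)(a := b i a) = (\<lambda>c. if c \<in> set (a # as) then b i c else x c)" by auto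
    then show "(k i * (\<Prod>c\<in>set as. \<kappa> i c)) * \<kappa> i a * H ((?y i)(a := b i a)) =
       k i * (\<Prod>c\<in>set (a # as). \<kappa> i c) * H (\<lambda>c. if c \<in> set (a # as) then b i c else x c)"
      using a by (simp add: ac_simps)
  qed
  finally show ?case .
qed (auto intro!: sum.cong)

section \<open>Integrals along unbounded contours\<close>

lemma eventually_at_both_ends:
  fixes P :: "real \<Rightarrow> bool"
  assumes "eventually P at_top" "eventually P at_bot"
  obtains T where "T > 0" "\<And>t. T \<le> \<bar>t\<bar> \<Longrightarrow> P t"
proof -
  obtain T1 where T1: "\<And>t. t \<ge> T1 \<Longrightarrow> P t" using assms(1) unfolding eventually_at_top_linorder by blast
  obtain T2 where T2: "\<And>t. t \<le> T2 \<Longrightarrow> P t" using assms(2) unfolding eventually_at_bot_linorder by blast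
  show ?thesis
    by (rule that[of "max 1 (max \<bar>T1\<bar> \<bar>T2\<bar>)"]) (use T1 T2 in \<open>fastforce simp: abs_if split: if_splits\<close>)+
qed

lemma unbounded_contour_continuous:
  assumes "unbounded_contour \<theta> \<gamma>" shows "continuous_on UNIV \<gamma>"
proof (rule continuous_at_imp_continuous_on, rule ballI)
  fix t :: real
  have "\<gamma> piecewise_C1_differentiable_on {t-1..t+1}" using assms by (auto simp: unbounded_contour_def)
  then have "continuous_on {t-1..t+1} \<gamma>" by (simp add: piecewise_C1_differentiable_on_def)
  then show "isCont \<gamma> t"
    by (rule continuous_on_interior) (auto simp: interior_atLeastAtMost_real)
qed

lemma unbounded_contour_large:
  assumes "unbounded_contour \<theta> \<gamma>"
  obtains T where "T > 0" "\<And>t. T \<le> \<bar>t\<bar> \<Longrightarrow> B \<le> norm (\<gamma> t)"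
proof -
  have "eventually (\<lambda>t. B \<le> norm (\<gamma> t)) at_top" "eventually (\<lambda>t. B \<le> norm (\<gamma> t)) at_bot"
    using assms filterlim_at_infinity_imp_norm_at_top[of \<gamma> at_top] filterlim_at_infinity_imp_norm_at_top[of \<gamma> at_bot]
    unfolding unbounded_contour_def filterlim_at_top by blast+
  then show ?thesis using that by (rule eventually_at_both_ends)
qed

lemma unbounded_contour_compact_part:
  assumes "unbounded_contour \<theta> \<gamma>"
  obtains M where "\<And>t. \<bar>t\<bar> \<le> T \<Longrightarrow> norm (\<gamma> t) \<le> M"
proof -
  have "compact (\<gamma> ` {-T..T})"
    using unbounded_contour_continuous[OF assms] by (intro compact_continuous_image) (auto intro: continuous_on_subset)
  then obtain M where "\<And>w. w \<in> \<gamma> ` {-T..T} \<Longrightarrow> norm w \<le> M"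
    by (meson bounded_iff compact_imp_bounded)
  then show ?thesis by (intro that[of M]) (auto simp: abs_le_iff)
qed

text \<open>Near a given point the range is that of a compact arc, since both tails leave every
  ball. The complement is therefore open, and its connected components are path components.\<close>

lemma unbounded_contour_closed_range:
  assumes "unbounded_contour \<theta> \<gamma>" shows "closed (range \<gamma>)"
proof -
  have "l \<in> range \<gamma>" if l: "l \<in> closure (range \<gamma>)" for l
  proof -
    obtain T where T: "T > 0" "\<And>t. T \<le> \<bar>t\<bar> \<Longrightarrow> norm l + 1 \<le> norm (\<gamma> t)"
      using unbounded_contour_large[OF assms] by blast
    have "range \<gamma> \<subseteq> \<gamma> ` {-T..T} \<union> - ball 0 (norm l + 1)"
    proof
      fix w assume "w \<in> range \<gamma>"
      then obtain t where t: "w = \<gamma> t" by blast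
      show "w \<in> \<gamma> ` {-T..T} \<union> - ball 0 (norm l + 1)"
        using T(2)[of t] unfolding t by (cases "\<bar>t\<bar> \<le> T") (auto simp: abs_le_iff)
    qed
    moreover have "compact (\<gamma> ` {-T..T})"
      using unbounded_contour_continuous[OF assms] by (intro compact_continuous_image) (auto intro: continuous_on_subset)
    ultimately have "closure (range \<gamma>) \<subseteq> \<gamma> ` {-T..T} \<union> - ball 0 (norm l + 1)"
      by (intro closure_minimal closed_Un) (auto intro: compact_imp_closed)
    then show ?thesis using l by auto
  qed
  then show ?thesis using closure_subset by (metis closure_eq subsetI subset_antisym)
qed

text \<open>The derivative is continuous off the union of the finite exceptional sets of the
  intervals \<open>{-k..k}\<close>, which is countable.\<close>

lemma unbounded_contour_derivative_measurable:
  assumes "unbounded_contour \<theta> \<gamma>"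
  shows "(\<lambda>t. vector_derivative \<gamma> (at t)) \<in> borel_measurable borel"
proof -
  have "\<exists>S. finite S \<and> \<gamma> C1_differentiable_on ({-real k..real k} - S)" for k :: nat
    using assms by (auto simp: unbounded_contour_def piecewise_C1_differentiable_on_def)
  then obtain S where S: "\<And>k. finite (S k)" "\<And>k::nat. \<gamma> C1_differentiable_on ({-real k..real k} - S k)"
    by metis
  let ?X = "\<Union>k. S k"
  have "countable ?X" using S(1) by (auto intro: countable_finite)
  moreover have "continuous_on (- ?X) (\<lambda>t. vector_derivative \<gamma> (at t))"
  proof (rule continuous_on_subset)
    show "continuous_on (\<Union>k. {-real k<..<real k} - ?X) (\<lambda>t. vector_derivative \<gamma> (at t))"
      unfolding continuous_on_eq_continuous_within
    proof
      fix t assume "t \<in> (\<Union>k. {-real k<..<real k} - ?X)"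
      then obtain k where k: "t \<in> {-real k<..<real k}" "t \<notin> ?X" by blast
      have "continuous_on ({-real k..real k} - S k) (\<lambda>t. vector_derivative \<gamma> (at t))"
        using S(2)[of k] by (simp add: C1_differentiable_on_eq)
      then have "continuous (at t within ({-real k..real k} - S k)) (\<lambda>t. vector_derivative \<gamma> (at t))"
        using k unfolding continuous_on_eq_continuous_within by auto
      then have "continuous (at t within ({-real k<..<real k} \<inter> (\<Union>k. {-real k<..<real k} - ?X))) (\<lambda>t. vector_derivative \<gamma> (at t))"
        by (rule continuous_within_subset) auto
      moreover have "at t within ({-real k<..<real k} \<inter> (\<Union>k. {-real k<..<real k} - ?X)) = at t within (\<Union>k. {-real k<..<real k} - ?X)"
        using k by (intro at_within_nhd[of _ "{-real k<..<real k}"]) auto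
      ultimately show "continuous (at t within (\<Union>k. {-real k<..<real k} - ?X)) (\<lambda>t. vector_derivative \<gamma> (at t))"
        by simp
    qed
    show "- ?X \<subseteq> (\<Union>k. {-real k<..<real k} - ?X)"
    proof
      fix t assume "t \<in> - ?X"
      moreover obtain k :: nat where "\<bar>t\<bar> < real k" using reals_Archimedean2 by blast
      ultimately show "t \<in> (\<Union>k. {-real k<..<real k} - ?X)" by (auto simp: abs_less_iff intro!: exI[of _ k])
    qed
  qed
  ultimately show ?thesis by (rule borel_measurable_continuous_countable_exceptions)
qed

text \<open>The rate \<open>K\<close> in the definition of an unbounded contour is not under
  control, so \<open>g\<close> is asked to decay faster than every exponential.\<close>

lemma unbounded_contour_integrable:
  assumes "unbounded_contour \<theta> \<gamma>"
    and "\<And>K. \<exists>C. \<forall>t. g (\<gamma> t) \<le> C * exp (- K * norm (\<gamma> t))" "\<And>t. 0 \<le> g (\<gamma> t)"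
    and "(\<lambda>t. g (\<gamma> t)) \<in> borel_measurable borel"
  shows "integrable lborel (\<lambda>t. g (\<gamma> t) * norm (vector_derivative \<gamma> (at t)))"
proof -
  obtain K where K: "integrable lborel (\<lambda>t. exp (- K * norm (\<gamma> t)) * norm (vector_derivative \<gamma> (at t)))"
    using assms(1) by (auto simp: unbounded_contour_def)
  obtain C where C: "\<And>t. g (\<gamma> t) \<le> C * exp (- K * norm (\<gamma> t))" using assms(2) by blast
  note [measurable] = assms(4) unbounded_contour_derivative_measurable[OF assms(1)]
  show ?thesis
  proof (rule Bochner_Integration.integrable_bound[OF integrable_mult_right[OF K, of C]])
    have "norm (g (\<gamma> t) * norm (vector_derivative \<gamma> (at t))) \<le>
       norm (C * (exp (- K * norm (\<gamma> t)) * norm (vector_derivative \<gamma> (at t))))" for t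
    proof -
      have "norm (g (\<gamma> t) * norm (vector_derivative \<gamma> (at t))) = g (\<gamma> t) * norm (vector_derivative \<gamma> (at t))"
        using assms(3) by simp
      also have "\<dots> \<le> (C * exp (- K * norm (\<gamma> t))) * norm (vector_derivative \<gamma> (at t))"
        using C by (intro mult_right_mono) auto
      finally show ?thesis by (simp add: mult.assoc)
    qed
    then show "AE t in lborel. norm (g (\<gamma> t) * norm (vector_derivative \<gamma> (at t))) \<le>
       norm (C * (exp (- K * norm (\<gamma> t)) * norm (vector_derivative \<gamma> (at t))))" by simp
  qed measurable
qed

text \<open>Relates path integrals over the unit interval to integrals in the original parameter.
  The factor \<open>b - a\<close> from the chain rule cancels the Jacobian; the finitely many
  parameters without derivative form a null set.\<close>

lemma has_contour_integral_affine:
  assumes "a < b" "\<gamma> piecewise_C1_differentiable_on {a..b}"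
    and "(f has_contour_integral I) (\<gamma> \<circ> (\<lambda>s. (b - a) *\<^sub>R s + a))"
  shows "((\<lambda>t. f (\<gamma> t) * vector_derivative \<gamma> (at t)) has_integral I) {a..b}"
proof -
  let ?q = "\<gamma> \<circ> (\<lambda>s. (b - a) *\<^sub>R s + a)"
  obtain S where S: "finite S" "\<gamma> C1_differentiable_on ({a..b} - S)"
    using assms(2) by (auto simp: piecewise_C1_differentiable_on_def)
  have diff: "(\<gamma> has_vector_derivative vector_derivative \<gamma> (at t)) (at t)" if "t \<in> {a..b} - S" for t
    using S(2) that by (simp add: C1_differentiable_on_eq vector_derivative_works)
  let ?S' = "(\<lambda>t. (t - a) / (b - a)) ` S"
  have vd: "vector_derivative ?q (at s) = (b - a) *\<^sub>R vector_derivative \<gamma> (at ((b - a) *\<^sub>R s + a))"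
    if s: "s \<in> {0..1} - ?S'" for s
  proof (rule vector_derivative_at)
    have "(b - a) * s + a \<in> {a..b} - S"
    proof -
      have "(b - a) * s + a \<notin> S"
      proof
        assume "(b - a) * s + a \<in> S"
        then have "((b - a) * s + a - a) / (b - a) \<in> ?S'" by (rule imageI)
        then show False using s assms(1) by simp
      qed
      moreover have "(b - a) * s \<le> b - a" using s assms(1) by (intro mult_left_le) auto
      moreover have "0 \<le> (b - a) * s" using s assms(1) by simp
      ultimately show ?thesis by simp
    qed
    then have "(\<gamma> has_vector_derivative vector_derivative \<gamma> (at ((b - a) *\<^sub>R s + a))) (at ((b - a) *\<^sub>R s + a))"
      using diff by simp
    moreover have "((\<lambda>s. (b - a) *\<^sub>R s + a) has_vector_derivative (b - a)) (at s)"
      unfolding has_real_derivative_iff_has_vector_derivative[symmetric]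
      by (auto intro!: derivative_eq_intros)
    ultimately show "(?q has_vector_derivative (b - a) *\<^sub>R vector_derivative \<gamma> (at ((b - a) *\<^sub>R s + a))) (at s)"
      by (intro vector_diff_chain_at)
  qed
  have "((\<lambda>s. f (?q s) * vector_derivative ?q (at s)) has_integral I) {0..1}"
    using assms(3) by (simp add: has_contour_integral)
  then have "((\<lambda>s. f (\<gamma> ((b - a) *\<^sub>R s + a)) * ((b - a) *\<^sub>R vector_derivative \<gamma> (at ((b - a) *\<^sub>R s + a)))) has_integral I) {0..1}"
  proof (rule has_integral_spike_finite[of ?S', rotated 2])
    show "finite ?S'" using S(1) by simp
  qed (simp only: vd o_apply)
  then have "((\<lambda>s. (\<lambda>t. f (\<gamma> t) * ((b - a) *\<^sub>R vector_derivative \<gamma> (at t))) ((b - a) *\<^sub>R s + a)) has_integral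
      (((b - a) *\<^sub>R I) /\<^sub>R (b - a) ^ DIM(real))) (cbox ((a - a) /\<^sub>R (b - a)) ((b - a) /\<^sub>R (b - a)))"
    using assms(1) by simp
  then have "((\<lambda>t. f (\<gamma> t) * ((b - a) *\<^sub>R vector_derivative \<gamma> (at t))) has_integral ((b - a) *\<^sub>R I)) (cbox a b)"
    using assms(1) by (subst (asm) has_integral_affinity_iff) auto
  from has_integral_cmul[OF this, of "inverse (b - a)"] show ?thesis
    using assms(1) by simp
qed

section \<open>Gaussian decay in a sector\<close>

definition slope :: real where "slope = (1 + tan (pi / 5)) / 2"

text \<open>The half opening lies strictly between pi/5 and pi/4. The first bound makes the tails of
  the right contours enter the sector, the second keeps the real part of \<open>w^2\<close> above a
  positive multiple of \<open>(norm w)^2\<close>.\<close>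

definition sector :: "complex set" where
  "sector = {w. 0 < Re w \<and> \<bar>Im w\<bar> \<le> slope * Re w}"

text \<open>Holomorphy is asked on the half plane, where the middle part of a contour may wander;
  decay is asked in the sector, which contains the tails and, being convex, the chords that close
  them off.\<close>

definition decaying :: "(complex \<Rightarrow> complex) \<Rightarrow> bool" where
  "decaying h \<longleftrightarrow> h holomorphic_on {w. 0 < Re w} \<and>
     (\<exists>C \<delta>. 0 < \<delta> \<and> (\<forall>w\<in>sector. norm (h w) \<le> C * exp (- \<delta> * (norm w)\<^sup>2)))"

lemma slope_bounds: "0 < slope" "slope < 1" "tan (pi / 5) < slope"
proof -
  have "- (pi / 2) < pi / 5" using pi_gt_zero by linarith
  then have "tan (pi / 5) < tan (pi / 4)" by (intro tan_monotone) auto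
  then have "tan (pi / 5) < 1" by (simp add: tan_45)
  moreover have "0 < tan (pi / 5)" by (rule tan_gt_zero) auto
  ultimately show "0 < slope" "slope < 1" "tan (pi / 5) < slope" by (auto simp: slope_def)
qed

lemma convex_sector: "convex sector"
proof -
  have "sector = {w. Re w > 0} \<inter> {w. Im w - slope * Re w \<le> 0} \<inter> {w. - Im w - slope * Re w \<le> 0}"
    by (auto simp: sector_def abs_le_iff)
  moreover have "convex {w. Im w - slope * Re w \<le> 0}"
    using convex_halfspace_le[of "Complex (- slope) 1" 0] by (simp add: inner_complex_def algebra_simps)
  moreover have "convex {w. - Im w - slope * Re w \<le> 0}"
    using convex_halfspace_le[of "Complex (- slope) (- 1)" 0] by (simp add: inner_complex_def algebra_simps)
  ultimately show ?thesis using convex_halfspace_Re_gt[of 0] by (metis convex_Int)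
qed

lemma sector_norm_le:
  assumes "w \<in> sector" shows "norm w \<le> 2 * Re w"
proof -
  have "\<bar>Im w\<bar> \<le> Re w"
    using assms slope_bounds(2) mult_right_mono[of slope 1 "Re w"] unfolding sector_def mem_Collect_eq mult_1
    by linarith
  then show ?thesis using cmod_le[of w] assms by (auto simp: sector_def)
qed

text \<open>Here \<open>(Im w)^2\<close> is at most \<open>slope^2 * (Re w)^2\<close>, which leaves
  \<open>(1 - slope^2) * (Re w)^2\<close> for the real part of the square; and
  \<open>(Re w)^2\<close> is at least half of \<open>(norm w)^2\<close>.\<close>

lemma sector_Re_square:
  assumes "w \<in> sector" shows "(1 - slope\<^sup>2) / 2 * (norm w)\<^sup>2 \<le> Re (w\<^sup>2)"
proof -
  have "\<bar>Im w\<bar>\<^sup>2 \<le> (slope * Re w)\<^sup>2"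
    using assms by (intro power_mono) (auto simp: sector_def)
  then have 1: "(Im w)\<^sup>2 \<le> slope\<^sup>2 * (Re w)\<^sup>2" by (simp add: power_mult_distrib)
  have s: "slope\<^sup>2 < 1" using slope_bounds by (simp add: power_less_one_iff abs_square_less_1)
  then have "slope\<^sup>2 * (Re w)\<^sup>2 \<le> (Re w)\<^sup>2" by (intro mult_left_le_one_le) auto
  then have "(norm w)\<^sup>2 \<le> 2 * (Re w)\<^sup>2" using 1 by (simp add: cmod_power2)
  then have "(1 - slope\<^sup>2) / 2 * (norm w)\<^sup>2 \<le> (1 - slope\<^sup>2) / 2 * (2 * (Re w)\<^sup>2)"
    using s by (intro mult_left_mono) auto
  also have "\<dots> = (Re w)\<^sup>2 - slope\<^sup>2 * (Re w)\<^sup>2" by (simp add: field_simps)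
  also have "\<dots> \<le> (Re w)\<^sup>2 - (Im w)\<^sup>2" using 1 by simp
  finally show ?thesis by (simp add: Re_power2)
qed

text \<open>The limiting directions satisfy the inequalities of the sector strictly, because
  \<open>slope\<close> exceeds \<open>tan (pi / 5)\<close>; hence the directions far out satisfy
  them too.\<close>

lemma unbounded_contour_eventually_sector:
  assumes "unbounded_contour (pi / 5) \<gamma>"
  shows "eventually (\<lambda>t. \<gamma> t \<in> sector \<and> 0 < Im (\<gamma> t)) at_top"
    and "eventually (\<lambda>t. \<gamma> t \<in> sector \<and> Im (\<gamma> t) < 0) at_bot"
proof -
  have c: "0 < cos (pi / 5)" "0 < sin (pi / 5)" by (auto intro!: cos_gt_zero sin_gt_zero)
  then have sc: "sin (pi / 5) < slope * cos (pi / 5)"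
    using slope_bounds(3) by (simp add: tan_def field_simps)
  have sgn_eq: "Re z = norm z * Re (sgn z)" "Im z = norm z * Im (sgn z)" for z :: complex
    by (cases "z = 0"; simp add: sgn_eq)+
  have sec: "z \<in> sector" if "0 < Re (sgn z)" "\<bar>Im (sgn z)\<bar> < slope * Re (sgn z)" for z
  proof -
    have n: "0 < norm z" using that(1) by (cases "z = 0") auto
    have "\<bar>Im z\<bar> = norm z * \<bar>Im (sgn z)\<bar>" by (subst sgn_eq(2)) (simp add: abs_mult)
    also have "\<dots> \<le> norm z * (slope * Re (sgn z))" using that(2) by (intro mult_left_mono) auto
    also have "\<dots> = slope * Re z" by (subst (2) sgn_eq(1)) simp
    finally have "\<bar>Im z\<bar> \<le> slope * Re z" .
    moreover have "0 < Re z" using n that(1) by (simp add: zero_less_divide_iff)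
    ultimately show ?thesis by (simp add: sector_def)
  qed
  \<comment> \<open>The sign \<open>e\<close> of the imaginary part at the end in question lets one
    argument serve both ends.\<close>
  have main: "eventually (\<lambda>t. \<gamma> t \<in> sector \<and> 0 < e * Im (\<gamma> t)) F"
    if lim: "((\<lambda>t. sgn (\<gamma> t)) \<longlongrightarrow> cis (e * (pi / 5))) F" and e: "e = 1 \<or> e = -1" for e and F :: "real filter"
  proof -
    have re: "((\<lambda>t. Re (sgn (\<gamma> t))) \<longlongrightarrow> cos (pi / 5)) F"
      using tendsto_Re[OF lim] e by auto
    have im: "((\<lambda>t. e * Im (sgn (\<gamma> t))) \<longlongrightarrow> sin (pi / 5)) F"
      using tendsto_mult_left[OF tendsto_Im[OF lim], of e] e by auto
    have dif: "((\<lambda>t. slope * Re (sgn (\<gamma> t)) - e * Im (sgn (\<gamma> t))) \<longlongrightarrow> slope * cos (pi / 5) - sin (pi / 5)) F"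
      by (intro tendsto_diff tendsto_mult_left re im)
    have "eventually (\<lambda>t. 0 < slope * Re (sgn (\<gamma> t)) - e * Im (sgn (\<gamma> t))) F"
      by (rule order_tendstoD(1)[OF dif]) (use sc in simp)
    with order_tendstoD(1)[OF re c(1)] order_tendstoD(1)[OF im c(2)] show ?thesis
    proof eventually_elim
      case (elim t)
      have "\<bar>Im (sgn (\<gamma> t))\<bar> = e * Im (sgn (\<gamma> t))"
        using e elim(2) by (elim disjE; hypsubst; linarith)
      then have "\<gamma> t \<in> sector" using elim by (intro sec) linarith+
      moreover have "0 < norm (\<gamma> t) * (e * Im (sgn (\<gamma> t)))"
        using elim(2) by (cases "\<gamma> t = 0") (auto simp only: zero_less_norm_iff sgn_zero zero_complex.sel mult_zero_right less_irrefl intro: mult_pos_pos)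
      then have "0 < e * Im (\<gamma> t)" using sgn_eq(2)[of "\<gamma> t"] by (metis mult.left_commute)
      ultimately show ?case ..
    qed
  qed
  show "eventually (\<lambda>t. \<gamma> t \<in> sector \<and> 0 < Im (\<gamma> t)) at_top"
    using main[of 1 at_top] assms by (simp add: unbounded_contour_def)
  show "eventually (\<lambda>t. \<gamma> t \<in> sector \<and> Im (\<gamma> t) < 0) at_bot"
    using main[of "-1" at_bot] assms by (simp add: unbounded_contour_def)
qed

text \<open>The intermediate value theorem gives both truncation points the same modulus
  \<open>n\<close>. The chord between them then has length at most \<open>2 * n\<close> and, in the
  sector, a distance from the origin comparable to \<open>n\<close>.\<close>

lemma unbounded_contour_truncation:
  assumes "unbounded_contour \<theta> \<gamma>"
  obtains s t :: "nat \<Rightarrow> real"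
  where "filterlim s at_bot sequentially" "filterlim t at_top sequentially"
    "eventually (\<lambda>n. norm (\<gamma> (s n)) = real n \<and> norm (\<gamma> (t n)) = real n) sequentially"
proof -
  have cont: "continuous_on UNIV (\<lambda>t. norm (\<gamma> t))"
    using unbounded_contour_continuous[OF assms] by (intro continuous_intros) auto
  have ex_t: "\<exists>t\<ge>0. norm (\<gamma> t) = real n" if "norm (\<gamma> 0) \<le> real n" for n
  proof -
    obtain T where T: "T > 0" "\<And>t. T \<le> \<bar>t\<bar> \<Longrightarrow> real n \<le> norm (\<gamma> t)"
      using unbounded_contour_large[OF assms] by blast
    have "\<exists>t. 0 \<le> t \<and> t \<le> T \<and> norm (\<gamma> t) = real n"
      using T that by (intro IVT') (auto intro: continuous_on_subset[OF cont])
    then show ?thesis by blast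
  qed
  have ex_s: "\<exists>s\<le>0. norm (\<gamma> s) = real n" if "norm (\<gamma> 0) \<le> real n" for n
  proof -
    obtain T where T: "T > 0" "\<And>t. T \<le> \<bar>t\<bar> \<Longrightarrow> real n \<le> norm (\<gamma> t)"
      using unbounded_contour_large[OF assms] by blast
    have "\<exists>t. - T \<le> t \<and> t \<le> 0 \<and> norm (\<gamma> t) = real n"
      using T that by (intro IVT2') (auto intro: continuous_on_subset[OF cont])
    then show ?thesis by blast
  qed
  define t where "t n = (SOME t. t \<ge> 0 \<and> norm (\<gamma> t) = real n)" for n
  define s where "s n = (SOME s. s \<le> 0 \<and> norm (\<gamma> s) = real n)" for n
  have t: "t n \<ge> 0" "norm (\<gamma> (t n)) = real n" if "norm (\<gamma> 0) \<le> real n" for n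
    using someI_ex[OF ex_t[OF that, unfolded Bex_def]] by (auto simp: t_def)
  have s: "s n \<le> 0" "norm (\<gamma> (s n)) = real n" if "norm (\<gamma> 0) \<le> real n" for n
    using someI_ex[OF ex_s[OF that, unfolded Bex_def]] by (auto simp: s_def)
  have big: "eventually (\<lambda>n. norm (\<gamma> 0) \<le> real n) sequentially"
    by (rule filterlim_real_sequentially[unfolded filterlim_at_top, rule_format])
  show ?thesis
  proof
    show "filterlim t at_top sequentially"
      unfolding filterlim_at_top
    proof
      fix Z
      \<comment> \<open>On a bounded parameter interval the modulus is bounded, so truncation times
        of large modulus must leave it.\<close>
      obtain M where M: "\<And>t. \<bar>t\<bar> \<le> \<bar>Z\<bar> \<Longrightarrow> norm (\<gamma> t) \<le> M"
        using unbounded_contour_compact_part[OF assms] by blast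
      have "eventually (\<lambda>n. M + 1 \<le> real n) sequentially"
        by (rule filterlim_real_sequentially[unfolded filterlim_at_top, rule_format])
      with big show "eventually (\<lambda>n. Z \<le> t n) sequentially"
      proof eventually_elim
        case (elim n)
        then have "\<not> \<bar>t n\<bar> \<le> \<bar>Z\<bar>" using M[of "t n"] t[of n] by auto
        then show ?case using t(1)[of n] elim by auto
      qed
    qed
    show "filterlim s at_bot sequentially"
      unfolding filterlim_at_bot
    proof
      fix Z
      obtain M where M: "\<And>t. \<bar>t\<bar> \<le> \<bar>Z\<bar> \<Longrightarrow> norm (\<gamma> t) \<le> M"
        using unbounded_contour_compact_part[OF assms] by blast
      have "eventually (\<lambda>n. M + 1 \<le> real n) sequentially"
        by (rule filterlim_real_sequentially[unfolded filterlim_at_top, rule_format])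
      with big show "eventually (\<lambda>n. s n \<le> Z) sequentially"
      proof eventually_elim
        case (elim n)
        then have "\<not> \<bar>s n\<bar> \<le> \<bar>Z\<bar>" using M[of "s n"] s[of n] by auto
        then show ?case using s(1)[of n] elim by auto
      qed
    qed
    show "eventually (\<lambda>n. norm (\<gamma> (s n)) = real n \<and> norm (\<gamma> (t n)) = real n) sequentially"
      using big by eventually_elim (use s t in auto)
  qed
qed

text \<open>On a right contour the arc is run through upwards and the chord, far to the right,
  downwards. The loop is thus clockwise, which is the origin of the minus sign of the
  residues.\<close>

definition truncated_loop :: "(real \<Rightarrow> complex) \<Rightarrow> real \<Rightarrow> real \<Rightarrow> real \<Rightarrow> complex" where
  "truncated_loop \<gamma> s t = (\<gamma> \<circ> (\<lambda>u. (t - s) *\<^sub>R u + s)) +++ linepath (\<gamma> t) (\<gamma> s)"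

lemma affine_image_unit: "s < t \<Longrightarrow> (\<lambda>u::real. (t - s) * u + s) ` {0..1} = {s..t}"
  by (subst image_affinity_atLeastAtMost) (auto simp: algebra_simps)

lemma truncated_arc:
  assumes "\<gamma> piecewise_C1_differentiable_on {s..t}" "s < t"
  shows "valid_path (\<gamma> \<circ> (\<lambda>u. (t - s) *\<^sub>R u + s))"
    "path_image (\<gamma> \<circ> (\<lambda>u. (t - s) *\<^sub>R u + s)) = \<gamma> ` {s..t}"
    "pathstart (\<gamma> \<circ> (\<lambda>u. (t - s) *\<^sub>R u + s)) = \<gamma> s" "pathfinish (\<gamma> \<circ> (\<lambda>u. (t - s) *\<^sub>R u + s)) = \<gamma> t"
proof -
  show "valid_path (\<gamma> \<circ> (\<lambda>u. (t - s) *\<^sub>R u + s))"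
    unfolding valid_path_def using assms
    by (intro piecewise_C1_differentiable_affine) (simp add: affine_image_unit)
  show "path_image (\<gamma> \<circ> (\<lambda>u. (t - s) *\<^sub>R u + s)) = \<gamma> ` {s..t}"
    unfolding affine_image_unit[OF assms(2), symmetric] path_image_def by (simp add: image_image)
qed (auto simp: pathstart_def pathfinish_def)

lemma truncated_loop:
  assumes "\<gamma> piecewise_C1_differentiable_on {s..t}" "s < t"
  shows "valid_path (truncated_loop \<gamma> s t)" "pathfinish (truncated_loop \<gamma> s t) = pathstart (truncated_loop \<gamma> s t)"
    "path_image (truncated_loop \<gamma> s t) = \<gamma> ` {s..t} \<union> closed_segment (\<gamma> t) (\<gamma> s)"
  using truncated_arc[OF assms]
  by (auto simp: truncated_loop_def path_image_join intro!: valid_path_join)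

lemma unbounded_contour_bound:
  assumes "unbounded_contour \<theta> \<gamma>" "continuous_on (range \<gamma>) g"
    and "eventually (\<lambda>t. norm (g (\<gamma> t)) * exp (K * norm (\<gamma> t)) \<le> C) at_top"
    and "eventually (\<lambda>t. norm (g (\<gamma> t)) * exp (K * norm (\<gamma> t)) \<le> C) at_bot"
  shows "\<exists>C. \<forall>t. norm (g (\<gamma> t)) \<le> C * exp (- K * norm (\<gamma> t))"
proof -
  obtain T where T: "T > 0" "\<And>t. T \<le> \<bar>t\<bar> \<Longrightarrow> norm (g (\<gamma> t)) * exp (K * norm (\<gamma> t)) \<le> C"
    using eventually_at_both_ends[OF assms(3,4)] by metis
  have c: "continuous_on {-T..T} \<gamma>" using unbounded_contour_continuous[OF assms(1)] continuous_on_subset by blast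
  then have "continuous_on {-T..T} (\<lambda>t. g (\<gamma> t))"
    by (rule continuous_on_compose2[OF assms(2)]) auto
  then have "compact ((\<lambda>t. norm (g (\<gamma> t)) * exp (K * norm (\<gamma> t))) ` {-T..T})"
    using c by (intro compact_continuous_image continuous_intros) auto
  then obtain M where M: "\<And>y. y \<in> (\<lambda>t. norm (g (\<gamma> t)) * exp (K * norm (\<gamma> t))) ` {-T..T} \<Longrightarrow> norm y \<le> M"
    by (meson bounded_iff compact_imp_bounded)
  have "norm (g (\<gamma> t)) \<le> max C M * exp (- K * norm (\<gamma> t))" for t
  proof -
    have "norm (g (\<gamma> t)) * exp (K * norm (\<gamma> t)) \<le> max C M"
    proof (cases "T \<le> \<bar>t\<bar>")
      case True then show ?thesis using T(2)[of t] by simp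
    next
      case False
      then have "t \<in> {-T..T}" by auto
      from M[OF imageI[OF this]] show ?thesis by (simp add: abs_mult)
    qed
    then show ?thesis by (simp add: exp_minus field_simps)
  qed
  then show ?thesis by blast
qed

text \<open>Complete the square: the exponent \<open>K * r - \<delta> * r^2\<close> is largest at
  \<open>r = K / (2 * \<delta>)\<close>.\<close>

lemma gaussian_le_exponential:
  fixes \<delta> K r :: real
  assumes "0 < \<delta>"
  shows "exp (- \<delta> * r\<^sup>2) * exp (K * r) \<le> exp (K\<^sup>2 / (4 * \<delta>))"
proof -
  have "0 \<le> (2 * \<delta> * r - K)\<^sup>2" by simp
  then have "4 * \<delta> * (K * r - \<delta> * r\<^sup>2) \<le> K\<^sup>2" by (simp add: power2_eq_square algebra_simps)
  then have "K * r - \<delta> * r\<^sup>2 \<le> K\<^sup>2 / (4 * \<delta>)" using assms by (simp add: field_simps)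
  then show ?thesis by (simp add: exp_add[symmetric])
qed

text \<open>The radius \<open>\<rho>\<close> excludes the neighbourhood of a possible pole, where a
  Gaussian estimate may fail; on the part of the curve that remains, compactness gives a
  bound.\<close>

lemma right_contour_gaussian_bound:
  assumes "unbounded_contour (pi / 5) \<gamma>" "continuous_on (range \<gamma>) g"
    and "0 < \<delta>" "\<And>w. w \<in> sector \<Longrightarrow> \<rho> \<le> norm w \<Longrightarrow> norm (g w) \<le> C * exp (- \<delta> * (norm w)\<^sup>2)"
  shows "\<exists>C. \<forall>t. norm (g (\<gamma> t)) \<le> C * exp (- K * norm (\<gamma> t))"
proof -
  obtain T where T: "T > 0" "\<And>t. T \<le> \<bar>t\<bar> \<Longrightarrow> \<rho> \<le> norm (\<gamma> t)"
    using unbounded_contour_large[OF assms(1)] by blast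
  have le: "norm (g (\<gamma> t)) * exp (K * norm (\<gamma> t)) \<le> \<bar>C\<bar> * exp (K\<^sup>2 / (4 * \<delta>))"
    if "\<gamma> t \<in> sector" "T \<le> \<bar>t\<bar>" for t
  proof -
    have "norm (g (\<gamma> t)) \<le> C * exp (- \<delta> * (norm (\<gamma> t))\<^sup>2)" using assms(4) T(2) that by blast
    also have "\<dots> \<le> \<bar>C\<bar> * exp (- \<delta> * (norm (\<gamma> t))\<^sup>2)" by (intro mult_right_mono) auto
    finally have "norm (g (\<gamma> t)) * exp (K * norm (\<gamma> t)) \<le> \<bar>C\<bar> * exp (- \<delta> * (norm (\<gamma> t))\<^sup>2) * exp (K * norm (\<gamma> t))"
      by (intro mult_right_mono) auto
    also have "\<dots> \<le> \<bar>C\<bar> * exp (K\<^sup>2 / (4 * \<delta>))"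
      unfolding mult.assoc by (intro mult_left_mono gaussian_le_exponential assms(3)) auto
    finally show ?thesis .
  qed
  show ?thesis
  proof (rule unbounded_contour_bound[OF assms(1,2)])
    show "eventually (\<lambda>t. norm (g (\<gamma> t)) * exp (K * norm (\<gamma> t)) \<le> \<bar>C\<bar> * exp (K\<^sup>2 / (4 * \<delta>))) at_top"
      using unbounded_contour_eventually_sector(1)[OF assms(1)] eventually_ge_at_top[of T]
      by eventually_elim (intro le, auto)
    show "eventually (\<lambda>t. norm (g (\<gamma> t)) * exp (K * norm (\<gamma> t)) \<le> \<bar>C\<bar> * exp (K\<^sup>2 / (4 * \<delta>))) at_bot"
      using unbounded_contour_eventually_sector(2)[OF assms(1)] eventually_le_at_bot[of "-T"]
      by eventually_elim (intro le, auto)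
  qed
qed

lemma contour_function_measurable:
  assumes "unbounded_contour \<theta> \<gamma>" "continuous_on (range \<gamma>) g"
  shows "(\<lambda>t. g (\<gamma> t)) \<in> borel_measurable borel"
  by (rule borel_measurable_continuous_onI)
    (rule continuous_on_compose2[OF assms(2) unbounded_contour_continuous[OF assms(1)]], simp)

lemma contour_integrable:
  fixes g :: "complex \<Rightarrow> complex"
  assumes "unbounded_contour \<theta> \<gamma>" "continuous_on (range \<gamma>) g"
    and "\<And>K. \<exists>C. \<forall>t. norm (g (\<gamma> t)) \<le> C * exp (- K * norm (\<gamma> t))"
  shows "integrable lborel (\<lambda>t. g (\<gamma> t) * vector_derivative \<gamma> (at t))"
proof (rule integrable_norm_cancel)
  have "continuous_on (range \<gamma>) (\<lambda>w. norm (g w))" using assms(2) by (intro continuous_intros)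
  then have "integrable lborel (\<lambda>t. norm (g (\<gamma> t)) * norm (vector_derivative \<gamma> (at t)))"
    using assms by (intro unbounded_contour_integrable contour_function_measurable) auto
  then show "integrable lborel (\<lambda>t. norm (g (\<gamma> t) * vector_derivative \<gamma> (at t)))"
    by (simp add: norm_mult)
  show "(\<lambda>t. g (\<gamma> t) * vector_derivative \<gamma> (at t)) \<in> borel_measurable lborel"
    using contour_function_measurable[OF assms(1,2)] unbounded_contour_derivative_measurable[OF assms(1)]
    by measurable
qed

text \<open>Truncate the contour and close it by chords. The loop integrals all equal
  \<open>W\<close> once the ends are far out, the arcs converge to the line integral by dominated
  convergence, and the chords contribute nothing in the limit.\<close>

lemma line_integral_eq_loop:
  assumes \<gamma>: "unbounded_contour (pi / 5) \<gamma>"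
    and g: "continuous_on (range \<gamma>) g" "0 < \<delta>"
      "\<And>w. w \<in> sector \<Longrightarrow> \<rho> \<le> norm w \<Longrightarrow> norm (g w) \<le> C * exp (- \<delta> * (norm w)\<^sup>2)"
    and loop: "\<And>s t. s < t \<Longrightarrow> \<gamma> s \<in> sector \<Longrightarrow> \<gamma> t \<in> sector \<Longrightarrow> Im (\<gamma> s) < 0 \<Longrightarrow> 0 < Im (\<gamma> t) \<Longrightarrow>
       R \<le> norm (\<gamma> s) \<Longrightarrow> R \<le> norm (\<gamma> t) \<Longrightarrow> (g has_contour_integral W) (truncated_loop \<gamma> s t)"
  shows "line_integral \<gamma> g = W"
proof -
  let ?f = "\<lambda>t. g (\<gamma> t) * vector_derivative \<gamma> (at t)"
  have int: "integrable lborel ?f"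
    using right_contour_gaussian_bound[OF \<gamma> g] by (intro contour_integrable[OF \<gamma> g(1)])
  obtain s t where st: "filterlim s at_bot sequentially" "filterlim t at_top sequentially"
    and nst: "eventually (\<lambda>n. norm (\<gamma> (s n)) = real n \<and> norm (\<gamma> (t n)) = real n) sequentially"
    using unbounded_contour_truncation[OF \<gamma>] by metis
  have lim1: "(\<lambda>n. \<integral>u. indicator {s n..t n} u *\<^sub>R ?f u \<partial>lborel) \<longlonglongrightarrow> (\<integral>u. ?f u \<partial>lborel)"
  proof (rule integral_dominated_convergence[where w = "\<lambda>u. norm (?f u)"])
    show "AE u in lborel. (\<lambda>n. indicator {s n..t n} u *\<^sub>R ?f u) \<longlonglongrightarrow> ?f u"
    proof (rule AE_I2)
      fix u
      have "eventually (\<lambda>n. s n \<le> u) sequentially" "eventually (\<lambda>n. u \<le> t n) sequentially"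
        using st unfolding filterlim_at_bot filterlim_at_top by blast+
      then have "eventually (\<lambda>n. indicator {s n..t n} u *\<^sub>R ?f u = ?f u) sequentially"
        by eventually_elim auto
      then show "(\<lambda>n. indicator {s n..t n} u *\<^sub>R ?f u) \<longlonglongrightarrow> ?f u"
        by (rule tendsto_eventually)
    qed
    show "AE u in lborel. norm (indicator {s n..t n} u *\<^sub>R ?f u) \<le> norm (?f u)" for n
      by (auto simp: indicator_def)
    show "?f \<in> borel_measurable lborel" using int by (rule borel_measurable_integrable)
    then show "(\<lambda>u. indicator {s n..t n} u *\<^sub>R ?f u) \<in> borel_measurable lborel" for n
      by measurable
    show "integrable lborel (\<lambda>u. norm (?f u))" using int by (rule integrable_norm)
  qed
  \<comment> \<open>The chord has length at most \<open>2 * n\<close>. Its points have real part at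
    least \<open>n / 2\<close>, since its ends do by \<open>sector_norm_le\<close>, and there the
    Gaussian bound applies.\<close>
  define B where "B n = \<bar>C\<bar> * exp (- \<delta> * (real n / 2)\<^sup>2) * (2 * real n)" for n
  have B: "B \<longlonglongrightarrow> 0"
    unfolding B_def using g(2) by real_asymp
  have "eventually (\<lambda>n. norm ((\<integral>u. indicator {s n..t n} u *\<^sub>R ?f u \<partial>lborel) - W) \<le> B n) sequentially"
  proof -
    have "eventually (\<lambda>n. \<gamma> (s n) \<in> sector \<and> Im (\<gamma> (s n)) < 0) sequentially"
      "eventually (\<lambda>n. \<gamma> (t n) \<in> sector \<and> 0 < Im (\<gamma> (t n))) sequentially"
      "eventually (\<lambda>n. s n \<le> -1) sequentially" "eventually (\<lambda>n. 1 \<le> t n) sequentially"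
      "eventually (\<lambda>n. max R (2 * \<rho>) \<le> real n) sequentially"
      using eventually_compose_filterlim[OF unbounded_contour_eventually_sector(1)[OF \<gamma>] st(2)]
        eventually_compose_filterlim[OF unbounded_contour_eventually_sector(2)[OF \<gamma>] st(1)]
        st filterlim_real_sequentially
      unfolding filterlim_at_bot filterlim_at_top by blast+
    then show ?thesis using nst
    proof eventually_elim
      case (elim n)
      then have lt: "s n < t n" by simp
      have pw: "\<gamma> piecewise_C1_differentiable_on {s n..t n}" using \<gamma> by (simp add: unbounded_contour_def)
      let ?q = "\<gamma> \<circ> (\<lambda>u. (t n - s n) *\<^sub>R u + s n)" and ?l = "linepath (\<gamma> (t n)) (\<gamma> (s n))"
      have W: "(g has_contour_integral W) (?q +++ ?l)"
        using loop[of "s n" "t n"] elim lt by (auto simp: truncated_loop_def)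
      have v: "valid_path ?q" using truncated_arc(1)[OF pw lt] .
      then have ig: "g contour_integrable_on ?q" "g contour_integrable_on ?l"
        using has_contour_integral_integrable[OF W] by (auto simp: contour_integrable_join)
      have Weq: "W = contour_integral ?q g + contour_integral ?l g"
        using contour_integral_unique[OF W] contour_integral_join[OF ig v] by simp
      have "((\<lambda>u. ?f u) has_integral contour_integral ?q g) {s n..t n}"
        by (rule has_contour_integral_affine[OF lt pw has_contour_integral_integral[OF ig(1)]])
      then have "(\<integral>u. indicator {s n..t n} u *\<^sub>R ?f u \<partial>lborel) = contour_integral ?q g"
        using set_borel_integral_eq_integral(2)[of "{s n..t n}" ?f] int
        by (simp add: set_lebesgue_integral_def set_integrable_def integrable_mult_indicator integral_unique)
      then have "norm ((\<integral>u. indicator {s n..t n} u *\<^sub>R ?f u \<partial>lborel) - W) = norm (contour_integral ?l g)"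
        by (simp add: Weq)
      also have "\<dots> \<le> (\<bar>C\<bar> * exp (- \<delta> * (real n / 2)\<^sup>2)) * norm (\<gamma> (s n) - \<gamma> (t n))"
      proof (rule contour_integral_bound_linepath[OF ig(2)])
        fix w assume w: "w \<in> closed_segment (\<gamma> (t n)) (\<gamma> (s n))"
        have ws: "w \<in> sector"
          using closed_segment_subset[OF _ _ convex_sector, of "\<gamma> (t n)" "\<gamma> (s n)"] elim w by blast
        have "real n / 2 \<le> Re (\<gamma> (t n))" "real n / 2 \<le> Re (\<gamma> (s n))"
          using sector_norm_le[of "\<gamma> (t n)"] sector_norm_le[of "\<gamma> (s n)"] elim by auto
        then have "closed_segment (\<gamma> (t n)) (\<gamma> (s n)) \<subseteq> {w. Re w \<ge> real n / 2}"
          by (intro closed_segment_subset convex_halfspace_Re_ge) auto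
        then have nw: "real n / 2 \<le> norm w" using w complex_Re_le_cmod[of w] by auto
        then have "norm (g w) \<le> C * exp (- \<delta> * (norm w)\<^sup>2)" using g(3)[OF ws] elim by auto
        also have "\<dots> \<le> \<bar>C\<bar> * exp (- \<delta> * (norm w)\<^sup>2)" by (intro mult_right_mono) auto
        also have "\<dots> \<le> \<bar>C\<bar> * exp (- \<delta> * (real n / 2)\<^sup>2)"
          using power_mono[OF nw, of 2] g(2) by (intro mult_left_mono) auto
        finally show "norm (g w) \<le> \<bar>C\<bar> * exp (- \<delta> * (real n / 2)\<^sup>2)" .
      qed simp
      also have "\<dots> \<le> B n"
        unfolding B_def using norm_triangle_ineq4[of "\<gamma> (s n)" "\<gamma> (t n)"] elim
        by (intro mult_left_mono) auto
      finally show ?case .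
    qed
  qed
  then have "(\<lambda>n. (\<integral>u. indicator {s n..t n} u *\<^sub>R ?f u \<partial>lborel) - W) \<longlonglongrightarrow> 0"
    using B by (rule Lim_null_comparison)
  then have "(\<lambda>n. \<integral>u. indicator {s n..t n} u *\<^sub>R ?f u \<partial>lborel) \<longlonglongrightarrow> W"
    by (simp add: LIM_zero_iff)
  from LIMSEQ_unique[OF lim1 this] show ?thesis by (simp add: line_integral_def)
qed

lemma right_contour_loop_subset:
  assumes "range \<gamma> \<subseteq> {w. 0 < Re w}"
  shows "\<gamma> ` {s..t} \<union> closed_segment (\<gamma> t) (\<gamma> s) \<subseteq> {w. 0 < Re w}"
  using assms closed_segment_subset[OF _ _ convex_halfspace_Re_gt[of 0], of "\<gamma> t" "\<gamma> s"]
  by (intro Un_least) (auto simp: image_subset_iff)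

lemma line_integral_decaying:
  assumes \<gamma>: "unbounded_contour (pi / 5) \<gamma>" "range \<gamma> \<subseteq> {w. 0 < Re w}" and h: "decaying h"
  shows "line_integral \<gamma> h = 0"
proof -
  obtain C \<delta> where C: "0 < \<delta>" "\<And>w. w \<in> sector \<Longrightarrow> norm (h w) \<le> C * exp (- \<delta> * (norm w)\<^sup>2)"
    using h by (auto simp: decaying_def)
  have hol: "h holomorphic_on {w. 0 < Re w}" using h by (simp add: decaying_def)
  show ?thesis
  proof (rule line_integral_eq_loop[OF \<gamma>(1) _ C(1) C(2)])
    show "continuous_on (range \<gamma>) h"
      using holomorphic_on_imp_continuous_on[OF hol] \<gamma>(2) continuous_on_subset by blast
    fix s t :: real assume "s < t"
    then show "(h has_contour_integral 0) (truncated_loop \<gamma> s t)"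
      using truncated_loop[of \<gamma> s t] \<gamma> right_contour_loop_subset[OF \<gamma>(2), of s t]
      by (intro Cauchy_theorem_convex_simple[OF hol convex_halfspace_Re_gt]) (auto simp: unbounded_contour_def)
  qed
qed

section \<open>Winding numbers of the truncated loops\<close>

lemma segment_in_sector_far:
  assumes "u \<in> sector" "v \<in> sector" "R \<le> norm u" "R \<le> norm v" "w \<in> closed_segment u v"
  shows "R / 2 \<le> Re w"
proof -
  have "closed_segment u v \<subseteq> {w. Re w \<ge> R / 2}"
    using sector_norm_le[OF assms(1)] sector_norm_le[OF assms(2)] assms(3,4)
    by (intro closed_segment_subset convex_halfspace_Re_ge) auto
  then show ?thesis using assms(5) by auto
qed

text \<open>A path from \<open>b\<close> to \<open>x\<close> off the curve is compact, hence also
  avoids a chord that is far enough out, and the winding number is constant along it. So one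
  convenient reference point on each side of the curve is enough.\<close>

lemma winding_number_loop_connected:
  assumes \<gamma>: "unbounded_contour (pi / 5) \<gamma>" and conn: "connected_component (- range \<gamma>) b x"
  obtains R where "\<And>s t. s < t \<Longrightarrow> \<gamma> s \<in> sector \<Longrightarrow> \<gamma> t \<in> sector \<Longrightarrow> R \<le> norm (\<gamma> s) \<Longrightarrow> R \<le> norm (\<gamma> t) \<Longrightarrow>
     winding_number (truncated_loop \<gamma> s t) b = winding_number (truncated_loop \<gamma> s t) x \<and>
     b \<notin> path_image (truncated_loop \<gamma> s t) \<and> x \<notin> path_image (truncated_loop \<gamma> s t)"
proof -
  have "open (- range \<gamma>)" using unbounded_contour_closed_range[OF \<gamma>] by auto
  then have "path_component (- range \<gamma>) b x"
    using conn path_component_eq_connected_component[OF open_imp_locally_path_connected] by metis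
  then obtain q where q: "path q" "path_image q \<subseteq> - range \<gamma>" "pathstart q = b" "pathfinish q = x"
    unfolding path_component_def by blast
  obtain M where M: "\<And>w. w \<in> path_image q \<Longrightarrow> norm w \<le> M"
    using bounded_path_image[OF q(1)] unfolding bounded_iff by blast
  show ?thesis
  \<comment> \<open>In the sector a chord with ends of modulus at least \<open>2 * (M + 1)\<close>
    stays at real part at least \<open>M + 1\<close>, beyond the path, which lies in the ball of
    radius \<open>M\<close>.\<close>
  proof (rule that[of "2 * (M + 1)"])
    fix s t assume st: "s < t" "\<gamma> s \<in> sector" "\<gamma> t \<in> sector" "2 * (M + 1) \<le> norm (\<gamma> s)" "2 * (M + 1) \<le> norm (\<gamma> t)"
    have pw: "\<gamma> piecewise_C1_differentiable_on {s..t}" using \<gamma> by (simp add: unbounded_contour_def)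
    note L = truncated_loop[OF pw st(1)]
    have disj: "path_image q \<inter> path_image (truncated_loop \<gamma> s t) = {}"
    proof -
      have "w \<notin> closed_segment (\<gamma> t) (\<gamma> s)" if "w \<in> path_image q" for w
        using M[OF that] segment_in_sector_far[OF st(3,2,5,4), of w] complex_Re_le_cmod[of w] by fastforce
      then show ?thesis using q(2) unfolding L(3) by blast
    qed
    have mem: "b \<in> path_image q" "x \<in> path_image q" using q by auto
    have "winding_number (truncated_loop \<gamma> s t) b = winding_number (truncated_loop \<gamma> s t) x"
      by (rule winding_number_eq[OF valid_path_imp_path[OF L(1)] L(2) mem connected_path_image[OF q(1)] disj])
    then show "winding_number (truncated_loop \<gamma> s t) b = winding_number (truncated_loop \<gamma> s t) x \<and>
     b \<notin> path_image (truncated_loop \<gamma> s t) \<and> x \<notin> path_image (truncated_loop \<gamma> s t)"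
      using disj mem by blast
  qed
qed

text \<open>The tails are off the real axis, so all crossings come from a compact part of the curve.
  Real points beyond \<open>X\<close> serve as reference points for the right side.\<close>

lemma right_contour_avoids_ray:
  assumes \<gamma>: "unbounded_contour (pi / 5) \<gamma>"
  obtains X where "\<And>t. Im (\<gamma> t) = 0 \<Longrightarrow> Re (\<gamma> t) < X"
proof -
  have "eventually (\<lambda>t. Im (\<gamma> t) \<noteq> 0) at_top" "eventually (\<lambda>t. Im (\<gamma> t) \<noteq> 0) at_bot"
    using unbounded_contour_eventually_sector[OF \<gamma>] by (auto elim!: eventually_mono)
  then obtain T where T: "T > 0" "\<And>t. T \<le> \<bar>t\<bar> \<Longrightarrow> Im (\<gamma> t) \<noteq> 0"
    using eventually_at_both_ends[of "\<lambda>t. Im (\<gamma> t) \<noteq> 0"] by blast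
  obtain M where M: "\<And>t. \<bar>t\<bar> \<le> T \<Longrightarrow> norm (\<gamma> t) \<le> M" using unbounded_contour_compact_part[OF \<gamma>] by blast
  show ?thesis
  proof (rule that[of "M + 1"])
    fix t assume "Im (\<gamma> t) = 0"
    then have "norm (\<gamma> t) \<le> M" using T(2)[of t] M[of t] by force
    then show "Re (\<gamma> t) < M + 1" using complex_Re_le_cmod[of "\<gamma> t"] by simp
  qed
qed

text \<open>
  The arc has the primitive \<open>Ln (x - w)\<close> and the closing segment \<open>Ln (w - x)\<close>; the two branches
  differ by \<open>- \<i> \<pi>\<close> at the upper and \<open>\<i> \<pi>\<close> at the lower end point.
\<close>

lemma winding_number_loop_inside:
  assumes \<gamma>: "unbounded_contour (pi / 5) \<gamma>" and x: "\<And>t. Im (\<gamma> t) = 0 \<Longrightarrow> Re (\<gamma> t) < x"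
    and st: "s < t" "\<gamma> s \<in> sector" "\<gamma> t \<in> sector" "Im (\<gamma> s) < 0" "0 < Im (\<gamma> t)"
      "2 * (\<bar>x\<bar> + 1) \<le> norm (\<gamma> s)" "2 * (\<bar>x\<bar> + 1) \<le> norm (\<gamma> t)"
  shows "winding_number (truncated_loop \<gamma> s t) (of_real x) = -1"
proof -
  have pw: "\<gamma> piecewise_C1_differentiable_on {s..t}" using \<gamma> by (simp add: unbounded_contour_def)
  let ?q = "\<gamma> \<circ> (\<lambda>u. (t - s) *\<^sub>R u + s)" and ?l = "linepath (\<gamma> t) (\<gamma> s)"
  note L = truncated_loop[OF pw st(1)] and Q = truncated_arc[OF pw st(1)]
  have seg: "x < Re w" if "w \<in> closed_segment (\<gamma> t) (\<gamma> s)" for w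
    using segment_in_sector_far[OF st(3,2,7,6) that] by simp
  \<comment> \<open>The curve crosses the real line to the left of \<open>x\<close> only, so along
    it \<open>x - w\<close> avoids the branch cut of the logarithm.\<close>
  have cut: "of_real x - \<gamma> u \<notin> \<real>\<^sub>\<le>\<^sub>0" for u
    using x[of u] by (auto simp: complex_nonpos_Reals_iff)
  have "((\<lambda>w. 1 / (w - of_real x)) has_contour_integral (Ln (of_real x - pathfinish ?q) - Ln (of_real x - pathstart ?q))) ?q"
  proof (rule contour_integral_primitive[of "{w. complex_of_real x - w \<notin> \<real>\<^sub>\<le>\<^sub>0}"])
    show "path_image ?q \<subseteq> {w. complex_of_real x - w \<notin> \<real>\<^sub>\<le>\<^sub>0}" unfolding Q(2) using cut by auto
    fix w assume w: "w \<in> {w. complex_of_real x - w \<notin> \<real>\<^sub>\<le>\<^sub>0}"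
    then have "w \<noteq> of_real x" by auto
    then show "((\<lambda>w. Ln (of_real x - w)) has_field_derivative 1 / (w - of_real x)) (at w within {w. complex_of_real x - w \<notin> \<real>\<^sub>\<le>\<^sub>0})"
      using w by (auto intro!: derivative_eq_intros simp: field_simps)
  qed (rule Q)
  then have iq: "((\<lambda>w. 1 / (w - of_real x)) has_contour_integral (Ln (of_real x - \<gamma> t) - Ln (of_real x - \<gamma> s))) ?q"
    by (simp only: Q)
  have "((\<lambda>w. 1 / (w - of_real x)) has_contour_integral (Ln (pathfinish ?l - of_real x) - Ln (pathstart ?l - of_real x))) ?l"
  proof (rule contour_integral_primitive[of "{w. x < Re w}"])
    fix w assume w: "w \<in> {w. x < Re w}"
    then have "w \<noteq> of_real x" "w - of_real x \<notin> \<real>\<^sub>\<le>\<^sub>0" by (auto simp: complex_nonpos_Reals_iff)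
    then show "((\<lambda>w. Ln (w - of_real x)) has_field_derivative 1 / (w - of_real x)) (at w within {w. x < Re w})"
      by (auto intro!: derivative_eq_intros simp: field_simps)
  qed (use seg in auto)
  then have il: "((\<lambda>w. 1 / (w - of_real x)) has_contour_integral (Ln (\<gamma> s - of_real x) - Ln (\<gamma> t - of_real x))) ?l"
    by simp
  have t: "Ln (of_real x - \<gamma> t) = Ln (\<gamma> t - of_real x) - \<i> * pi"
    using Ln_minus[of "\<gamma> t - of_real x"] st(5) by (auto simp: complex_eq_iff)
  have s: "Ln (of_real x - \<gamma> s) = Ln (\<gamma> s - of_real x) + \<i> * pi"
    using Ln_minus[of "\<gamma> s - of_real x"] st(4) by (auto simp: complex_eq_iff)
  have "contour_integral (truncated_loop \<gamma> s t) (\<lambda>w. 1 / (w - of_real x)) = - 2 * pi * \<i>"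
    unfolding truncated_loop_def
    using contour_integral_unique[OF has_contour_integral_join[OF iq il Q(1)]] by (simp add: s t)
  moreover have "complex_of_real x \<noteq> \<gamma> u" for u
    using x[of u] by (metis Im_complex_of_real Re_complex_of_real less_irrefl)
  then have "complex_of_real x \<notin> path_image (truncated_loop \<gamma> s t)"
    using seg[of "of_real x"] unfolding L(3) by auto
  ultimately show ?thesis using winding_number_valid_path[OF L(1)] by simp
qed

lemma line_integral_pole:
  assumes \<gamma>: "unbounded_contour (pi / 5) \<gamma>" "range \<gamma> \<subseteq> {w. 0 < Re w}" and h: "decaying h"
    and b: "0 < Re b" "b \<notin> range \<gamma>"
    and wn: "\<And>s t. s < t \<Longrightarrow> \<gamma> s \<in> sector \<Longrightarrow> \<gamma> t \<in> sector \<Longrightarrow> Im (\<gamma> s) < 0 \<Longrightarrow> 0 < Im (\<gamma> t) \<Longrightarrow>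
       R \<le> norm (\<gamma> s) \<Longrightarrow> R \<le> norm (\<gamma> t) \<Longrightarrow>
       winding_number (truncated_loop \<gamma> s t) b = N \<and> b \<notin> path_image (truncated_loop \<gamma> s t)"
  shows "line_integral \<gamma> (\<lambda>w. h w / (w - b)) = 2 * pi * \<i> * N * h b"
proof -
  obtain C \<delta> where C: "0 < \<delta>" "\<And>w. w \<in> sector \<Longrightarrow> norm (h w) \<le> C * exp (- \<delta> * (norm w)\<^sup>2)"
    using h by (auto simp: decaying_def)
  have hol: "h holomorphic_on {w. 0 < Re w}" using h by (simp add: decaying_def)
  show ?thesis
  \<comment> \<open>Beyond modulus \<open>norm b + 1\<close> the denominator has modulus at least 1,
    so the quotient inherits the decay of \<open>h\<close>; the value of the loops is Cauchy's
    formula with winding number \<open>N\<close>.\<close>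
  proof (rule line_integral_eq_loop[OF \<gamma>(1) _ C(1), where \<rho> = "norm b + 1" and C = C and R = R], goal_cases)
    case 1
    have "continuous_on (range \<gamma>) h"
      using holomorphic_on_imp_continuous_on[OF hol] \<gamma>(2) continuous_on_subset by blast
    then show ?case
      using b(2) by (intro continuous_intros) auto
  next
    case w: (2 w)
    then have "1 \<le> norm (w - b)" using norm_triangle_ineq2[of w b] by simp
    then have "norm (h w / (w - b)) \<le> norm (h w)"
      using mult_left_mono[of 1 "norm (w - b)" "norm (h w)"] by (auto simp: norm_divide divide_le_eq)
    then show ?case using C(2)[OF w(1)] by simp
  next
    case st: (3 s t)
    have pw: "\<gamma> piecewise_C1_differentiable_on {s..t}" using \<gamma> by (simp add: unbounded_contour_def)
    note L = truncated_loop[OF pw st(1)]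
    have "open {w. 0 < Re w}" by (rule open_halfspace_Re_gt)
    then have "b \<in> interior {w. 0 < Re w}" using b(1) by (simp add: interior_open)
    moreover have "path_image (truncated_loop \<gamma> s t) \<subseteq> {w. 0 < Re w} - {b}"
      using right_contour_loop_subset[OF \<gamma>(2), of s t] wn[OF st] unfolding L(3) by auto
    ultimately show ?case
      using Cauchy_integral_formula_convex_simple[OF convex_halfspace_Re_gt hol _ L(1) _ L(2)] wn[OF st] by auto
  qed
qed

text \<open>The reference point is a negative real number. The loops stay in the right half plane,
  so they do not wind around it.\<close>

lemma line_integral_pole_left:
  assumes \<gamma>: "unbounded_contour (pi / 5) \<gamma>" "range \<gamma> \<subseteq> {w. 0 < Re w}" and h: "decaying h"
    and b: "0 < Re b" "b \<in> left_side \<gamma>"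
  shows "line_integral \<gamma> (\<lambda>w. h w / (w - b)) = 0"
proof -
  have "eventually (\<lambda>x. connected_component (- range \<gamma>) b (complex_of_real x) \<and> x < 0) at_bot"
    using b(2) eventually_gt_at_bot by (auto simp: left_side_def eventually_conj_iff)
  then obtain x where x: "connected_component (- range \<gamma>) b (complex_of_real x)" "x < 0"
    by (metis (no_types, lifting) eventually_at_bot_linorder order_refl)
  obtain R where R: "\<And>s t. s < t \<Longrightarrow> \<gamma> s \<in> sector \<Longrightarrow> \<gamma> t \<in> sector \<Longrightarrow> R \<le> norm (\<gamma> s) \<Longrightarrow> R \<le> norm (\<gamma> t) \<Longrightarrow>
     winding_number (truncated_loop \<gamma> s t) b = winding_number (truncated_loop \<gamma> s t) x \<and>
     b \<notin> path_image (truncated_loop \<gamma> s t) \<and> of_real x \<notin> path_image (truncated_loop \<gamma> s t)"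
    using winding_number_loop_connected[OF \<gamma>(1) x(1)] by metis
  have "line_integral \<gamma> (\<lambda>w. h w / (w - b)) = 2 * pi * \<i> * 0 * h b"
  proof (rule line_integral_pole[OF \<gamma> h b(1), where R = R])
    show "b \<notin> range \<gamma>" using connected_component_in[OF x(1)] by auto
    fix s t :: real
    assume st: "s < t" "\<gamma> s \<in> sector" "\<gamma> t \<in> sector" "R \<le> norm (\<gamma> s)" "R \<le> norm (\<gamma> t)"
    have pw: "\<gamma> piecewise_C1_differentiable_on {s..t}" using \<gamma> by (simp add: unbounded_contour_def)
    note L = truncated_loop[OF pw st(1)]
    have "winding_number (truncated_loop \<gamma> s t) (of_real x) = 0"
      using right_contour_loop_subset[OF \<gamma>(2), of s t] x(2)
      by (intro winding_number_zero_outside[OF valid_path_imp_path[OF L(1)] convex_halfspace_Re_gt[of 0] L(2)]) (auto simp: L(3))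
    then show "winding_number (truncated_loop \<gamma> s t) b = 0 \<and> b \<notin> path_image (truncated_loop \<gamma> s t)"
      using R[OF st] by simp
  qed
  then show ?thesis by simp
qed

text \<open>The reference point is a real number beyond all crossings of the contour with the real
  axis; far loops wind around it once, clockwise.\<close>

lemma line_integral_pole_right:
  assumes \<gamma>: "unbounded_contour (pi / 5) \<gamma>" "range \<gamma> \<subseteq> {w. 0 < Re w}" and h: "decaying h"
    and b: "0 < Re b" "b \<in> right_side \<gamma>"
  shows "line_integral \<gamma> (\<lambda>w. h w / (w - b)) = - (2 * pi * \<i>) * h b"
proof -
  obtain X where X: "\<And>t. Im (\<gamma> t) = 0 \<Longrightarrow> Re (\<gamma> t) < X" using right_contour_avoids_ray[OF \<gamma>(1)] by blast
  have "eventually (\<lambda>x. connected_component (- range \<gamma>) b (complex_of_real x) \<and> X \<le> x) at_top"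
    using b(2) eventually_ge_at_top by (auto simp: right_side_def eventually_conj_iff)
  then obtain x where x: "connected_component (- range \<gamma>) b (complex_of_real x)" "X \<le> x"
    by (metis (no_types, lifting) eventually_at_top_linorder order_refl)
  obtain R where R: "\<And>s t. s < t \<Longrightarrow> \<gamma> s \<in> sector \<Longrightarrow> \<gamma> t \<in> sector \<Longrightarrow> R \<le> norm (\<gamma> s) \<Longrightarrow> R \<le> norm (\<gamma> t) \<Longrightarrow>
     winding_number (truncated_loop \<gamma> s t) b = winding_number (truncated_loop \<gamma> s t) x \<and>
     b \<notin> path_image (truncated_loop \<gamma> s t) \<and> of_real x \<notin> path_image (truncated_loop \<gamma> s t)"
    using winding_number_loop_connected[OF \<gamma>(1) x(1)] by metis
  have "line_integral \<gamma> (\<lambda>w. h w / (w - b)) = 2 * pi * \<i> * (-1) * h b"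
  proof (rule line_integral_pole[OF \<gamma> h b(1), where R = "max R (2 * (\<bar>x\<bar> + 1))"])
    show "b \<notin> range \<gamma>" using connected_component_in[OF x(1)] by auto
    fix s t :: real
    assume st: "s < t" "\<gamma> s \<in> sector" "\<gamma> t \<in> sector" "Im (\<gamma> s) < 0" "0 < Im (\<gamma> t)"
      "max R (2 * (\<bar>x\<bar> + 1)) \<le> norm (\<gamma> s)" "max R (2 * (\<bar>x\<bar> + 1)) \<le> norm (\<gamma> t)"
    have "Re (\<gamma> t) < x" if "Im (\<gamma> t) = 0" for t using X[OF that] x(2) by simp
    then have "winding_number (truncated_loop \<gamma> s t) (of_real x) = -1"
      using st by (intro winding_number_loop_inside[OF \<gamma>(1)]) auto
    then show "winding_number (truncated_loop \<gamma> s t) b = -1 \<and> b \<notin> path_image (truncated_loop \<gamma> s t)"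
      using R[OF st(1-3)] st(6,7) by simp
  qed
  then show ?thesis by simp
qed

section \<open>Cauchy determinants and permutations\<close>

text \<open>The Leibniz expansion of the Cauchy determinant. Each variable occurs in one simple
  fraction per term, which is the form on which residues act term by term.\<close>

definition cdet :: "nat \<Rightarrow> (nat \<Rightarrow> complex) \<Rightarrow> (nat \<Rightarrow> complex) \<Rightarrow> complex" where
  "cdet n a b = (\<Sum>p | p permutes {..<n}. of_int (sign p) * (\<Prod>i<n. 1 / (a i - b (p i))))"

definition cat :: "nat \<Rightarrow> (nat \<Rightarrow> 'b) \<Rightarrow> (nat \<Rightarrow> 'b) \<Rightarrow> nat \<Rightarrow> 'b" where
  "cat M a b j = (if j < M then a j else b (j - M))"

lemma cauchy_det_eq_cdet:
  assumes "length W = n" "length W' = n" "\<And>i. i < n \<Longrightarrow> W ! i = a i" "\<And>i. i < n \<Longrightarrow> W' ! i = b i"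
  shows "cauchy_det W W' = cdet n a b"
  unfolding cauchy_det_def cdet_def Determinant.det_def using assms
  by (auto simp: atLeast0LessThan intro!: sum.cong prod.cong dest: permutes_in_image)

lemma cdet_cong:
  assumes "\<And>i. i < n \<Longrightarrow> a i = a' i" "\<And>i. i < n \<Longrightarrow> b i = b' i"
  shows "cdet n a b = cdet n a' b'"
proof -
  have "b (p i) = b' (p i)" if "p permutes {..<n}" "i < n" for p i
    using assms(2)[of "p i"] permutes_in_image[OF that(1), of i] that(2) by simp
  then show ?thesis unfolding cdet_def using assms(1) by (intro sum.cong refl) (auto intro!: prod.cong)
qed

lemma cdet_permute_left:
  assumes "\<tau> permutes {..<n}"
  shows "cdet n (a \<circ> \<tau>) b = of_int (sign \<tau>) * cdet n a b"
proof -
  have \<tau>: "permutation \<tau>" using assms by (rule permutes_imp_permutation[rotated]) simp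
  have "cdet n (a \<circ> \<tau>) b = (\<Sum>p | p permutes {..<n}. of_int (sign (p \<circ> \<tau>)) * (\<Prod>i<n. 1 / ((a \<circ> \<tau>) i - b ((p \<circ> \<tau>) i))))"
    unfolding cdet_def by (rule sum_permutations_compose_right[OF assms])
  also have "\<dots> = (\<Sum>p | p permutes {..<n}. of_int (sign \<tau>) * (of_int (sign p) * (\<Prod>i<n. 1 / (a i - b (p i)))))"
  proof (intro sum.cong refl)
    fix p assume "p \<in> {p. p permutes {..<n}}"
    then have "permutation p" by (auto intro: permutes_imp_permutation[OF finite_lessThan])
    moreover have "(\<Prod>i<n. 1 / (a i - b (p i))) = (\<Prod>i<n. 1 / ((a \<circ> \<tau>) i - b ((p \<circ> \<tau>) i)))"
      using prod.permute[OF assms, of "\<lambda>i. 1 / (a i - b (p i))"] by (simp add: o_def)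
    ultimately show "of_int (sign (p \<circ> \<tau>)) * (\<Prod>i<n. 1 / ((a \<circ> \<tau>) i - b ((p \<circ> \<tau>) i))) =
       of_int (sign \<tau>) * (of_int (sign p) * (\<Prod>i<n. 1 / (a i - b (p i))))"
      using \<tau> by (simp add: sign_compose)
  qed
  finally show ?thesis by (simp add: cdet_def sum_distrib_left)
qed

section \<open>Permutations with prescribed values and a double coset\<close>

lemma card_permutations_extending:
  assumes "inj_on f {..<N}" "f ` {..<N} \<subseteq> {..<M}"
  shows "card {\<tau>. \<tau> permutes {..<M} \<and> (\<forall>l<N. \<tau> l = f l)} = fact (M - N)"
proof -
  have NM: "N \<le> M" using card_inj_on_le[OF assms] by simp
  have "card {N..<M} = card ({..<M} - f ` {..<N})"
    using assms by (simp add: card_Diff_subset card_image)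
  \<comment> \<open>An arbitrary matching of the free positions with the free values extends
    \<open>f\<close> to \<open>\<tau>0\<close>. The extensions are exactly the products
    \<open>\<tau>0 \<circ> \<rho>\<close> with \<open>\<rho>\<close> a permutation of the
    \<open>M - N\<close> free positions.\<close>
  then obtain g where g: "bij_betw g {N..<M} ({..<M} - f ` {..<N})"
    using finite_same_card_bij[of "{N..<M}" "{..<M} - f ` {..<N}"] by auto
  define \<tau>0 where "\<tau>0 i = (if i < N then f i else if i < M then g i else i)" for i
  have \<tau>0: "\<tau>0 permutes {..<M}"
  proof (rule bij_imp_permutes)
    have "bij_betw \<tau>0 {..<N} (f ` {..<N})"
      using assms(1) by (intro bij_betw_cong[THEN iffD1, OF _ inj_on_imp_bij_betw]) (auto simp: \<tau>0_def)
    moreover have "bij_betw \<tau>0 {N..<M} ({..<M} - f ` {..<N})"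
      by (rule bij_betw_cong[THEN iffD1, OF _ g]) (auto simp: \<tau>0_def)
    ultimately have "bij_betw \<tau>0 ({..<N} \<union> {N..<M}) (f ` {..<N} \<union> ({..<M} - f ` {..<N}))"
      by (rule bij_betw_combine) auto
    moreover have "{..<N} \<union> {N..<M} = {..<M}" using NM by auto
    moreover have "f ` {..<N} \<union> ({..<M} - f ` {..<N}) = {..<M}" using assms(2) by auto
    ultimately show "bij_betw \<tau>0 {..<M} {..<M}" by simp
  qed (use NM in \<open>auto simp: \<tau>0_def\<close>)
  have "bij_betw (\<lambda>\<rho>. \<tau>0 \<circ> \<rho>) {\<rho>. \<rho> permutes {N..<M}} {\<tau>. \<tau> permutes {..<M} \<and> (\<forall>l<N. \<tau> l = f l)}"
  proof (rule bij_betw_byWitness[where f' = "\<lambda>\<tau>. inv_into UNIV \<tau>0 \<circ> \<tau>"])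
    show "\<forall>\<rho>\<in>{\<rho>. \<rho> permutes {N..<M}}. inv_into UNIV \<tau>0 \<circ> (\<tau>0 \<circ> \<rho>) = \<rho>"
      using permutes_inv_o(2)[OF \<tau>0] by (simp add: o_assoc)
    show "\<forall>\<tau>\<in>{\<tau>. \<tau> permutes {..<M} \<and> (\<forall>l<N. \<tau> l = f l)}. \<tau>0 \<circ> (inv_into UNIV \<tau>0 \<circ> \<tau>) = \<tau>"
      using permutes_inv_o(1)[OF \<tau>0] by (simp add: o_assoc)
    show "(\<lambda>\<rho>. \<tau>0 \<circ> \<rho>) ` {\<rho>. \<rho> permutes {N..<M}} \<subseteq> {\<tau>. \<tau> permutes {..<M} \<and> (\<forall>l<N. \<tau> l = f l)}"
    proof clarsimp
      fix \<rho> assume \<rho>: "\<rho> permutes {N..<M}"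
      then have "\<rho> permutes {..<M}" by (rule permutes_subset) auto
      then have "\<tau>0 \<circ> \<rho> permutes {..<M}" using \<tau>0 by (rule permutes_compose)
      moreover have "\<tau>0 (\<rho> l) = f l" if "l < N" for l
        using permutes_not_in[OF \<rho>, of l] that by (simp add: \<tau>0_def)
      ultimately show "\<tau>0 \<circ> \<rho> permutes {..<M} \<and> (\<forall>l<N. \<tau>0 (\<rho> l) = f l)" by blast
    qed
    show "(\<lambda>\<tau>. inv_into UNIV \<tau>0 \<circ> \<tau>) ` {\<tau>. \<tau> permutes {..<M} \<and> (\<forall>l<N. \<tau> l = f l)} \<subseteq> {\<rho>. \<rho> permutes {N..<M}}"
    proof clarsimp
      fix \<tau> assume \<tau>: "\<tau> permutes {..<M}" "\<forall>l<N. \<tau> l = f l"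
      have p: "inv_into UNIV \<tau>0 \<circ> \<tau> permutes {..<M}" using \<tau>(1) permutes_inv[OF \<tau>0] by (rule permutes_compose)
      show "inv_into UNIV \<tau>0 \<circ> \<tau> permutes {N..<M}"
      proof (rule permutes_superset[OF p])
        fix l assume "l \<in> {..<M} - {N..<M}"
        then have "\<tau> l = \<tau>0 l" using \<tau>(2) by (auto simp: \<tau>0_def)
        then show "(inv_into UNIV \<tau>0 \<circ> \<tau>) l = l" using permutes_inverses(2)[OF \<tau>0] by simp
      qed
    qed
  qed
  then have "card {\<tau>. \<tau> permutes {..<M} \<and> (\<forall>l<N. \<tau> l = f l)} = card {\<rho>. \<rho> permutes {N..<M}}"
    by (rule bij_betw_same_card[symmetric])
  also have "\<dots> = fact (M - N)" by (rule card_permutations) auto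
  finally show ?thesis .
qed

text \<open>The product of the \<open>N\<close> transpositions of \<open>i\<close> and
  \<open>M + i\<close>, disjoint for \<open>N \<le> M\<close>. It represents the matching in which
  row \<open>M + l\<close> takes column \<open>l\<close>.\<close>

definition block_swap :: "nat \<Rightarrow> nat \<Rightarrow> nat \<Rightarrow> nat" where
  "block_swap M N i = (if i < N then M + i else if M \<le> i \<and> i < M + N then i - M else i)"

lemma block_swap_permutes:
  assumes "N \<le> M" shows "block_swap M N permutes {..<M + N}"
proof (rule bij_imp_permutes)
  show "bij_betw (block_swap M N) {..<M + N} {..<M + N}"
    by (rule bij_betw_byWitness[where f' = "block_swap M N"]) (use assms in \<open>auto simp: block_swap_def\<close>)
qed (use assms in \<open>auto simp: block_swap_def\<close>)

lemma block_swap_involution: "N \<le> M \<Longrightarrow> block_swap M N (block_swap M N i) = i"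
  by (auto simp: block_swap_def)

lemma sign_block_swap: "N \<le> M \<Longrightarrow> sign (block_swap M N) = (-1) ^ N"
proof (induction N)
  case 0
  have "block_swap M 0 = id" by (auto simp: block_swap_def)
  then show ?case by (simp add: sign_id)
next
  case (Suc N)
  have "block_swap M (Suc N) = Transposition.transpose N (M + N) \<circ> block_swap M N"
  proof
    fix i
    consider "i < N" | "i = N" | "N < i" "i < M" | "M \<le> i" "i < M + N" | "i = M + N" | "M + N < i"
      by linarith
    then show "block_swap M (Suc N) i = (Transposition.transpose N (M + N) \<circ> block_swap M N) i"
      by cases (use Suc.prems in \<open>auto simp: block_swap_def Transposition.transpose_def\<close>)
  qed
  moreover have "permutation (block_swap M N)"
    using block_swap_permutes[of N M] Suc.prems by (auto intro: permutes_imp_permutation[OF finite_lessThan])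
  ultimately have "sign (block_swap M (Suc N)) = sign (Transposition.transpose N (M + N)) * sign (block_swap M N)"
    by (simp only: sign_compose permutation_swap_id)
  then show ?case using Suc by (simp add: sign_swap_id)
qed

text \<open>
  The permutations mapping the last \<open>N\<close> rows into the first \<open>M\<close> columns form the double coset of
  \<open>block_swap M N\<close> by permutations of the first \<open>M\<close> columns and of the first \<open>M\<close> rows.
\<close>

lemma sum_double_coset:
  fixes F :: "(nat \<Rightarrow> nat) \<Rightarrow> complex"
  assumes NM: "N \<le> M"
  defines "P \<equiv> {\<pi>. \<pi> permutes {..<M + N} \<and> (\<forall>l<N. \<pi> (M + l) < M)}"
  shows "(\<Sum>\<tau> | \<tau> permutes {..<M}. \<Sum>\<omega> | \<omega> permutes {..<M}. F (\<tau> \<circ> block_swap M N \<circ> \<omega>)) =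
    fact (M - N) * (\<Sum>\<pi>\<in>P. F \<pi>)"
proof -
  let ?S = "{\<tau>. \<tau> permutes {..<M}}" and ?s = "block_swap M N"
  have fS: "finite ?S" by (rule finite_permutations) simp
  have fP: "finite P"
    by (rule finite_subset[OF _ finite_permutations[of "{..<M + N}"]]) (auto simp: P_def)
  have ext: "\<tau> permutes {..<M + N}" if "\<tau> permutes {..<M}" for \<tau>
    using that by (rule permutes_subset) auto
  \<comment> \<open>For fixed \<open>\<tau>\<close> the products with all \<open>\<omega>\<close>
    run exactly once through those \<open>\<pi>\<close> whose last \<open>N\<close> rows take the
    columns \<open>\<tau> 0\<close>, \<open>\<tau> 1\<close> and so on, in this order.\<close>
  have inner: "(\<Sum>\<omega>\<in>?S. F (\<tau> \<circ> ?s \<circ> \<omega>)) = (\<Sum>\<pi>\<in>{\<pi>\<in>P. \<forall>l<N. \<tau> l = \<pi> (M + l)}. F \<pi>)"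
    if \<tau>: "\<tau> permutes {..<M}" for \<tau>
  proof (rule sum.reindex_bij_witness[where j = "\<lambda>\<omega>. \<tau> \<circ> ?s \<circ> \<omega>" and i = "\<lambda>\<pi>. ?s \<circ> inv_into UNIV \<tau> \<circ> \<pi>"])
    fix \<omega> assume "\<omega> \<in> ?S"
    then have \<omega>: "\<omega> permutes {..<M}" by simp
    show "?s \<circ> inv_into UNIV \<tau> \<circ> (\<tau> \<circ> ?s \<circ> \<omega>) = \<omega>"
      using permutes_inverses(2)[OF \<tau>] block_swap_involution[OF NM] by (auto simp: fun_eq_iff)
    have "\<tau> \<circ> ?s \<circ> \<omega> permutes {..<M + N}"
      by (rule permutes_compose[OF ext[OF \<omega>] permutes_compose[OF block_swap_permutes[OF NM] ext[OF \<tau>]]])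
    moreover have "(\<tau> \<circ> ?s \<circ> \<omega>) (M + l) = \<tau> l" if "l < N" for l
      using permutes_not_in[OF \<omega>, of "M + l"] that NM by (simp add: block_swap_def)
    moreover have "\<tau> l < M" if "l < N" for l
      using permutes_in_image[OF \<tau>, of l] that NM by simp
    ultimately show "\<tau> \<circ> ?s \<circ> \<omega> \<in> {\<pi>\<in>P. \<forall>l<N. \<tau> l = \<pi> (M + l)}"
      by (simp add: P_def)
  next
    fix \<pi> assume \<pi>: "\<pi> \<in> {\<pi>\<in>P. \<forall>l<N. \<tau> l = \<pi> (M + l)}"
    show "\<tau> \<circ> ?s \<circ> (?s \<circ> inv_into UNIV \<tau> \<circ> \<pi>) = \<pi>"
      using permutes_inverses(1)[OF \<tau>] block_swap_involution[OF NM] by (auto simp: fun_eq_iff)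
    have "?s \<circ> inv_into UNIV \<tau> \<circ> \<pi> permutes {..<M + N}"
      using \<pi>
      by (intro permutes_compose[OF _ permutes_compose[OF ext[OF permutes_inv[OF \<tau>]] block_swap_permutes[OF NM]]])
        (simp add: P_def)
    then have "?s \<circ> inv_into UNIV \<tau> \<circ> \<pi> permutes {..<M}"
    proof (rule permutes_superset)
      fix i assume "i \<in> {..<M + N} - {..<M}"
      then obtain l where l: "i = M + l" "l < N" by (metis DiffE add_diff_inverse_nat lessThan_iff nat_add_left_cancel_less)
      then have "inv_into UNIV \<tau> (\<pi> i) = l" using \<pi> permutes_inverses(2)[OF \<tau>, of l] by auto
      then show "(?s \<circ> inv_into UNIV \<tau> \<circ> \<pi>) i = i" using l NM by (simp add: block_swap_def)
    qed
    then show "?s \<circ> inv_into UNIV \<tau> \<circ> \<pi> \<in> ?S" by simp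
  qed simp
  have "(\<Sum>\<tau>\<in>?S. \<Sum>\<omega>\<in>?S. F (\<tau> \<circ> ?s \<circ> \<omega>)) = (\<Sum>\<tau>\<in>?S. \<Sum>\<pi>\<in>{\<pi>\<in>P. \<forall>l<N. \<tau> l = \<pi> (M + l)}. F \<pi>)"
    by (intro sum.cong refl inner) simp
  \<comment> \<open>Counted the other way, each \<open>\<pi>\<close> occurs once for every
    \<open>\<tau>\<close> that extends its last rows, that is, \<open>fact (M - N)\<close>
    times.\<close>
  also have "\<dots> = (\<Sum>\<pi>\<in>P. \<Sum>\<tau>\<in>{\<tau>\<in>?S. \<forall>l<N. \<tau> l = \<pi> (M + l)}. F \<pi>)"
    by (rule sum.swap_restrict[OF fS fP])
  also have "\<dots> = (\<Sum>\<pi>\<in>P. fact (M - N) * F \<pi>)"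
  proof (intro sum.cong refl)
    fix \<pi> assume \<pi>: "\<pi> \<in> P"
    have "card {\<tau>. \<tau> permutes {..<M} \<and> (\<forall>l<N. \<tau> l = \<pi> (M + l))} = fact (M - N)"
    proof (rule card_permutations_extending)
      have "inj \<pi>" using \<pi> permutes_inj by (auto simp: P_def)
      then show "inj_on (\<lambda>l. \<pi> (M + l)) {..<N}" by (intro inj_onI) (metis add_left_cancel injD)
      show "(\<lambda>l. \<pi> (M + l)) ` {..<N} \<subseteq> {..<M}" using \<pi> by (auto simp: P_def)
    qed
    then show "(\<Sum>\<tau>\<in>{\<tau>\<in>?S. \<forall>l<N. \<tau> l = \<pi> (M + l)}. F \<pi>) = fact (M - N) * F \<pi>" by simp
  qed
  finally show ?thesis by (simp add: sum_distrib_left)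
qed

text \<open>In a Leibniz term of the determinant that couples two levels, row \<open>M + l\<close>
  is a variable about to be replaced by a residue, and \<open>\<pi> (M + l) < M\<close> says that it
  takes its pole from \<open>b\<close>. In the double coset form the sum over
  \<open>\<omega>\<close> completes the remaining rows to a determinant in which \<open>u\<close>
  has taken the places of the used poles; the sign is that of \<open>block_swap\<close>, and
  \<open>fact (M - N)\<close> corrects the multiplicity.\<close>

lemma sum_matching_permutations:
  fixes a b u :: "nat \<Rightarrow> complex" and H :: "(nat \<Rightarrow> complex) \<Rightarrow> complex"
  assumes H: "\<And>f g. (\<And>l. l < N \<Longrightarrow> f l = g l) \<Longrightarrow> H f = H g" and NM: "N \<le> M"
  shows "(\<Sum>\<pi> | \<pi> permutes {..<M + N} \<and> (\<forall>l<N. \<pi> (M + l) < M).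
      of_int (sign \<pi>) * (\<Prod>j<M. 1 / (a j - cat M b u (\<pi> j))) * H (\<lambda>l. b (\<pi> (M + l)))) =
    (-1) ^ N / fact (M - N) * (\<Sum>\<tau> | \<tau> permutes {..<M}.
      of_int (sign \<tau>) * cdet M a (\<lambda>j. if j < N then u j else b (\<tau> j)) * H (b \<circ> \<tau>))"
proof -
  define F where "F \<pi> = of_int (sign \<pi>) * (\<Prod>j<M. 1 / (a j - cat M b u (\<pi> j))) * H (\<lambda>l. b (\<pi> (M + l)))" for \<pi>
  have "(\<Sum>\<omega> | \<omega> permutes {..<M}. F (\<tau> \<circ> block_swap M N \<circ> \<omega>)) =
     (-1) ^ N * (of_int (sign \<tau>) * cdet M a (\<lambda>j. if j < N then u j else b (\<tau> j)) * H (b \<circ> \<tau>))"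
    if \<tau>: "\<tau> permutes {..<M}" for \<tau>
  proof -
    have "F (\<tau> \<circ> block_swap M N \<circ> \<omega>) = ((-1) ^ N * of_int (sign \<tau>) * H (b \<circ> \<tau>)) *
       (of_int (sign \<omega>) * (\<Prod>j<M. 1 / (a j - (if \<omega> j < N then u (\<omega> j) else b (\<tau> (\<omega> j))))))"
      if \<omega>: "\<omega> permutes {..<M}" for \<omega>
    proof -
      have perm: "permutation \<tau>" "permutation (block_swap M N)" "permutation \<omega>"
        by (rule permutes_imp_permutation[OF finite_lessThan], fact \<tau> \<omega> block_swap_permutes[OF NM])+
      have sg: "sign (\<tau> \<circ> block_swap M N \<circ> \<omega>) = sign \<tau> * (-1) ^ N * sign \<omega>"
        using perm by (simp add: sign_compose permutation_compose sign_block_swap[OF NM])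
      have col: "cat M b u ((\<tau> \<circ> block_swap M N \<circ> \<omega>) j) = (if \<omega> j < N then u (\<omega> j) else b (\<tau> (\<omega> j)))" if "j < M" for j
      proof -
        have "\<omega> j < M" using permutes_in_image[OF \<omega>, of j] that by simp
        moreover have "\<tau> (\<omega> j) < M" using permutes_in_image[OF \<tau>, of "\<omega> j"] calculation by simp
        moreover have "\<tau> (M + k) = M + k" for k using permutes_not_in[OF \<tau>, of "M + k"] by simp
        ultimately show ?thesis using NM by (auto simp: block_swap_def cat_def)
      qed
      have "H (\<lambda>l. b ((\<tau> \<circ> block_swap M N \<circ> \<omega>) (M + l))) = H (b \<circ> \<tau>)"
      proof (rule H)
        fix l assume "l < N"
        then show "b ((\<tau> \<circ> block_swap M N \<circ> \<omega>) (M + l)) = (b \<circ> \<tau>) l"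
          using permutes_not_in[OF \<omega>, of "M + l"] NM by (simp add: block_swap_def)
      qed
      moreover have "(\<Prod>j<M. 1 / (a j - cat M b u ((\<tau> \<circ> block_swap M N \<circ> \<omega>) j))) =
          (\<Prod>j<M. 1 / (a j - (if \<omega> j < N then u (\<omega> j) else b (\<tau> (\<omega> j)))))"
        by (rule prod.cong[OF refl]) (simp only: col lessThan_iff)
      ultimately show ?thesis unfolding F_def sg by (simp only: of_int_mult of_int_power of_int_minus of_int_1 ac_simps)
    qed
    then have "(\<Sum>\<omega> | \<omega> permutes {..<M}. F (\<tau> \<circ> block_swap M N \<circ> \<omega>)) =
       (\<Sum>\<omega> | \<omega> permutes {..<M}. ((-1) ^ N * of_int (sign \<tau>) * H (b \<circ> \<tau>)) *
       (of_int (sign \<omega>) * (\<Prod>j<M. 1 / (a j - (if \<omega> j < N then u (\<omega> j) else b (\<tau> (\<omega> j)))))))"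
      by (intro sum.cong refl) simp
    also have "\<dots> = ((-1) ^ N * of_int (sign \<tau>) * H (b \<circ> \<tau>)) * cdet M a (\<lambda>j. if j < N then u j else b (\<tau> j))"
      unfolding cdet_def sum_distrib_left ..
    finally show ?thesis by (simp add: ac_simps)
  qed
  then have "fact (M - N) * (\<Sum>\<pi> | \<pi> permutes {..<M + N} \<and> (\<forall>l<N. \<pi> (M + l) < M). F \<pi>) =
     (\<Sum>\<tau> | \<tau> permutes {..<M}. (-1) ^ N * (of_int (sign \<tau>) * cdet M a (\<lambda>j. if j < N then u j else b (\<tau> j)) * H (b \<circ> \<tau>)))"
    unfolding sum_double_coset[OF NM, symmetric] by (intro sum.cong refl) simp
  also have "\<dots> = (-1) ^ N * (\<Sum>\<tau> | \<tau> permutes {..<M}. of_int (sign \<tau>) * cdet M a (\<lambda>j. if j < N then u j else b (\<tau> j)) * H (b \<circ> \<tau>))"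
    by (rule sum_distrib_left[symmetric])
  finally show ?thesis unfolding F_def by (simp add: field_simps)
qed

text \<open>Substituting \<open>\<tau> \<circ> \<rho>\<close> for \<open>\<tau>\<close> shows that
  all \<open>\<rho>\<close> contribute equally. In this way the antisymmetrization over one level is
  swallowed by that over the level below.\<close>

lemma sum_sign_absorb:
  fixes Y T :: "(nat \<Rightarrow> nat) \<Rightarrow> complex"
  assumes "N \<le> M" and Y: "\<And>\<tau> \<rho>. \<tau> permutes {..<M} \<Longrightarrow> \<rho> permutes {..<N} \<Longrightarrow> Y (\<tau> \<circ> \<rho>) = Y \<tau>"
  shows "(\<Sum>\<tau> | \<tau> permutes {..<M}. of_int (sign \<tau>) * Y \<tau> * (\<Sum>\<rho> | \<rho> permutes {..<N}. of_int (sign \<rho>) * T (\<tau> \<circ> \<rho>))) =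
    fact N * (\<Sum>\<tau> | \<tau> permutes {..<M}. of_int (sign \<tau>) * Y \<tau> * T \<tau>)"
proof -
  have "(\<Sum>\<tau> | \<tau> permutes {..<M}. of_int (sign \<tau>) * Y \<tau> * (\<Sum>\<rho> | \<rho> permutes {..<N}. of_int (sign \<rho>) * T (\<tau> \<circ> \<rho>))) =
     (\<Sum>\<rho> | \<rho> permutes {..<N}. \<Sum>\<tau> | \<tau> permutes {..<M}. of_int (sign \<tau>) * Y \<tau> * (of_int (sign \<rho>) * T (\<tau> \<circ> \<rho>)))"
    unfolding sum_distrib_left by (rule sum.swap)
  also have "\<dots> = (\<Sum>\<rho> | \<rho> permutes {..<N}. \<Sum>\<tau> | \<tau> permutes {..<M}. of_int (sign \<tau>) * Y \<tau> * T \<tau>)"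
  proof (rule sum.cong[OF refl])
    fix \<rho> assume "\<rho> \<in> {\<rho>. \<rho> permutes {..<N}}"
    then have \<rho>: "\<rho> permutes {..<N}" by simp
    then have \<rho>': "\<rho> permutes {..<M}" using assms(1) by (auto intro: permutes_subset)
    have "(\<Sum>\<tau> | \<tau> permutes {..<M}. of_int (sign \<tau>) * Y \<tau> * T \<tau>) =
       (\<Sum>\<tau> | \<tau> permutes {..<M}. of_int (sign (\<tau> \<circ> \<rho>)) * Y (\<tau> \<circ> \<rho>) * T (\<tau> \<circ> \<rho>))"
      by (rule sum_permutations_compose_right[OF \<rho>'])
    also have "\<dots> = (\<Sum>\<tau> | \<tau> permutes {..<M}. of_int (sign \<tau>) * Y \<tau> * (of_int (sign \<rho>) * T (\<tau> \<circ> \<rho>)))"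
      using \<rho> \<rho>' by (intro sum.cong refl) (auto simp: sign_compose permutes_imp_permutation[OF finite_lessThan] Y ac_simps)
    finally show "(\<Sum>\<tau> | \<tau> permutes {..<M}. of_int (sign \<tau>) * Y \<tau> * (of_int (sign \<rho>) * T (\<tau> \<circ> \<rho>))) =
       (\<Sum>\<tau> | \<tau> permutes {..<M}. of_int (sign \<tau>) * Y \<tau> * T \<tau>)" by simp
  qed
  also have "\<dots> = fact N * (\<Sum>\<tau> | \<tau> permutes {..<M}. of_int (sign \<tau>) * Y \<tau> * T \<tau>)"
    by (simp add: card_permutations[of "{..<N}" N])
  finally show ?thesis .
qed

section \<open>Decaying functions and their residues\<close>

definition sector_bounded :: "(complex \<Rightarrow> complex) \<Rightarrow> bool" where
  "sector_bounded h \<longleftrightarrow> h holomorphic_on {w. 0 < Re w} \<and> (\<exists>C. \<forall>w\<in>sector. norm (h w) \<le> C)"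

lemma sector_bounded_const: "sector_bounded (\<lambda>w. c)"
  by (auto simp: sector_bounded_def)

lemma sector_bounded_add:
  assumes "sector_bounded f" "sector_bounded g" shows "sector_bounded (\<lambda>w. f w + g w)"
proof -
  obtain C D where "\<And>w. w \<in> sector \<Longrightarrow> norm (f w) \<le> C" "\<And>w. w \<in> sector \<Longrightarrow> norm (g w) \<le> D"
    using assms unfolding sector_bounded_def by blast
  then have "\<forall>w\<in>sector. norm (f w + g w) \<le> C + D" by (meson norm_triangle_mono)
  then show ?thesis using assms unfolding sector_bounded_def by (blast intro: holomorphic_on_add)
qed

lemma sector_bounded_mult:
  assumes "sector_bounded f" "sector_bounded g" shows "sector_bounded (\<lambda>w. f w * g w)"
proof -
  obtain C D where CD: "\<And>w. w \<in> sector \<Longrightarrow> norm (f w) \<le> C" "\<And>w. w \<in> sector \<Longrightarrow> norm (g w) \<le> D"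
    using assms unfolding sector_bounded_def by blast
  have "norm (f w * g w) \<le> C * D" if "w \<in> sector" for w
    unfolding norm_mult
    by (rule mult_mono[OF CD(1)[OF that] CD(2)[OF that] order_trans[OF norm_ge_zero CD(1)[OF that]] norm_ge_zero])
  then show ?thesis using assms unfolding sector_bounded_def by (blast intro: holomorphic_on_mult)
qed

lemma sector_bounded_sum:
  "(\<And>i. i \<in> I \<Longrightarrow> sector_bounded (f i)) \<Longrightarrow> sector_bounded (\<lambda>w. \<Sum>i\<in>I. f i w)"
  by (induction I rule: infinite_finite_induct) (auto intro: sector_bounded_const sector_bounded_add)

lemma sector_bounded_prod:
  "(\<And>i. i \<in> I \<Longrightarrow> sector_bounded (f i)) \<Longrightarrow> sector_bounded (\<lambda>w. \<Prod>i\<in>I. f i w)"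
  by (induction I rule: infinite_finite_induct) (auto intro: sector_bounded_const sector_bounded_mult)

text \<open>The pole keeps the distance \<open>- Re u\<close> from the right half plane.\<close>

lemma sector_bounded_simple_fraction:
  assumes "Re u < 0" shows "sector_bounded (\<lambda>w. 1 / (u - w))" "sector_bounded (\<lambda>w. 1 / (w - u))"
proof -
  have nz: "u \<noteq> w" if "0 < Re w" for w using assms that by auto
  have le: "norm (1 / (u - w)) \<le> 1 / (- Re u)" if "0 < Re w" for w
  proof -
    have "- Re u \<le> norm (u - w)" using abs_Re_le_cmod[of "u - w"] that assms by simp
    then show ?thesis using assms by (simp add: norm_divide divide_simps)
  qed
  have le': "norm (1 / (w - u)) \<le> 1 / (- Re u)" if "0 < Re w" for w
    using le[OF that] by (simp add: norm_divide norm_minus_commute)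
  show "sector_bounded (\<lambda>w. 1 / (u - w))"
    unfolding sector_bounded_def using nz le
    by (intro conjI holomorphic_intros exI[of _ "1 / (- Re u)"]) (auto simp: sector_def)
  show "sector_bounded (\<lambda>w. 1 / (w - u))"
    unfolding sector_bounded_def using nz le'
    by (intro conjI holomorphic_intros exI[of _ "1 / (- Re u)"]) (auto simp: sector_def)
qed

lemma decaying_mult_bounded:
  assumes "decaying f" "sector_bounded g" shows "decaying (\<lambda>w. f w * g w)"
proof -
  obtain C \<delta> where C: "0 < \<delta>" "\<And>w. w \<in> sector \<Longrightarrow> norm (f w) \<le> C * exp (- \<delta> * (norm w)\<^sup>2)"
    using assms(1) unfolding decaying_def by blast
  obtain D where D: "\<And>w. w \<in> sector \<Longrightarrow> norm (g w) \<le> D"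
    using assms(2) unfolding sector_bounded_def by blast
  have "norm (f w * g w) \<le> C * D * exp (- \<delta> * (norm w)\<^sup>2)" if "w \<in> sector" for w
  proof -
    have "norm (f w * g w) \<le> (C * exp (- \<delta> * (norm w)\<^sup>2)) * D"
      unfolding norm_mult
      by (rule mult_mono[OF C(2)[OF that] D[OF that] order_trans[OF norm_ge_zero C(2)[OF that]] norm_ge_zero])
    then show ?thesis by (simp add: ac_simps)
  qed
  then show ?thesis
    using assms C(1) unfolding decaying_def sector_bounded_def by (blast intro: holomorphic_on_mult)
qed

lemma decaying_imp_sector_bounded:
  assumes "decaying f" shows "sector_bounded f"
proof -
  obtain C \<delta> where C: "0 < \<delta>" "\<And>w. w \<in> sector \<Longrightarrow> norm (f w) \<le> C * exp (- \<delta> * (norm w)\<^sup>2)"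
    using assms(1) unfolding decaying_def by blast
  have "norm (f w) \<le> \<bar>C\<bar>" if "w \<in> sector" for w
  proof -
    have "norm (f w) \<le> \<bar>C\<bar> * exp (- \<delta> * (norm w)\<^sup>2)"
      using C(2)[OF that] by (rule order_trans) (intro mult_right_mono, auto)
    also have "\<dots> \<le> \<bar>C\<bar> * 1" using C(1) by (intro mult_left_mono) auto
    finally show ?thesis by simp
  qed
  then show ?thesis using assms unfolding decaying_def sector_bounded_def by blast
qed

lemma decaying_add:
  assumes "decaying f" "decaying g" shows "decaying (\<lambda>w. f w + g w)"
proof -
  obtain C \<delta> where C: "0 < \<delta>" "\<And>w. w \<in> sector \<Longrightarrow> norm (f w) \<le> C * exp (- \<delta> * (norm w)\<^sup>2)"
    using assms(1) unfolding decaying_def by blast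
  obtain D \<epsilon> where D: "0 < \<epsilon>" "\<And>w. w \<in> sector \<Longrightarrow> norm (g w) \<le> D * exp (- \<epsilon> * (norm w)\<^sup>2)"
    using assms(2) unfolding decaying_def by blast
  have "norm (f w + g w) \<le> (\<bar>C\<bar> + \<bar>D\<bar>) * exp (- min \<delta> \<epsilon> * (norm w)\<^sup>2)" if "w \<in> sector" for w
  proof -
    have "norm (f w) \<le> \<bar>C\<bar> * exp (- min \<delta> \<epsilon> * (norm w)\<^sup>2)"
      using C(2)[OF that] by (rule order_trans) (intro mult_mono, auto intro!: mult_right_mono)
    moreover have "norm (g w) \<le> \<bar>D\<bar> * exp (- min \<delta> \<epsilon> * (norm w)\<^sup>2)"
      using D(2)[OF that] by (rule order_trans) (intro mult_mono, auto intro!: mult_right_mono)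
    ultimately show ?thesis using norm_triangle_ineq[of "f w" "g w"] by (simp add: distrib_right)
  qed
  moreover have "0 < min \<delta> \<epsilon>" using C(1) D(1) by simp
  ultimately show ?thesis
    using assms unfolding decaying_def by (blast intro: holomorphic_on_add)
qed

lemma decaying_zero: "decaying (\<lambda>w. 0)"
  by (auto simp: decaying_def intro!: exI[of _ "0::real"] exI[of _ "1::real"])

lemma decaying_sum:
  "(\<And>i. i \<in> I \<Longrightarrow> decaying (f i)) \<Longrightarrow> decaying (\<lambda>w. \<Sum>i\<in>I. f i w)"
  by (induction I rule: infinite_finite_induct) (auto intro: decaying_zero decaying_add)

lemma decaying_cmult: "decaying f \<Longrightarrow> decaying (\<lambda>w. c * f w)"
  using decaying_mult_bounded[OF _ sector_bounded_const, of f c] by (simp add: mult.commute)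

text \<open>In the sector the quadratic term gives \<open>exp (- \<kappa> * (norm w)^2)\<close>; one
  half of this exponent pays for the linear term, the other half remains.\<close>

lemma decaying_gaussian:
  fixes a c :: real
  assumes "0 < a" shows "decaying (\<lambda>w. exp (- (of_real a * w\<^sup>2 + of_real c * w)))"
proof -
  define \<kappa> where "\<kappa> = a * ((1 - slope\<^sup>2) / 2)"
  have "slope\<^sup>2 < 1" using slope_bounds by (simp add: power_less_one_iff abs_square_less_1)
  then have \<kappa>: "0 < \<kappa>" using assms by (simp add: \<kappa>_def)
  have "norm (exp (- (of_real a * w\<^sup>2 + of_real c * w))) \<le> exp (\<bar>c\<bar>\<^sup>2 / (4 * (\<kappa> / 2))) * exp (- (\<kappa> / 2) * (norm w)\<^sup>2)"
    if w: "w \<in> sector" for w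
  proof -
    have 1: "\<kappa> * (norm w)\<^sup>2 \<le> a * Re (w\<^sup>2)"
      using mult_left_mono[OF sector_Re_square[OF w], of a] assms by (simp add: \<kappa>_def ac_simps)
    have "- (c * Re w) \<le> \<bar>c * Re w\<bar>" by simp
    also have "\<dots> \<le> \<bar>c\<bar> * norm w" unfolding abs_mult by (intro mult_left_mono abs_Re_le_cmod) auto
    finally have 2: "- (c * Re w) \<le> \<bar>c\<bar> * norm w" .
    have "norm (exp (- (of_real a * w\<^sup>2 + of_real c * w))) = exp (- (a * Re (w\<^sup>2) + c * Re w))"
      by (simp add: norm_exp_eq_Re)
    also have "\<dots> \<le> exp (- (\<kappa> / 2) * (norm w)\<^sup>2 + (- (\<kappa> / 2) * (norm w)\<^sup>2 + \<bar>c\<bar> * norm w))"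
      using 1 2 by simp
    also have "\<dots> = exp (- (\<kappa> / 2) * (norm w)\<^sup>2) * (exp (- (\<kappa> / 2) * (norm w)\<^sup>2) * exp (\<bar>c\<bar> * norm w))"
      by (simp only: exp_add)
    also have "\<dots> \<le> exp (- (\<kappa> / 2) * (norm w)\<^sup>2) * exp (\<bar>c\<bar>\<^sup>2 / (4 * (\<kappa> / 2)))"
      using \<kappa> by (intro mult_left_mono gaussian_le_exponential) auto
    finally show ?thesis by (simp only: mult.commute)
  qed
  moreover have "(\<lambda>w. exp (- (of_real a * w\<^sup>2 + of_real c * w))) holomorphic_on {w. 0 < Re w}"
    by (intro holomorphic_intros)
  ultimately show ?thesis unfolding decaying_def
    using \<kappa> by (intro conjI exI[of _ "exp (\<bar>c\<bar>\<^sup>2 / (4 * (\<kappa> / 2)))"] exI[of _ "\<kappa> / 2"]) auto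
qed

section \<open>Normalized integrals and the contribution of a pole\<close>

definition cint :: "(real \<Rightarrow> complex) \<Rightarrow> (complex \<Rightarrow> complex) \<Rightarrow> complex" where
  "cint \<gamma> g = line_integral \<gamma> g / (2 * of_real pi * \<i>)"

text \<open>\<open>\<kappa>\<close> is the factor with which a pole at \<open>b\<close> enters the
  normalized integral of \<open>h w / (w - b)\<close>. A pole in the left half plane or to the left
  of the contour is not met when the contour is pushed to the right; a pole to its right is
  encircled clockwise.\<close>

definition pole_response :: "(real \<Rightarrow> complex) \<Rightarrow> complex \<Rightarrow> complex \<Rightarrow> bool" where
  "pole_response \<gamma> b \<kappa> \<longleftrightarrow> Re b < 0 \<and> \<kappa> = 0 \<or> 0 < Re b \<and> b \<in> left_side \<gamma> \<and> \<kappa> = 0 \<or> 0 < Re b \<and> b \<in> right_side \<gamma> \<and> \<kappa> = -1"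

lemma side_not_in_range: "b \<in> left_side \<gamma> \<Longrightarrow> b \<notin> range \<gamma>" "b \<in> right_side \<gamma> \<Longrightarrow> b \<notin> range \<gamma>"
  unfolding left_side_def right_side_def
  by (auto dest!: eventually_happens' [rotated] connected_component_in simp: trivial_limit_at_bot_linorder trivial_limit_at_top_linorder)

text \<open>A pole in the left half plane amounts to none at all, since \<open>1 / (w - b)\<close>
  is then holomorphic and bounded on the right half plane and may be absorbed into
  \<open>h\<close>.\<close>

lemma pole_response_integral:
  assumes \<gamma>: "unbounded_contour (pi / 5) \<gamma>" "range \<gamma> \<subseteq> {w. 0 < Re w}" and h: "decaying h"
    and b: "pole_response \<gamma> b \<kappa>"
  shows "cint \<gamma> (\<lambda>w. 1 / (w - b) * h w) = \<kappa> * h b"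
    and "integrable lborel (\<lambda>t. 1 / (\<gamma> t - b) * h (\<gamma> t) * vector_derivative \<gamma> (at t))"
proof -
  have eq: "(\<lambda>w. 1 / (w - b) * h w) = (\<lambda>w. h w / (w - b))" by auto
  show "cint \<gamma> (\<lambda>w. 1 / (w - b) * h w) = \<kappa> * h b"
    using b unfolding pole_response_def
  proof (elim disjE conjE)
    assume b: "Re b < 0" and \<kappa>: "\<kappa> = 0"
    have "decaying (\<lambda>w. h w * (1 / (w - b)))" by (intro decaying_mult_bounded sector_bounded_simple_fraction h b)
    from line_integral_decaying[OF \<gamma> this] show ?thesis by (simp add: \<kappa> cint_def)
  next
    assume "0 < Re b" "b \<in> left_side \<gamma>" "\<kappa> = 0"
    then show ?thesis unfolding eq cint_def using line_integral_pole_left[OF \<gamma> h] by simp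
  next
    assume "0 < Re b" "b \<in> right_side \<gamma>" "\<kappa> = -1"
    then show ?thesis unfolding eq cint_def using line_integral_pole_right[OF \<gamma> h] by simp
  qed
  have b': "b \<notin> range \<gamma>"
    using b side_not_in_range[of b \<gamma>] \<gamma>(2) unfolding pole_response_def by force
  obtain C \<delta> where C: "0 < \<delta>" "\<And>w. w \<in> sector \<Longrightarrow> norm (h w) \<le> C * exp (- \<delta> * (norm w)\<^sup>2)"
    using h unfolding decaying_def by blast
  have "continuous_on (range \<gamma>) h"
    using h \<gamma>(2) unfolding decaying_def by (meson continuous_on_subset holomorphic_on_imp_continuous_on)
  then have cont: "continuous_on (range \<gamma>) (\<lambda>w. 1 / (w - b) * h w)"
    using b' by (intro continuous_intros) auto
  have "norm (1 / (w - b) * h w) \<le> C * exp (- \<delta> * (norm w)\<^sup>2)" if w: "w \<in> sector" "norm b + 1 \<le> norm w" for w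
  proof -
    have "1 \<le> norm (w - b)" using norm_triangle_ineq2[of w b] w by simp
    then have "norm (1 / (w - b) * h w) \<le> norm (h w)"
      using mult_left_mono[of 1 "norm (w - b)" "norm (h w)"] by (auto simp: norm_divide norm_mult divide_le_eq)
    then show ?thesis using C(2)[OF w(1)] by simp
  qed
  from contour_integrable[OF \<gamma>(1) cont right_contour_gaussian_bound[OF \<gamma>(1) cont C(1) this]]
  show "integrable lborel (\<lambda>t. 1 / (\<gamma> t - b) * h (\<gamma> t) * vector_derivative \<gamma> (at t))" .
qed

text \<open>The linearity that \<open>iterated_integral_sum_prod\<close> asks for: each summand has
  its own pole and is integrable by itself.\<close>

lemma cint_sum_poles:
  assumes \<gamma>: "unbounded_contour (pi / 5) \<gamma>" "range \<gamma> \<subseteq> {w. 0 < Re w}"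
    and h: "\<And>i. i \<in> P \<Longrightarrow> decaying (h i)" and b: "\<And>i. i \<in> P \<Longrightarrow> pole_response \<gamma> (b i) (\<kappa> i)"
  shows "cint \<gamma> (\<lambda>w. \<Sum>i\<in>P. k i * (1 / (w - b i)) * h i w) = (\<Sum>i\<in>P. k i * \<kappa> i * h i (b i))"
proof -
  have "cint \<gamma> (\<lambda>w. \<Sum>i\<in>P. k i * (1 / (w - b i)) * h i w) =
      (\<integral>t. (\<Sum>i\<in>P. k i * (1 / (\<gamma> t - b i) * h i (\<gamma> t) * vector_derivative \<gamma> (at t))) \<partial>lborel) / (2 * of_real pi * \<i>)"
    unfolding cint_def line_integral_def by (simp only: sum_distrib_right mult.assoc)
  also have "(\<integral>t. (\<Sum>i\<in>P. k i * (1 / (\<gamma> t - b i) * h i (\<gamma> t) * vector_derivative \<gamma> (at t))) \<partial>lborel) =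
      (\<Sum>i\<in>P. \<integral>t. k i * (1 / (\<gamma> t - b i) * h i (\<gamma> t) * vector_derivative \<gamma> (at t)) \<partial>lborel)"
    by (rule Bochner_Integration.integral_sum) (intro integrable_mult_right pole_response_integral(2)[OF \<gamma> h b])
  also have "\<dots> = (\<Sum>i\<in>P. k i * line_integral \<gamma> (\<lambda>w. 1 / (w - b i) * h i w))"
    unfolding line_integral_def by (simp only: integral_mult_right_zero)
  also have "\<dots> / (2 * of_real pi * \<i>) = (\<Sum>i\<in>P. k i * cint \<gamma> (\<lambda>w. 1 / (w - b i) * h i w))"
    unfolding cint_def sum_divide_distrib by (simp only: times_divide_eq_right)
  also have "\<dots> = (\<Sum>i\<in>P. k i * \<kappa> i * h i (b i))"
    by (intro sum.cong refl) (simp only: pole_response_integral(1)[OF \<gamma> h b] mult.assoc)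
  finally show ?thesis .
qed

section \<open>The contours and one level of integration\<close>

text \<open>The variables are numbered from 1, the rows and columns of \<open>cdet\<close> from
  0.\<close>

definition U_coord :: "(var \<Rightarrow> complex) \<Rightarrow> nat \<Rightarrow> nat \<Rightarrow> complex" where "U_coord x j l = x (U j (Suc l))"
definition V_coord :: "(var \<Rightarrow> complex) \<Rightarrow> nat \<Rightarrow> nat \<Rightarrow> complex" where "V_coord x j l = x (V j (Suc l))"

lemma sorted_wrt_upt_iff:
  "sorted_wrt Q [a..<b] \<longleftrightarrow> (\<forall>i j. a \<le> i \<and> i < j \<and> j < b \<longrightarrow> Q i j)"
proof
  assume s: "sorted_wrt Q [a..<b]"
  show "\<forall>i j. a \<le> i \<and> i < j \<and> j < b \<longrightarrow> Q i j"
  proof (intro allI impI)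
    fix i j assume ij: "a \<le> i \<and> i < j \<and> j < b"
    then have "Q ([a..<b] ! (i - a)) ([a..<b] ! (j - a))"
      using sorted_wrt_nth_less[OF s, of "i - a" "j - a"] by (simp add: diff_less_mono)
    then show "Q i j" using ij by simp
  qed
qed (auto simp: sorted_wrt_iff_nth_less)

locale contour_setting =
  fixes m :: nat and n :: "nat \<Rightarrow> nat" and \<alpha> \<beta> :: "nat \<Rightarrow> real"
    and Lin Lout Rin Rout :: "nat \<Rightarrow> real \<Rightarrow> complex"
  assumes m_pos: "1 \<le> m"
    and \<alpha>_mono: "strict_mono_on {1..m} \<alpha>"
    and left: "left_contours m Lin Lout"
    and right: "right_contours m Rin Rout"
begin

abbreviation "N \<equiv> ext m n"
abbreviation "F \<equiv> F_fun \<alpha> \<beta>"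

text \<open>
  A set \<open>S\<close> of variables selects one contour for each of them.  The choice \<open>S = {}\<close> is the one that
  survives in the theorem: \<open>\<Gamma>\<^sup>i\<^sup>n\<close> on the left and \<open>\<Gamma>\<^sup>o\<^sup>u\<^sup>t\<close> on the right.
\<close>

definition contour :: "var set \<Rightarrow> var \<Rightarrow> real \<Rightarrow> complex" where
  "contour S a = (case a of U i l \<Rightarrow> if a \<in> S then Lout i else Lin i | V i l \<Rightarrow> if a \<in> S then Rin i else Rout i)"

text \<open>The variables that have two contours to choose from. A choice
  \<open>S \<subseteq> upper\<close> never refers to the values \<open>Lout 1\<close> and
  \<open>Rin 1\<close>.\<close>

definition upper :: "var set" where
  "upper = {U i l | i l. 2 \<le> i} \<union> {V i l | i l. 2 \<le> i}"

lemma Lin_contour: "i \<in> {1..m} \<Longrightarrow> unbounded_contour (2 * pi / 3) (Lin i) \<and> range (Lin i) \<subseteq> {w. Re w < 0}"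
  and Lout_contour: "i \<in> {2..m} \<Longrightarrow> unbounded_contour (2 * pi / 3) (Lout i) \<and> range (Lout i) \<subseteq> {w. Re w < 0}"
  using left by (auto simp: left_contours_def Let_def simp del: upt_Suc)

lemma Rout_contour: "i \<in> {1..m} \<Longrightarrow> unbounded_contour (pi / 5) (Rout i) \<and> range (Rout i) \<subseteq> {w. 0 < Re w}"
  and Rin_contour: "i \<in> {2..m} \<Longrightarrow> unbounded_contour (pi / 5) (Rin i) \<and> range (Rin i) \<subseteq> {w. 0 < Re w}"
  using right by (auto simp: right_contours_def Let_def simp del: upt_Suc)

lemma left_order:
  shows "1 \<le> i \<Longrightarrow> i < j \<Longrightarrow> j \<le> m \<Longrightarrow> tamely_separated (Lin j) (Lin i)"
    and "1 \<le> i \<Longrightarrow> i \<le> m \<Longrightarrow> 2 \<le> j \<Longrightarrow> j \<le> m \<Longrightarrow> tamely_separated (Lin i) (Lout j)"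
    and "2 \<le> i \<Longrightarrow> i < j \<Longrightarrow> j \<le> m \<Longrightarrow> tamely_separated (Lout i) (Lout j)"
  using left
  by (auto simp: left_contours_def Let_def sorted_wrt_append sorted_wrt_map sorted_wrt_rev sorted_wrt_upt_iff simp del: upt_Suc)

lemma right_order:
  shows "2 \<le> i \<Longrightarrow> i < j \<Longrightarrow> j \<le> m \<Longrightarrow> left_of (Rin i) (Rin j) \<and> tamely_separated (Rin j) (Rin i)"
    and "2 \<le> i \<Longrightarrow> i \<le> m \<Longrightarrow> 1 \<le> j \<Longrightarrow> j \<le> m \<Longrightarrow> left_of (Rout j) (Rin i) \<and> tamely_separated (Rin i) (Rout j)"
    and "1 \<le> i \<Longrightarrow> i < j \<Longrightarrow> j \<le> m \<Longrightarrow> left_of (Rout j) (Rout i) \<and> tamely_separated (Rout i) (Rout j)"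
  using right
  by (auto simp: right_contours_def Let_def sorted_wrt_append sorted_wrt_map sorted_wrt_rev sorted_wrt_upt_iff simp del: upt_Suc)

lemma contour_V:
  assumes "i \<in> {1..m}" "S \<subseteq> upper"
  shows "unbounded_contour (pi / 5) (contour S (V i l)) \<and> range (contour S (V i l)) \<subseteq> {w. 0 < Re w}"
  using assms Rout_contour[of i] Rin_contour[of i] by (auto simp: contour_def upper_def)

lemma contour_U:
  assumes "i \<in> {1..m}" "S \<subseteq> upper"
  shows "unbounded_contour (2 * pi / 3) (contour S (U i l)) \<and> range (contour S (U i l)) \<subseteq> {w. Re w < 0}"
  using assms Lin_contour[of i] Lout_contour[of i] by (auto simp: contour_def upper_def)

text \<open>The right \<open>in\<close> contour of level \<open>k + 1\<close> lies to the right of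
  every contour of level \<open>k\<close>, the \<open>out\<close> contour to the left of every one.
  So a pole on level \<open>k\<close> is never to the right of the former and always to the right of
  the latter.\<close>

lemma pole_response_contour:
  assumes "k \<in> {1..<m}" "S \<subseteq> upper" "b \<in> range (contour S (V k l'))"
  shows "pole_response (contour S (V (Suc k) l)) b (if V (Suc k) l \<in> S then 0 else -1)"
proof -
  have "0 < Re b" using contour_V[of k S l'] assms by auto
  moreover have "b \<in> left_side (Rin (Suc k))" if "V (Suc k) l \<in> S"
    using assms right_order(1)[of k "Suc k"] right_order(2)[of "Suc k" k]
    by (auto simp: contour_def left_of_def upper_def split: if_splits)
  moreover have "b \<in> right_side (Rout (Suc k))" if "V (Suc k) l \<notin> S"
    using assms right_order(2)[of k "Suc k"] right_order(3)[of k "Suc k"]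
    by (auto simp: contour_def left_of_def upper_def split: if_splits)
  ultimately show ?thesis by (auto simp: pole_response_def contour_def)
qed

lemma F_eq: "2 \<le> j \<Longrightarrow> F j w = exp (of_real (\<alpha> j - \<alpha> (j - 1)) * w\<^sup>2 + of_real (\<beta> j - \<beta> (j - 1)) * w)"
  by (auto simp: F_fun_def f_fun_def exp_diff[symmetric] algebra_simps)

lemma F_nonzero: "F j w \<noteq> 0"
  by (simp add: F_fun_def f_fun_def)

text \<open>For \<open>j \<ge> 2\<close> the cubic terms of \<open>f_j\<close> and
  \<open>f_(j-1)\<close> cancel, and the increase of \<open>\<alpha>\<close> makes
  \<open>1 / F j\<close> a Gaussian.\<close>

lemma decaying_F:
  assumes "j \<in> {2..m}" shows "decaying (\<lambda>w. 1 / F j w)"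
proof -
  have "\<alpha> (j - 1) < \<alpha> j" using strict_mono_onD[OF \<alpha>_mono, of "j - 1" j] assms by auto
  then have "decaying (\<lambda>w. exp (- (of_real (\<alpha> j - \<alpha> (j - 1)) * w\<^sup>2 + of_real (\<beta> j - \<beta> (j - 1)) * w)))"
    by (intro decaying_gaussian) simp
  moreover have "1 / F j w = exp (- (of_real (\<alpha> j - \<alpha> (j - 1)) * w\<^sup>2 + of_real (\<beta> j - \<beta> (j - 1)) * w))" for w
    using F_eq[of j w] assms by (simp only: exp_minus inverse_eq_divide) simp
  ultimately show ?thesis by simp
qed

text \<open>
  For fixed \<open>U\<close>, \<open>tail_sum x i B\<close> is what remains of the integrand after the levels above \<open>i\<close> of the
  variables \<open>V\<close> have been replaced by residues, as a function of the \<open>i\<close>-th level \<open>B\<close>.  It is the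
  antisymmetrization of \<open>tail_product\<close>, in which \<open>V\<^sup>(\<^sup>j\<^sup>)\<close> is the initial segment of \<open>V\<^sup>(\<^sup>j\<^sup>-\<^sup>1\<^sup>)\<close>; the factor
  \<open>tail_count\<close> vanishes unless the level sizes decrease.
\<close>

definition tail_product :: "(var \<Rightarrow> complex) \<Rightarrow> nat \<Rightarrow> (nat \<Rightarrow> complex) \<Rightarrow> complex" where
  "tail_product x i B = (\<Prod>j=i..m. cdet (N j) (U_coord x j) (\<lambda>l. if l < N (Suc j) then U_coord x (Suc j) l else B l) *
     (\<Prod>l<N j. 1 / F j (B l)))"

definition tail_count :: "nat \<Rightarrow> complex" where
  "tail_count i = (\<Prod>j=i..m. if N (Suc j) \<le> N j then fact (N (Suc j)) / fact (N j - N (Suc j)) else 0)"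

definition tail_sum :: "(var \<Rightarrow> complex) \<Rightarrow> nat \<Rightarrow> (nat \<Rightarrow> complex) \<Rightarrow> complex" where
  "tail_sum x i B = tail_count i * (\<Sum>\<rho> | \<rho> permutes {..<N i}. of_int (sign \<rho>) * tail_product x i (B \<circ> \<rho>))"

definition link :: "(var \<Rightarrow> complex) \<Rightarrow> nat \<Rightarrow> complex" where
  "link x j = cdet (N j + N (Suc j)) (cat (N j) (U_coord x j) (V_coord x (Suc j))) (cat (N j) (V_coord x j) (U_coord x (Suc j)))"

text \<open>Interpolates between the given integrand, at \<open>i = m + 1\<close> with an empty
  tail, and the result of eliminating all levels from 2 on, at \<open>i = 1\<close> without
  links.\<close>

definition partial_integrand :: "nat \<Rightarrow> (var \<Rightarrow> complex) \<Rightarrow> complex" where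
  "partial_integrand i x = cdet (N 1) (V_coord x 1) (U_coord x 1) * (\<Prod>j=1..<i. link x j * (\<Prod>l<N j. 1 / F j (V_coord x j l)))
     * tail_sum x i (V_coord x i) * (\<Prod>j=1..m. \<Prod>l<N j. F j (U_coord x j l))"

lemma tail_count_nonzero_decreasing:
  assumes "tail_count i \<noteq> 0" "i \<le> j" "j \<le> m" shows "N (Suc j) \<le> N j"
proof (rule ccontr)
  assume "\<not> N (Suc j) \<le> N j"
  then have "tail_count i = 0" using assms(2,3) unfolding tail_count_def by (intro prod_zero) (auto intro!: bexI[of _ j])
  then show False using assms(1) by simp
qed

lemma tail_count_nonzero_le:
  assumes "tail_count i \<noteq> 0" "i \<le> j" "j \<le> Suc m" shows "N j \<le> N i"
  using assms(2,3)
proof (induction j rule: dec_induct)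
  case (step j)
  then show ?case using tail_count_nonzero_decreasing[OF assms(1), of j] by simp
qed simp

text \<open>\<open>tail_product\<close> can read \<open>B\<close> beyond the first
  \<open>N i\<close> entries only if some later level is larger than level \<open>i\<close>; then
  \<open>tail_count\<close> is 0 and both sides vanish.\<close>

lemma tail_sum_cong:
  assumes "\<And>l. l < N i \<Longrightarrow> A l = B l" shows "tail_sum x i A = tail_sum x i B"
proof (cases "tail_count i = 0")
  case False
  have "tail_product x i (A \<circ> \<rho>) = tail_product x i (B \<circ> \<rho>)" if \<rho>: "\<rho> permutes {..<N i}" for \<rho>
    unfolding tail_product_def
  proof (intro prod.cong refl arg_cong2[where f = "(*)"])
    fix j assume j: "j \<in> {i..m}"
    have eq: "(A \<circ> \<rho>) l = (B \<circ> \<rho>) l" if "l < N j" for l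
      using tail_count_nonzero_le[OF False, of j] j that permutes_in_image[OF \<rho>, of l] assms[of "\<rho> l"] by simp
    show "cdet (N j) (U_coord x j) (\<lambda>l. if l < N (Suc j) then U_coord x (Suc j) l else (A \<circ> \<rho>) l) =
       cdet (N j) (U_coord x j) (\<lambda>l. if l < N (Suc j) then U_coord x (Suc j) l else (B \<circ> \<rho>) l)"
      using eq by (intro cdet_cong) auto
    show "1 / F j ((A \<circ> \<rho>) l) = 1 / F j ((B \<circ> \<rho>) l)" if "l \<in> {..<N j}" for l using eq that by simp
  qed
  then show ?thesis by (simp add: tail_sum_def)
qed (simp add: tail_sum_def)

text \<open>The factor \<open>1 / F i\<close> at the varying coordinate supplies the decay.
  Everything else stays bounded: as functions of \<open>w\<close> the determinants have poles only
  at U variables, which lie in the left half plane, and the further \<open>1 / F j\<close> decay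
  themselves.\<close>

lemma decaying_tail_product:
  assumes i: "i \<in> {2..m}" and k: "k < N i" and u: "\<And>j l. j \<in> {i..m} \<Longrightarrow> l < N j \<Longrightarrow> Re (U_coord x j l) < 0"
  shows "decaying (\<lambda>w. tail_product x i (B(k := w)))"
proof -
  let ?d = "\<lambda>j w. cdet (N j) (U_coord x j) (\<lambda>l. if l < N (Suc j) then U_coord x (Suc j) l else (B(k := w)) l)"
  have d: "sector_bounded (?d j)" if j: "j \<in> {i..m}" for j
    unfolding cdet_def
  proof (intro sector_bounded_sum sector_bounded_mult sector_bounded_prod sector_bounded_const)
    fix p l assume "p \<in> {p. p permutes {..<N j}}" "l \<in> {..<N j}"
    then have "Re (U_coord x j l) < 0" using u[OF j] by simp
    then show "sector_bounded (\<lambda>w. 1 / (U_coord x j l - (if p l < N (Suc j) then U_coord x (Suc j) (p l) else (B(k := w)) (p l))))"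
      by (cases "p l < N (Suc j)"; cases "p l = k")
        (auto intro: sector_bounded_const sector_bounded_simple_fraction)
  qed
  have f: "sector_bounded (\<lambda>w. 1 / F j ((B(k := w)) l))" if "j \<in> {i..m}" for j l
  proof (cases "l = k")
    case True
    then show ?thesis using decaying_imp_sector_bounded[OF decaying_F[of j]] that i by simp
  qed (simp add: sector_bounded_const)
  have fact_i: "decaying (\<lambda>w. \<Prod>l<N i. 1 / F i ((B(k := w)) l))"
  proof -
    have "decaying (\<lambda>w. 1 / F i w * (\<Prod>l\<in>{..<N i} - {k}. 1 / F i ((B(k := w)) l)))"
      using i by (intro decaying_mult_bounded decaying_F sector_bounded_prod f) auto
    moreover have "(\<Prod>l<N i. 1 / F i ((B(k := w)) l)) = 1 / F i w * (\<Prod>l\<in>{..<N i} - {k}. 1 / F i ((B(k := w)) l))" for w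
      using k by (subst prod.remove[of _ k]) auto
    ultimately show ?thesis by simp
  qed
  have "decaying (\<lambda>w. ((\<Prod>l<N i. 1 / F i ((B(k := w)) l)) * ?d i w) *
     (\<Prod>j\<in>{i..m}-{i}. ?d j w * (\<Prod>l<N j. 1 / F j ((B(k := w)) l))))"
    using i by (intro decaying_mult_bounded fact_i sector_bounded_prod sector_bounded_mult d f) auto
  moreover have "tail_product x i (B(k := w)) = ((\<Prod>l<N i. 1 / F i ((B(k := w)) l)) * ?d i w) *
     (\<Prod>j\<in>{i..m}-{i}. ?d j w * (\<Prod>l<N j. 1 / F j ((B(k := w)) l)))" for w
    unfolding tail_product_def using i by (subst prod.remove[of _ i]) (auto simp: mult.commute)
  ultimately show ?thesis by simp
qed

lemma decaying_tail_sum: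
  assumes i: "i \<in> {2..m}" and k: "k < N i" and u: "\<And>j l. j \<in> {i..m} \<Longrightarrow> l < N j \<Longrightarrow> Re (U_coord x j l) < 0"
  shows "decaying (\<lambda>w. tail_sum x i (B(k := w)))"
  unfolding tail_sum_def
proof (intro decaying_cmult decaying_sum)
  fix \<rho> assume "\<rho> \<in> {\<rho>. \<rho> permutes {..<N i}}"
  then have \<rho>: "\<rho> permutes {..<N i}" by simp
  \<comment> \<open>Changing entry \<open>k\<close> of \<open>B\<close> changes the single entry of
    \<open>B \<circ> \<rho>\<close> at the preimage of \<open>k\<close>.\<close>
  have "B(k := w) \<circ> \<rho> = (B \<circ> \<rho>)(inv_into UNIV \<rho> k := w)" for w
    using permutes_inverses[OF \<rho>] by (auto simp: fun_eq_iff)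
  moreover have "inv_into UNIV \<rho> k < N i"
    using permutes_in_image[OF permutes_inv[OF \<rho>], of k] k by simp
  ultimately show "decaying (\<lambda>w. tail_product x i (B(k := w) \<circ> \<rho>))"
    using decaying_tail_product[OF i _ u] by simp
qed

end

lemma prod_lessThan_add: "(\<Prod>i<M + N. f i) = (\<Prod>i<M. f i) * (\<Prod>l<N. f (M + l :: nat) :: 'c :: comm_monoid_mult)"
  by (induction N) (auto simp: mult.assoc)

section \<open>Replacing one level of V by residues\<close>

context contour_setting
begin

definition level_vars :: "nat \<Rightarrow> var list" where
  "level_vars i = map (\<lambda>l. V i (Suc l)) [0..<N i]"

lemma set_level_vars: "set (level_vars i) = (\<lambda>l. V i (Suc l)) ` {..<N i}"
  by (auto simp: level_vars_def)

lemma distinct_level_vars: "distinct (level_vars i)"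
  by (auto simp: level_vars_def distinct_map inj_on_def)

lemma prod_level_vars: "(\<Prod>a\<in>set (level_vars i). f a) = (\<Prod>l<N i. f (V i (Suc l)))"
  unfolding set_level_vars by (subst prod.reindex) (auto simp: inj_on_def)

lemma tail_product_cong:
  assumes "\<And>j l. U_coord x j l = U_coord y j l" shows "tail_product x i B = tail_product y i B"
proof -
  have "U_coord x = U_coord y" using assms by (intro HOL.ext) auto
  then show ?thesis by (simp only: tail_product_def)
qed

lemma tail_sum_cong_U:
  assumes "\<And>j l. U_coord x j l = U_coord y j l" shows "tail_sum x i B = tail_sum y i B"
  using tail_product_cong[OF assms] by (simp add: tail_sum_def)

text \<open>The combinatorial content of one descent. The sum runs over the Leibniz terms of
  \<open>link x k\<close> after residues have replaced the variables of level \<open>k + 1\<close>;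
  \<open>b\<close> stands for level \<open>k\<close>. Only injections of the upper level into level
  \<open>k\<close> contribute, with a factor \<open>-1\<close> for each residue, and they add up to
  an antisymmetrization again.\<close>

lemma tail_sum_step:
  fixes x :: "var \<Rightarrow> complex" and b :: "nat \<Rightarrow> complex"
  assumes k: "k \<in> {1..m}"
  shows "(\<Sum>\<pi> | \<pi> permutes {..<N k + N (Suc k)}. of_int (sign \<pi>) *
      (\<Prod>j<N k. 1 / (U_coord x k j - cat (N k) b (U_coord x (Suc k)) (\<pi> j))) *
      (if \<forall>l<N (Suc k). \<pi> (N k + l) < N k then (-1) ^ N (Suc k) else 0) *
      tail_sum x (Suc k) (\<lambda>l. cat (N k) b (U_coord x (Suc k)) (\<pi> (N k + l)))) * (\<Prod>l<N k. 1 / F k (b l)) = tail_sum x k b"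
    (is "?L * ?R = _")
proof -
  let ?M = "N k" and ?N = "N (Suc k)"
  let ?P = "{\<pi>. \<pi> permutes {..<?M + ?N} \<and> (\<forall>l<?N. \<pi> (?M + l) < ?M)}"
  let ?Y = "\<lambda>\<tau>::nat \<Rightarrow> nat. cdet ?M (U_coord x k) (\<lambda>j. if j < ?N then U_coord x (Suc k) j else b (\<tau> j))"
  have fin: "finite {\<pi>::nat \<Rightarrow> nat. \<pi> permutes {..<?M + ?N}}" by (rule finite_permutations) simp
  have "?L = (\<Sum>\<pi>\<in>?P. (-1) ^ ?N * (of_int (sign \<pi>) * (\<Prod>j<?M. 1 / (U_coord x k j - cat ?M b (U_coord x (Suc k)) (\<pi> j))) *
      tail_sum x (Suc k) (\<lambda>l. b (\<pi> (?M + l)))))"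
  proof (rule sum.mono_neutral_cong_right[OF fin])
    fix \<pi> assume \<pi>: "\<pi> \<in> ?P"
    have "tail_sum x (Suc k) (\<lambda>l. cat ?M b (U_coord x (Suc k)) (\<pi> (?M + l))) = tail_sum x (Suc k) (\<lambda>l. b (\<pi> (?M + l)))"
      using \<pi> by (intro tail_sum_cong) (auto simp: cat_def)
    then show "of_int (sign \<pi>) * (\<Prod>j<?M. 1 / (U_coord x k j - cat ?M b (U_coord x (Suc k)) (\<pi> j))) *
        (if \<forall>l<?N. \<pi> (?M + l) < ?M then (-1) ^ ?N else 0) *
        tail_sum x (Suc k) (\<lambda>l. cat ?M b (U_coord x (Suc k)) (\<pi> (?M + l))) =
        (-1) ^ ?N * (of_int (sign \<pi>) * (\<Prod>j<?M. 1 / (U_coord x k j - cat ?M b (U_coord x (Suc k)) (\<pi> j))) *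
        tail_sum x (Suc k) (\<lambda>l. b (\<pi> (?M + l))))"
      using \<pi> by (simp add: ac_simps)
  qed auto
  also have "\<dots> = (-1) ^ ?N * (\<Sum>\<pi>\<in>?P. of_int (sign \<pi>) * (\<Prod>j<?M. 1 / (U_coord x k j - cat ?M b (U_coord x (Suc k)) (\<pi> j))) *
      tail_sum x (Suc k) (\<lambda>l. b (\<pi> (?M + l))))"
    by (rule sum_distrib_left[symmetric])
  finally have L: "?L = \<dots>" .
  have count: "tail_count k = (if ?N \<le> ?M then fact ?N / fact (?M - ?N) else 0) * tail_count (Suc k)"
    unfolding tail_count_def using k by (subst prod.atLeast_Suc_atMost) auto
  show ?thesis
  proof (cases "?N \<le> ?M")
    case False
    \<comment> \<open>Pigeonhole: \<open>N (k + 1)\<close> rows cannot take distinct columns among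
      fewer than that many. On the other side \<open>tail_count k\<close> vanishes.\<close>
    have "?P = {}"
    proof (rule ccontr)
      assume "?P \<noteq> {}"
      then obtain \<pi> where \<pi>: "\<pi> \<in> ?P" by blast
      then have "inj \<pi>" by (auto intro: permutes_inj)
      then have "inj_on (\<lambda>l. \<pi> (?M + l)) {..<?N}" by (intro inj_onI) (metis add_left_cancel injD)
      moreover have "(\<lambda>l. \<pi> (?M + l)) ` {..<?N} \<subseteq> {..<?M}" using \<pi> by auto
      ultimately have "?N \<le> ?M" using card_inj_on_le[of _ "{..<?N}" "{..<?M}"] by fastforce
      then show False using False by simp
    qed
    then have "?L = 0" unfolding L by (simp only: sum.empty mult_zero_right)
    moreover have "tail_count k = 0" using False by (simp only: count if_False mult_zero_left)
    ultimately show ?thesis by (simp only: tail_sum_def mult_zero_left)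
  next
    case True
    have "?L = (-1) ^ ?N * ((-1) ^ ?N / fact (?M - ?N) * (\<Sum>\<tau> | \<tau> permutes {..<?M}.
        of_int (sign \<tau>) * ?Y \<tau> * tail_sum x (Suc k) (b \<circ> \<tau>)))"
      unfolding L by (subst sum_matching_permutations[OF tail_sum_cong True]) auto
    \<comment> \<open>The factors \<open>-1\<close> of the residues cancel the sign of the block
      swap.\<close>
    also have "\<dots> = 1 / fact (?M - ?N) * (\<Sum>\<tau> | \<tau> permutes {..<?M}.
        of_int (sign \<tau>) * ?Y \<tau> * tail_sum x (Suc k) (b \<circ> \<tau>))"
      by (simp add: power_mult_distrib[symmetric] flip: mult.assoc times_divide_eq_right)
    also have "(\<Sum>\<tau> | \<tau> permutes {..<?M}. of_int (sign \<tau>) * ?Y \<tau> * tail_sum x (Suc k) (b \<circ> \<tau>)) =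
       tail_count (Suc k) * (\<Sum>\<tau> | \<tau> permutes {..<?M}. of_int (sign \<tau>) * ?Y \<tau> *
         (\<Sum>\<rho> | \<rho> permutes {..<?N}. of_int (sign \<rho>) * tail_product x (Suc k) (b \<circ> (\<tau> \<circ> \<rho>))))"
      by (simp only: tail_sum_def sum_distrib_left o_assoc mult.assoc mult.commute mult.left_commute)
    \<comment> \<open>Permuting the first \<open>N (k + 1)\<close> entries does not affect
      \<open>?Y\<close>, whose first columns are U variables. So the inner antisymmetrization only
      contributes \<open>fact (N (k + 1))\<close>, the numerator in
      \<open>tail_count\<close>.\<close>
    also have "(\<Sum>\<tau> | \<tau> permutes {..<?M}. of_int (sign \<tau>) * ?Y \<tau> *
         (\<Sum>\<rho> | \<rho> permutes {..<?N}. of_int (sign \<rho>) * tail_product x (Suc k) (b \<circ> (\<tau> \<circ> \<rho>)))) =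
       fact ?N * (\<Sum>\<tau> | \<tau> permutes {..<?M}. of_int (sign \<tau>) * ?Y \<tau> * tail_product x (Suc k) (b \<circ> \<tau>))"
    proof (rule sum_sign_absorb[OF True, where T = "\<lambda>\<tau>. tail_product x (Suc k) (b \<circ> \<tau>)"])
      fix \<tau> \<rho> :: "nat \<Rightarrow> nat" assume "\<tau> permutes {..<?M}" and \<rho>: "\<rho> permutes {..<?N}"
      then show "?Y (\<tau> \<circ> \<rho>) = ?Y \<tau>"
        using permutes_not_in[OF \<rho>] by (intro cdet_cong) auto
    qed
    also have "1 / fact (?M - ?N) * (tail_count (Suc k) * (fact ?N * Z)) = tail_count k * Z" for Z
      unfolding count using True by (simp only: if_True divide_inverse mult_1_left mult.assoc mult.commute mult.left_commute)
    finally have L': "?L = tail_count k * (\<Sum>\<tau> | \<tau> permutes {..<?M}. of_int (sign \<tau>) * ?Y \<tau> * tail_product x (Suc k) (b \<circ> \<tau>))" .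
    have step: "tail_product x k (b \<circ> \<tau>) = ?Y \<tau> * ?R * tail_product x (Suc k) (b \<circ> \<tau>)" if \<tau>: "\<tau> permutes {..<?M}" for \<tau>
    proof -
      have "(\<Prod>l<?M. 1 / F k ((b \<circ> \<tau>) l)) = ?R"
        using prod.permute[OF \<tau>, of "\<lambda>l. 1 / F k (b l)"] by (simp add: o_def)
      moreover have "cdet ?M (U_coord x k) (\<lambda>l. if l < ?N then U_coord x (Suc k) l else (b \<circ> \<tau>) l) = ?Y \<tau>"
        by (rule cdet_cong) auto
      moreover have "{k..m} = insert k {Suc k..m}" using k by auto
      ultimately show ?thesis unfolding tail_product_def by (simp only: prod.insert finite_atLeastAtMost) simp
    qed
    have "tail_sum x k b = tail_count k * (\<Sum>\<tau> | \<tau> permutes {..<?M}. of_int (sign \<tau>) * (?Y \<tau> * ?R * tail_product x (Suc k) (b \<circ> \<tau>)))"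
      unfolding tail_sum_def
      by (rule arg_cong2[where f = "(*)", OF refl sum.cong[OF refl]]) (simp only: mem_Collect_eq step)
    also have "\<dots> = tail_count k * (\<Sum>\<tau> | \<tau> permutes {..<?M}. of_int (sign \<tau>) * ?Y \<tau> * tail_product x (Suc k) (b \<circ> \<tau>)) * ?R"
      unfolding sum_distrib_left sum_distrib_right by (intro sum.cong refl) (simp only: ac_simps)
    finally show ?thesis by (simp only: L')
  qed
qed

text \<open>
  Every \<open>V (k + 1) l\<close> on its right \<open>out\<close> contour contributes minus the residues at the variables of
  level \<open>k\<close>; on the right \<open>in\<close> contour there is no pole to the right of it.
\<close>

lemma iterated_integral_level:
  assumes S: "S \<subseteq> upper" and k: "k \<in> {1..m}"
    and U: "\<And>j l. j \<in> {1..m} \<Longrightarrow> l < N j \<Longrightarrow> Re (U_coord x j l) < 0"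
    and B: "\<And>l. l < N k \<Longrightarrow> V_coord x k l \<in> range (contour S (V k (Suc l)))"
  shows "iterated_integral (\<lambda>a. cint (contour S a)) (level_vars (Suc k)) (partial_integrand (Suc k)) x =
    (if \<exists>l<N (Suc k). V (Suc k) (Suc l) \<in> S then 0 else partial_integrand k x)"
proof -
  let ?M = "N k" and ?N = "N (Suc k)" and ?as = "level_vars (Suc k)"
  let ?col = "cat ?M (V_coord x k) (U_coord x (Suc k))"
  \<comment> \<open>\<open>C\<close> and \<open>?R\<close> collect what does not involve V of level
    \<open>k + 1\<close>. Below, \<open>b \<pi> a\<close> is the pole that the Leibniz term
    \<open>\<pi>\<close> assigns to the variable \<open>a\<close>, and
    \<open>\<kappa> \<pi> a\<close> is its contribution: a column from \<open>N k\<close> on is a U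
    variable, whose pole in the left half plane contributes 0.\<close>
  define C where "C = cdet (N 1) (V_coord x 1) (U_coord x 1) * (\<Prod>j=1..<k. link x j * (\<Prod>l<N j. 1 / F j (V_coord x j l)))
     * (\<Prod>j=1..m. \<Prod>l<N j. F j (U_coord x j l))"
  let ?R = "\<Prod>l<?M. 1 / F k (V_coord x k l)"
  let ?P = "{\<pi>. \<pi> permutes {..<?M + ?N}}"
  define c where "c \<pi> = C * ?R * (of_int (sign \<pi>) * (\<Prod>j<?M. 1 / (U_coord x k j - ?col (\<pi> j))))" for \<pi>
  define b where "b \<pi> a = (case a of V _ l \<Rightarrow> ?col (\<pi> (?M + (l - 1))) | U _ _ \<Rightarrow> 0)" for \<pi> :: "nat \<Rightarrow> nat" and a
  define \<kappa> where "\<kappa> \<pi> a = (case a of V _ l \<Rightarrow> if \<pi> (?M + (l - 1)) < ?M \<and> a \<notin> S then -1 else (0 :: complex) | U _ _ \<Rightarrow> 0)"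
    for \<pi> :: "nat \<Rightarrow> nat" and a :: var
  define H where "H y = tail_sum y (Suc k) (V_coord y (Suc k))" for y
  have "iterated_integral (\<lambda>a. cint (contour S a)) ?as (partial_integrand (Suc k)) x =
    iterated_integral (\<lambda>a. cint (contour S a)) ?as (\<lambda>y. \<Sum>\<pi>\<in>?P. c \<pi> * (\<Prod>a\<in>set ?as. 1 / (y a - b \<pi> a)) * H y) x"
  proof (rule iterated_integral_cong[where K = "\<lambda>_. UNIV"])
    fix a and g h :: "complex \<Rightarrow> complex" assume "\<And>w. w \<in> UNIV \<Longrightarrow> g w = h w"
    then have "g = h" by auto
    then show "cint (contour S a) g = cint (contour S a) h" by simp
  next
    fix y assume y: "\<And>a. a \<notin> set ?as \<Longrightarrow> y a = x a"
    have eqU: "U_coord y = U_coord x" using y by (auto simp: U_coord_def set_level_vars fun_eq_iff)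
    have eqV: "V_coord y j l = V_coord x j l" if "j \<noteq> Suc k" for j l using y that by (auto simp: V_coord_def set_level_vars)
    have eqV': "V_coord y j = V_coord x j" if "j \<noteq> Suc k" for j using eqV that by auto
    have split: "{1..<Suc k} = insert k {1..<k}" using k by auto
    have first: "cdet (N 1) (V_coord y 1) (U_coord x 1) = cdet (N 1) (V_coord x 1) (U_coord x 1)" using eqV'[of 1] k by simp
    have "(\<Prod>j=1..<k. link y j * (\<Prod>l<N j. 1 / F j (V_coord y j l))) = (\<Prod>j=1..<k. link x j * (\<Prod>l<N j. 1 / F j (V_coord x j l)))"
      unfolding link_def by (intro prod.cong refl) (simp add: eqU eqV')
    moreover have "(\<Prod>l<N k. 1 / F k (V_coord y k l)) = ?R" using eqV'[of k] by simp
    ultimately have "(\<Prod>j=1..<Suc k. link y j * (\<Prod>l<N j. 1 / F j (V_coord y j l))) =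
        link y k * ?R * (\<Prod>j=1..<k. link x j * (\<Prod>l<N j. 1 / F j (V_coord x j l)))"
      unfolding split by (subst prod.insert) simp_all
    then have 1: "partial_integrand (Suc k) y = C * ?R * link y k * H y"
      by (simp only: partial_integrand_def C_def H_def first eqU mult.assoc mult.commute mult.left_commute)
    \<comment> \<open>The first \<open>N k\<close> rows hold U variables, and no column is a V of
      level \<open>k + 1\<close>, so in each term every integrated variable is confined to one
      simple fraction.\<close>
    have "link y k = (\<Sum>\<pi>\<in>?P. of_int (sign \<pi>) * ((\<Prod>j<?M. 1 / (U_coord x k j - ?col (\<pi> j))) * (\<Prod>a\<in>set ?as. 1 / (y a - b \<pi> a))))"
      unfolding link_def cdet_def
    proof (rule sum.cong[OF refl])
      fix \<pi> :: "nat \<Rightarrow> nat"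
      have "(\<Prod>i<?M + ?N. 1 / (cat ?M (U_coord y k) (V_coord y (Suc k)) i - ?col (\<pi> i))) =
         (\<Prod>i<?M. 1 / (cat ?M (U_coord y k) (V_coord y (Suc k)) i - ?col (\<pi> i))) *
         (\<Prod>l<?N. 1 / (cat ?M (U_coord y k) (V_coord y (Suc k)) (?M + l) - ?col (\<pi> (?M + l))))"
        by (rule prod_lessThan_add)
      also have "(\<Prod>i<?M. 1 / (cat ?M (U_coord y k) (V_coord y (Suc k)) i - ?col (\<pi> i))) = (\<Prod>j<?M. 1 / (U_coord x k j - ?col (\<pi> j)))"
        by (intro prod.cong refl) (simp add: cat_def eqU)
      also have "(\<Prod>l<?N. 1 / (cat ?M (U_coord y k) (V_coord y (Suc k)) (?M + l) - ?col (\<pi> (?M + l)))) =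
         (\<Prod>a\<in>set ?as. 1 / (y a - b \<pi> a))"
        unfolding prod_level_vars by (intro prod.cong refl) (simp add: cat_def V_coord_def b_def)
      finally show "of_int (sign \<pi>) * (\<Prod>i<?M + ?N. 1 / (cat ?M (U_coord y k) (V_coord y (Suc k)) i - cat ?M (V_coord y k) (U_coord y (Suc k)) (\<pi> i))) =
         of_int (sign \<pi>) * ((\<Prod>j<?M. 1 / (U_coord x k j - ?col (\<pi> j))) * (\<Prod>a\<in>set ?as. 1 / (y a - b \<pi> a)))"
        using eqU eqV'[of k] by simp
    qed
    then show "partial_integrand (Suc k) y = (\<Sum>\<pi>\<in>?P. c \<pi> * (\<Prod>a\<in>set ?as. 1 / (y a - b \<pi> a)) * H y)"
      unfolding 1 c_def by (simp only: sum_distrib_left sum_distrib_right ac_simps)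
  qed
  also have "\<dots> = (\<Sum>\<pi>\<in>?P. c \<pi> * (\<Prod>a\<in>set ?as. \<kappa> \<pi> a) * H (\<lambda>a. if a \<in> set ?as then b \<pi> a else x a))"
  proof (rule iterated_integral_sum_prod[where good = "\<lambda>_. decaying"])
    show "finite ?P" by (rule finite_permutations) simp
    show "distinct ?as" by (rule distinct_level_vars)
  next
    fix a and k' :: "(nat \<Rightarrow> nat) \<Rightarrow> complex" and h :: "(nat \<Rightarrow> nat) \<Rightarrow> complex \<Rightarrow> complex"
    assume a: "a \<in> set ?as" and h: "\<And>\<pi>. \<pi> \<in> ?P \<Longrightarrow> decaying (h \<pi>)"
    then obtain l where l: "a = V (Suc k) (Suc l)" "l < ?N" by (auto simp: set_level_vars)
    then have sk: "Suc k \<in> {1..m}" by (auto simp: ext_def split: if_splits)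
    show "cint (contour S a) (\<lambda>w. \<Sum>\<pi>\<in>?P. k' \<pi> * (1 / (w - b \<pi> a)) * h \<pi> w) = (\<Sum>\<pi>\<in>?P. k' \<pi> * \<kappa> \<pi> a * h \<pi> (b \<pi> a))"
    proof (rule cint_sum_poles[OF _ _ h])
      show "unbounded_contour (pi / 5) (contour S a)" "range (contour S a) \<subseteq> {w. 0 < Re w}"
        using contour_V[OF sk S] l by auto
      fix \<pi> assume "\<pi> \<in> ?P"
      then have \<pi>: "\<pi> (?M + l) < ?M + ?N" using permutes_in_image[of \<pi> "{..<?M + ?N}" "?M + l"] l by simp
      show "pole_response (contour S a) (b \<pi> a) (\<kappa> \<pi> a)"
      proof (cases "\<pi> (?M + l) < ?M")
        case True
        then show ?thesis
          using pole_response_contour[OF _ S B[OF True], of "Suc l"] k sk l by (auto simp: b_def \<kappa>_def cat_def)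
      next
        case False
        then have "Re (b \<pi> a) < 0" using U[OF sk, of "\<pi> (?M + l) - ?M"] \<pi> l by (simp add: b_def cat_def)
        then show ?thesis using False l by (simp add: pole_response_def \<kappa>_def)
      qed
    qed
  next
    fix a and y :: "var \<Rightarrow> complex" assume a: "a \<in> set ?as" and y: "\<And>c. c \<notin> set ?as \<Longrightarrow> y c = x c"
    then obtain l where l: "a = V (Suc k) (Suc l)" "l < ?N" by (auto simp: set_level_vars)
    then have sk: "Suc k \<in> {2..m}" using k by (auto simp: ext_def split: if_splits)
    have "U_coord y j i = U_coord x j i" for j i using y by (auto simp: U_coord_def set_level_vars)
    then have "U_coord (y(a := w)) j i = U_coord x j i" for w j i by (simp add: U_coord_def l)
    then have "tail_sum (y(a := w)) (Suc k) B = tail_sum x (Suc k) B" for w B by (rule tail_sum_cong_U)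
    moreover have "V_coord (y(a := w)) (Suc k) = (V_coord y (Suc k))(l := w)" for w
      by (auto simp: V_coord_def l fun_eq_iff)
    ultimately have "tail_sum (y(a := w)) (Suc k) (V_coord (y(a := w)) (Suc k)) = tail_sum x (Suc k) ((V_coord y (Suc k))(l := w))" for w
      by (simp only:)
    moreover have "decaying (\<lambda>w. tail_sum x (Suc k) ((V_coord y (Suc k))(l := w)))"
      using sk by (intro decaying_tail_sum[OF sk l(2)] U) auto
    ultimately show "decaying (\<lambda>w. H (y(a := w)))" unfolding H_def by simp
  qed
  also have "\<dots> = (\<Sum>\<pi>\<in>?P. c \<pi> * (\<Prod>a\<in>set ?as. \<kappa> \<pi> a) * tail_sum x (Suc k) (\<lambda>l. ?col (\<pi> (?M + l))))"
  proof (rule sum.cong[OF refl])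
    fix \<pi>
    let ?y = "\<lambda>a. if a \<in> set ?as then b \<pi> a else x a"
    have "tail_sum ?y (Suc k) (V_coord ?y (Suc k)) = tail_sum x (Suc k) (V_coord ?y (Suc k))"
      by (rule tail_sum_cong_U) (auto simp: U_coord_def set_level_vars)
    also have "\<dots> = tail_sum x (Suc k) (\<lambda>l. ?col (\<pi> (?M + l)))"
      by (rule tail_sum_cong) (auto simp: V_coord_def set_level_vars b_def)
    finally show "c \<pi> * (\<Prod>a\<in>set ?as. \<kappa> \<pi> a) * H ?y = c \<pi> * (\<Prod>a\<in>set ?as. \<kappa> \<pi> a) * tail_sum x (Suc k) (\<lambda>l. ?col (\<pi> (?M + l)))"
      unfolding H_def by simp
  qed
  finally have eq: "iterated_integral (\<lambda>a. cint (contour S a)) ?as (partial_integrand (Suc k)) x = \<dots>" .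
  show ?thesis
  proof (cases "\<exists>l<?N. V (Suc k) (Suc l) \<in> S")
    case True
    then have zero: "(\<Prod>a\<in>set ?as. \<kappa> \<pi> a) = 0" for \<pi>
      unfolding prod_level_vars by (intro prod_zero) (auto simp: \<kappa>_def)
    show ?thesis
      unfolding eq if_P[OF True] by (simp only: zero mult_zero_right mult_zero_left sum.neutral_const)
  next
    case False
    \<comment> \<open>A term survives only if every variable of level \<open>k + 1\<close> takes its
      pole from level \<open>k\<close>.\<close>
    have "(\<Prod>a\<in>set ?as. \<kappa> \<pi> a) = (if \<forall>l<?N. \<pi> (?M + l) < ?M then (-1) ^ ?N else 0)" for \<pi>
    proof (cases "\<forall>l<?N. \<pi> (?M + l) < ?M")
      case True
      then have "(\<Prod>l<?N. \<kappa> \<pi> (V (Suc k) (Suc l))) = (\<Prod>l<?N. -1)"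
        using False by (intro prod.cong) (auto simp: \<kappa>_def)
      then show ?thesis using True unfolding prod_level_vars by simp
    next
      case F: False
      then have zero: "(\<Prod>l<?N. \<kappa> \<pi> (V (Suc k) (Suc l))) = 0"
        by (intro prod_zero) (auto simp: \<kappa>_def)
      show ?thesis unfolding prod_level_vars if_not_P[OF F] by (rule zero)
    qed
    then have "iterated_integral (\<lambda>a. cint (contour S a)) ?as (partial_integrand (Suc k)) x =
       (\<Sum>\<pi>\<in>?P. C * ?R * (of_int (sign \<pi>) * (\<Prod>j<?M. 1 / (U_coord x k j - ?col (\<pi> j))) *
          (if \<forall>l<?N. \<pi> (?M + l) < ?M then (-1) ^ ?N else 0) * tail_sum x (Suc k) (\<lambda>l. ?col (\<pi> (?M + l)))))"
      unfolding eq c_def by (intro sum.cong refl) (simp only: mult.assoc)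
    also have "\<dots> = C * tail_sum x k (V_coord x k)"
      unfolding sum_distrib_left[symmetric] tail_sum_step[OF k, symmetric] by (simp only: ac_simps)
    also have "\<dots> = partial_integrand k x"
      by (simp add: partial_integrand_def C_def ac_simps)
    finally show ?thesis unfolding if_not_P[OF False] .
  qed
qed

end

section \<open>Descending through all levels of V\<close>

context contour_setting
begin

lemma iterated_integral_cint_zero: "iterated_integral (\<lambda>a. cint (\<gamma> a)) as (\<lambda>y. 0) x = 0"
  by (induction as arbitrary: x) (auto simp: cint_def line_integral_def)

lemma cint_cong:
  assumes "\<And>w. w \<in> range \<gamma> \<Longrightarrow> g w = h w" shows "cint \<gamma> g = cint \<gamma> h"
  using assms by (simp add: cint_def line_integral_def)

text \<open>Level 1 is outermost and the highest level innermost, so that the levels are eliminated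
  from the inside.\<close>

definition V_vars :: "nat \<Rightarrow> var list" where
  "V_vars i = concat (map level_vars [1..<Suc i])"

lemma V_vars_Suc: "1 \<le> i \<Longrightarrow> V_vars (Suc i) = V_vars i @ level_vars (Suc i)"
  by (simp add: V_vars_def)

lemma V_vars_1: "V_vars (Suc 0) = level_vars (Suc 0)"
  by (simp add: V_vars_def)

lemma set_V_vars: "set (V_vars i) = {V j (Suc l) | j l. 1 \<le> j \<and> j \<le> i \<and> l < N j}"
proof -
  have "set (V_vars i) = (\<Union>j\<in>{1..<Suc i}. (\<lambda>l. V j (Suc l)) ` {..<N j})"
    by (simp only: V_vars_def set_concat set_map set_upt set_level_vars image_image)
  also have "\<dots> = {V j (Suc l) | j l. 1 \<le> j \<and> j \<le> i \<and> l < N j}"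
    by (force simp: less_Suc_eq_le)
  finally show ?thesis .
qed

text \<open>Peel off the innermost level. When it is integrated, the U lie in the left half plane
  and the level below on its contours, as \<open>iterated_integral_level\<close> demands.\<close>

lemma iterated_integral_chain:
  assumes S: "S \<subseteq> upper" and U: "\<And>j l. j \<in> {1..m} \<Longrightarrow> l < N j \<Longrightarrow> Re (U_coord x j l) < 0"
    and k: "k \<le> m"
  shows "iterated_integral (\<lambda>a. cint (contour S a)) (V_vars (Suc k)) (partial_integrand (Suc k)) x =
    (if \<exists>j\<in>{2..Suc k}. \<exists>l<N j. V j (Suc l) \<in> S then 0
     else iterated_integral (\<lambda>a. cint (contour S a)) (level_vars 1) (partial_integrand 1) x)"
  using k
proof (induction k)
  case 0
  then show ?case by (simp add: V_vars_1)
next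
  case (Suc k)
  let ?J = "\<lambda>a. cint (contour S a)"
  have "iterated_integral ?J (V_vars (Suc (Suc k))) (partial_integrand (Suc (Suc k))) x =
     iterated_integral ?J (V_vars (Suc k)) (iterated_integral ?J (level_vars (Suc (Suc k))) (partial_integrand (Suc (Suc k)))) x"
    by (simp add: V_vars_Suc iterated_integral_append)
  also have "\<dots> = iterated_integral ?J (V_vars (Suc k)) (\<lambda>y. if \<exists>l<N (Suc (Suc k)). V (Suc (Suc k)) (Suc l) \<in> S then 0
      else partial_integrand (Suc k) y) x"
  proof (rule iterated_integral_cong[where K = "\<lambda>a. range (contour S a)"])
    fix y assume y: "\<And>a. a \<in> set (V_vars (Suc k)) \<Longrightarrow> y a \<in> range (contour S a)"
      "\<And>a. a \<notin> set (V_vars (Suc k)) \<Longrightarrow> y a = x a"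
    have "U_coord y j l = U_coord x j l" for j l using y(2) by (auto simp: U_coord_def set_V_vars)
    moreover have "V_coord y (Suc k) l \<in> range (contour S (V (Suc k) (Suc l)))" if "l < N (Suc k)" for l
      using y(1)[of "V (Suc k) (Suc l)"] that by (auto simp: V_coord_def set_V_vars)
    ultimately show "iterated_integral ?J (level_vars (Suc (Suc k))) (partial_integrand (Suc (Suc k))) y =
      (if \<exists>l<N (Suc (Suc k)). V (Suc (Suc k)) (Suc l) \<in> S then 0 else partial_integrand (Suc k) y)"
      using Suc.prems U by (intro iterated_integral_level[OF S]) auto
  qed (rule cint_cong)
  also have "\<dots> = (if \<exists>l<N (Suc (Suc k)). V (Suc (Suc k)) (Suc l) \<in> S then 0
      else iterated_integral ?J (V_vars (Suc k)) (partial_integrand (Suc k)) x)"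
    by (cases "\<exists>l<N (Suc (Suc k)). V (Suc (Suc k)) (Suc l) \<in> S")
      (simp_all only: if_True if_False iterated_integral_cint_zero)
  also have "\<dots> = (if \<exists>j\<in>{2..Suc (Suc k)}. \<exists>l<N j. V j (Suc l) \<in> S then 0
     else iterated_integral ?J (level_vars 1) (partial_integrand 1) x)"
  proof -
    have "{2..Suc (Suc k)} = insert (Suc (Suc k)) {2..Suc k}" by auto
    then have "(\<exists>j\<in>{2..Suc (Suc k)}. \<exists>l<N j. V j (Suc l) \<in> S) \<longleftrightarrow>
       (\<exists>l<N (Suc (Suc k)). V (Suc (Suc k)) (Suc l) \<in> S) \<or> (\<exists>j\<in>{2..Suc k}. \<exists>l<N j. V j (Suc l) \<in> S)"
      by (simp only: bex_simps)
    then show ?thesis using Suc by (simp only: Suc_leD) auto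
  qed
  finally show ?case .
qed

lemma N_Suc_m: "N (Suc m) = 0"
  by (simp add: ext_def)

lemma tail_sum_Suc_m: "tail_sum x (Suc m) B = 1"
  by (simp add: tail_sum_def tail_count_def tail_product_def N_Suc_m)

lemma nth_Uvec: "l < k \<Longrightarrow> Uvec x k i ! l = U_coord x i l" "length (Uvec x k i) = k"
  by (auto simp: Uvec_def U_coord_def simp del: upt_Suc)

lemma nth_Vvec: "l < k \<Longrightarrow> Vvec x k i ! l = V_coord x i l" "length (Vvec x k i) = k"
  by (auto simp: Vvec_def V_coord_def simp del: upt_Suc)

lemma integrand_eq: "integrand m n \<alpha> \<beta> = partial_integrand (Suc m)"
proof (rule HOL.ext)
  fix x
  have "cauchy_det (Vvec x (N 1) 1) (Uvec x (N 1) 1) = cdet (N 1) (V_coord x 1) (U_coord x 1)"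
    by (rule cauchy_det_eq_cdet) (auto simp: nth_Uvec nth_Vvec)
  moreover have "cauchy_det (Uvec x (N i) i @ Vvec x (N (Suc i)) (Suc i)) (Vvec x (N i) i @ Uvec x (N (Suc i)) (Suc i)) = link x i" for i
    unfolding link_def by (rule cauchy_det_eq_cdet) (auto simp: nth_Uvec nth_Vvec nth_append cat_def)
  moreover have "(\<Prod>i=1..m. \<Prod>l=1..n i. F i (x (U i l)) / F i (x (V i l))) =
     (\<Prod>i=1..m. \<Prod>l<N i. F i (U_coord x i l)) * (\<Prod>i=1..m. \<Prod>l<N i. 1 / F i (V_coord x i l))"
    unfolding prod.distrib[symmetric]
  proof (rule prod.cong[OF refl])
    fix i assume "i \<in> {1..m}"
    then have "n i = N i" by (simp add: ext_def)
    then show "(\<Prod>l=1..n i. F i (x (U i l)) / F i (x (V i l))) = (\<Prod>l<N i. F i (U_coord x i l) * (1 / F i (V_coord x i l)))"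
      by (simp add: prod.atLeast1_atMost_eq U_coord_def V_coord_def)
  qed
  moreover have "{1..<Suc m} = {1..m}" by auto
  ultimately show "integrand m n \<alpha> \<beta> x = partial_integrand (Suc m) x"
    by (simp add: integrand_def Let_def partial_integrand_def tail_sum_Suc_m prod.distrib)
qed

lemma iterated_integral_V:
  assumes S: "S \<subseteq> upper" and U: "\<And>j l. j \<in> {1..m} \<Longrightarrow> l < N j \<Longrightarrow> Re (U_coord x j l) < 0"
  shows "iterated_integral (\<lambda>a. cint (contour S a)) (V_vars m) (integrand m n \<alpha> \<beta>) x =
    (if \<exists>j\<in>{2..m}. \<exists>l<N j. V j (Suc l) \<in> S then 0
     else iterated_integral (\<lambda>a. cint (contour S a)) (level_vars 1) (partial_integrand 1) x)"
proof -
  \<comment> \<open>Level \<open>m + 1\<close> is empty: including it lets the first descent, at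
    \<open>k = m\<close>, merely rewrite the last link as a tail.\<close>
  have "V_vars (Suc m) = V_vars m" using m_pos by (simp add: V_vars_Suc level_vars_def N_Suc_m)
  moreover have "(\<exists>j\<in>{2..Suc m}. \<exists>l<N j. V j (Suc l) \<in> S) \<longleftrightarrow> (\<exists>j\<in>{2..m}. \<exists>l<N j. V j (Suc l) \<in> S)"
  proof -
    have "{2..Suc m} = insert (Suc m) {2..m}" using m_pos by auto
    then show ?thesis by (simp only: bex_simps N_Suc_m not_less_zero) blast
  qed
  ultimately show ?thesis
    using iterated_integral_chain[OF S U order_refl] by (simp add: integrand_eq)
qed

end

section \<open>Integrability of the integrand\<close>

text \<open>Write \<open>\<gamma> t\<close> as modulus times direction, with limiting direction
  \<open>s\<close>. The leading coefficient tends to a negative number, so the leading power beats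
  all lower ones and the exponential rate \<open>K\<close>.\<close>

lemma eventually_exp_cubic_le:
  fixes c1 c2 c3 K :: real and \<gamma> :: "real \<Rightarrow> complex" and Q :: "real filter"
  assumes inf: "filterlim \<gamma> at_infinity Q" and sgn: "((\<lambda>t. sgn (\<gamma> t)) \<longlongrightarrow> s) Q"
    and c: "c3 * Re (s ^ 3) < 0 \<or> c3 = 0 \<and> c2 * Re (s\<^sup>2) < 0"
  shows "eventually (\<lambda>t. norm (exp (of_real c3 * \<gamma> t ^ 3 + of_real c2 * (\<gamma> t)\<^sup>2 + of_real c1 * \<gamma> t)) * exp (K * norm (\<gamma> t)) \<le> 1) Q"
proof -
  have Re_pow: "Re (w ^ k) = norm w ^ k * Re (sgn w ^ k)" for w :: complex and k
  proof -
    have "w = norm w *\<^sub>R sgn w" by (cases "w = 0") (auto simp: sgn_div_norm)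
    then have "w ^ k = (norm w ^ k) *\<^sub>R (sgn w ^ k)" by (metis scaleR_power)
    then show ?thesis by (simp only: scaleR_complex.sel(1))
  qed
  have le1: "\<bar>Re (sgn w ^ k)\<bar> \<le> 1" for w :: complex and k
  proof -
    have "norm (sgn w ^ k) \<le> 1" by (simp add: norm_power norm_sgn power_le_one)
    then show ?thesis using abs_Re_le_cmod order_trans by blast
  qed
  have eq: "norm (exp (of_real c3 * w ^ 3 + of_real c2 * w\<^sup>2 + of_real c1 * w)) * exp (K * norm w) =
     exp (c3 * Re (sgn w ^ 3) * norm w ^ 3 + c2 * Re (sgn w ^ 2) * norm w ^ 2 + c1 * Re (sgn w ^ 1) * norm w + K * norm w)" for w
  proof -
    have "Re (of_real c3 * w ^ 3 + of_real c2 * w\<^sup>2 + of_real c1 * w) =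
       c3 * Re (w ^ 3) + c2 * Re (w ^ 2) + c1 * Re (w ^ 1)" by simp
    then show ?thesis unfolding norm_exp_eq_Re exp_add[symmetric]
      by (simp only: Re_pow[of w 3] Re_pow[of w 2] Re_pow[of w 1, unfolded power_one_right] power_one_right ac_simps)
  qed
  have big: "eventually (\<lambda>t. r \<le> norm (\<gamma> t)) Q" for r
    using filterlim_at_infinity_imp_norm_at_top[OF inf] unfolding filterlim_at_top by blast
  have lim: "((\<lambda>t. x * Re (sgn (\<gamma> t) ^ k)) \<longlongrightarrow> x * Re (s ^ k)) Q" for x k
    by (intro tendsto_intros sgn)
  have low: "c1 * Re (sgn w ^ 1) * norm w + K * norm w \<le> (\<bar>c1\<bar> + \<bar>K\<bar>) * norm w" for w :: complex
  proof -
    have "c1 * Re (sgn w ^ 1) \<le> \<bar>c1\<bar> * \<bar>Re (sgn w ^ 1)\<bar>" unfolding abs_mult[symmetric] by (rule abs_ge_self)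
    also have "\<dots> \<le> \<bar>c1\<bar> * 1" by (intro mult_left_mono le1) auto
    finally have "c1 * Re (sgn w ^ 1) + K \<le> \<bar>c1\<bar> + \<bar>K\<bar>" by simp
    from mult_right_mono[OF this, of "norm w"] show ?thesis by (simp add: distrib_right)
  qed
  from c show ?thesis
  proof (elim disjE conjE)
    assume neg: "c3 * Re (s ^ 3) < 0"
    \<comment> \<open>\<open>- a\<close> is half of the limiting coefficient, and the actual
      coefficient eventually stays below it; from modulus \<open>r0\<close> on, \<open>a * r\<close>
      is at least the sum of the moduli of all other coefficients.\<close>
    define a where "a = - (c3 * Re (s ^ 3)) / 2"
    have a: "0 < a" "c3 * Re (s ^ 3) < - a" using neg by (auto simp: a_def)
    define r0 where "r0 = 1 + (\<bar>c2\<bar> + \<bar>c1\<bar> + \<bar>K\<bar>) / a"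
    show ?thesis
      using order_tendstoD(2)[OF lim a(2)] big[of r0]
    proof eventually_elim
      case (elim t)
      define r where "r = norm (\<gamma> t)"
      have r1: "1 \<le> r" using elim(2) a by (simp add: r0_def r_def) (smt (verit) divide_nonneg_pos)
      have "(\<bar>c2\<bar> + \<bar>c1\<bar> + \<bar>K\<bar>) / a \<le> r" using elim(2) by (simp add: r0_def r_def)
      then have ar: "\<bar>c2\<bar> + \<bar>c1\<bar> + \<bar>K\<bar> \<le> a * r" using a(1) by (simp add: field_simps)
      have 3: "c3 * Re (sgn (\<gamma> t) ^ 3) * r ^ 3 \<le> - a * r ^ 3"
        using elim(1) r1 by (intro mult_right_mono) auto
      have "c2 * Re (sgn (\<gamma> t) ^ 2) \<le> \<bar>c2\<bar> * \<bar>Re (sgn (\<gamma> t) ^ 2)\<bar>" unfolding abs_mult[symmetric] by (rule abs_ge_self)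
      also have "\<dots> \<le> \<bar>c2\<bar> * 1" by (intro mult_left_mono le1) auto
      finally have 2: "c2 * Re (sgn (\<gamma> t) ^ 2) * r ^ 2 \<le> \<bar>c2\<bar> * r ^ 2" by (intro mult_right_mono) auto
      have "(\<bar>c1\<bar> + \<bar>K\<bar>) * r \<le> (\<bar>c1\<bar> + \<bar>K\<bar>) * r ^ 2"
        using r1 by (intro mult_left_mono) (auto simp: power2_eq_square)
      then have "c3 * Re (sgn (\<gamma> t) ^ 3) * r ^ 3 + c2 * Re (sgn (\<gamma> t) ^ 2) * r ^ 2 + (c1 * Re (sgn (\<gamma> t) ^ 1) * r + K * r)
         \<le> - a * r ^ 3 + \<bar>c2\<bar> * r ^ 2 + (\<bar>c1\<bar> + \<bar>K\<bar>) * r ^ 2"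
        using 2 3 low[of "\<gamma> t"] unfolding r_def by linarith
      also have "\<dots> = ((\<bar>c2\<bar> + \<bar>c1\<bar> + \<bar>K\<bar>) - a * r) * r ^ 2"
        by (simp add: algebra_simps power2_eq_square power3_eq_cube)
      also have "\<dots> \<le> 0" using ar by (intro mult_nonpos_nonneg) auto
      finally show ?case unfolding eq r_def by (simp add: add.assoc)
    qed
  next
    assume c3: "c3 = 0" and neg: "c2 * Re (s\<^sup>2) < 0"
    define a where "a = - (c2 * Re (s\<^sup>2)) / 2"
    have a: "0 < a" "c2 * Re (s\<^sup>2) < - a" using neg by (auto simp: a_def)
    show ?thesis
      using order_tendstoD(2)[OF lim a(2)] big[of "(\<bar>c1\<bar> + \<bar>K\<bar>) / a"]
    proof eventually_elim
      case (elim t)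
      define r where "r = norm (\<gamma> t)"
      have ar: "\<bar>c1\<bar> + \<bar>K\<bar> \<le> a * r" using a(1) elim(2) by (simp add: field_simps r_def)
      have r0: "0 \<le> r" by (simp add: r_def)
      have "c2 * Re (sgn (\<gamma> t) ^ 2) * r ^ 2 \<le> - a * r ^ 2"
        using elim(1) by (intro mult_right_mono) auto
      then have "c3 * Re (sgn (\<gamma> t) ^ 3) * r ^ 3 + c2 * Re (sgn (\<gamma> t) ^ 2) * r ^ 2 + (c1 * Re (sgn (\<gamma> t) ^ 1) * r + K * r)
         \<le> - a * r ^ 2 + (\<bar>c1\<bar> + \<bar>K\<bar>) * r"
        using c3 low[of "\<gamma> t"] unfolding r_def by simp
      also have "\<dots> = ((\<bar>c1\<bar> + \<bar>K\<bar>) - a * r) * r"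
        by (simp add: algebra_simps power2_eq_square)
      also have "\<dots> \<le> 0" using ar r0 by (intro mult_nonpos_nonneg) auto
      finally show ?case unfolding eq r_def by (simp add: add.assoc)
    qed
  qed
qed

lemma unbounded_contour_exp_cubic:
  fixes c1 c2 c3 K :: real
  assumes \<gamma>: "unbounded_contour \<theta> \<gamma>"
    and c: "c3 * cos (3 * \<theta>) < 0 \<or> c3 = 0 \<and> c2 * cos (2 * \<theta>) < 0"
    and f: "\<And>w. f w = exp (of_real c3 * w ^ 3 + of_real c2 * w\<^sup>2 + of_real c1 * w)"
  shows "\<exists>C. \<forall>t. norm (f (\<gamma> t)) \<le> C * exp (- K * norm (\<gamma> t))"
proof (rule unbounded_contour_bound[OF \<gamma>, where C = 1])
  show "continuous_on (range \<gamma>) f" unfolding f by (intro continuous_intros)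
  have s: "Re (cis \<theta> ^ 3) = cos (3 * \<theta>)" "Re (cis \<theta> ^ 2) = cos (2 * \<theta>)"
    "Re (cis (- \<theta>) ^ 3) = cos (3 * \<theta>)" "Re (cis (- \<theta>) ^ 2) = cos (2 * \<theta>)"
    by (simp_all add: Complex.DeMoivre)
  show "eventually (\<lambda>t. norm (f (\<gamma> t)) * exp (K * norm (\<gamma> t)) \<le> 1) at_top"
    using \<gamma> c unfolding f unbounded_contour_def by (intro eventually_exp_cubic_le[where s = "cis \<theta>"]) (auto simp: s)
  show "eventually (\<lambda>t. norm (f (\<gamma> t)) * exp (K * norm (\<gamma> t)) \<le> 1) at_bot"
    using \<gamma> c unfolding f unbounded_contour_def by (intro eventually_exp_cubic_le[where s = "cis (- \<theta>)"]) (auto simp: s)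
qed

text \<open>The four signs that give decay, in this order: for \<open>F_i\<close> with
  \<open>i \<ge> 2\<close> and for \<open>F_1\<close> on the left, for \<open>1 / F_i\<close> with
  \<open>i \<ge> 2\<close> and for \<open>1 / F_1\<close> on the right.\<close>

lemma cos_values:
  "cos (2 * (2 * pi / 3)) < 0" "0 < cos (3 * (2 * pi / 3))" "0 < cos (2 * (pi / 5))" "cos (3 * (pi / 5)) < 0"
proof -
  have "cos (2 * (2 * pi / 3)) = - cos (pi / 3)"
    using cos_minus_pi[of "4 * pi / 3"] by (simp add: field_simps)
  moreover have "0 < cos (pi / 3)" by (rule cos_gt_zero) auto
  ultimately show "cos (2 * (2 * pi / 3)) < 0" by simp
  have "3 * (2 * pi / 3) = 2 * pi" by simp
  then show "0 < cos (3 * (2 * pi / 3))" by (simp only: cos_two_pi zero_less_one)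
  show "0 < cos (2 * (pi / 5))" by (rule cos_gt_zero) auto
  have "cos (3 * (pi / 5)) = - cos (2 * (pi / 5))"
    using cos_pi_minus[of "2 * (pi / 5)"] by (simp add: field_simps)
  then show "cos (3 * (pi / 5)) < 0" using \<open>0 < cos (2 * (pi / 5))\<close> by simp
qed

section \<open>Bounds for the Cauchy kernel between different contours\<close>

lemma right_contour_Re_bounded_below:
  assumes \<gamma>: "unbounded_contour (pi / 5) \<gamma>" "range \<gamma> \<subseteq> {w. 0 < Re w}"
  obtains c where "0 < c" "\<And>t. c \<le> Re (\<gamma> t)"
proof -
  have "eventually (\<lambda>t. \<gamma> t \<in> sector) at_top" "eventually (\<lambda>t. \<gamma> t \<in> sector) at_bot"
    using unbounded_contour_eventually_sector[OF \<gamma>(1)] by (auto elim!: eventually_mono)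
  then obtain T1 where T1: "T1 > 0" "\<And>t. T1 \<le> \<bar>t\<bar> \<Longrightarrow> \<gamma> t \<in> sector"
    using eventually_at_both_ends[of "\<lambda>t. \<gamma> t \<in> sector"] by blast
  obtain T2 where T2: "T2 > 0" "\<And>t. T2 \<le> \<bar>t\<bar> \<Longrightarrow> 2 \<le> norm (\<gamma> t)"
    using unbounded_contour_large[OF \<gamma>(1)] by blast
  define T where "T = max T1 T2"
  \<comment> \<open>On the tails the real part is at least half of the modulus; on the compact
    middle part it attains its minimum, which is positive.\<close>
  have "\<exists>s\<in>{-T..T}. \<forall>t\<in>{-T..T}. Re (\<gamma> s) \<le> Re (\<gamma> t)"
  proof (rule continuous_attains_inf)
    show "continuous_on {-T..T} (\<lambda>t. Re (\<gamma> t))"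
      using unbounded_contour_continuous[OF \<gamma>(1)] continuous_on_subset by (blast intro: continuous_on_Re)
  qed (use T1 in \<open>auto simp: T_def\<close>)
  then obtain s where s: "\<And>t. t \<in> {-T..T} \<Longrightarrow> Re (\<gamma> s) \<le> Re (\<gamma> t)" by blast
  show ?thesis
  proof (rule that[of "min 1 (Re (\<gamma> s))"])
    show "0 < min 1 (Re (\<gamma> s))" using \<gamma>(2) by auto
    fix t
    show "min 1 (Re (\<gamma> s)) \<le> Re (\<gamma> t)"
    proof (cases "t \<in> {-T..T}")
      case True
      then show ?thesis using s[OF True] by simp
    next
      case False
      then have "T1 \<le> \<bar>t\<bar>" "T2 \<le> \<bar>t\<bar>" by (auto simp: T_def)
      then show ?thesis using sector_norm_le[OF T1(2)] T2(2) by fastforce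
    qed
  qed
qed

text \<open>Symmetric in the two curves, and in the product form that the Leibniz expansion needs:
  each exponential can be assigned to its own variable.\<close>

definition separated_by :: "real \<Rightarrow> real \<Rightarrow> (real \<Rightarrow> complex) \<Rightarrow> (real \<Rightarrow> complex) \<Rightarrow> bool" where
  "separated_by C \<kappa> \<gamma> \<gamma>' \<longleftrightarrow>
     (\<forall>s t. norm (1 / (\<gamma> s - \<gamma>' t)) \<le> C * exp (\<kappa> * norm (\<gamma> s)) * exp (\<kappa> * norm (\<gamma>' t)))"

lemma separated_by_sym: "separated_by C \<kappa> \<gamma> \<gamma>' \<Longrightarrow> separated_by C \<kappa> \<gamma>' \<gamma>"
  unfolding separated_by_def norm_divide norm_one by (simp add: norm_minus_commute mult.assoc mult.commute mult.left_commute)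

lemma separated_by_mono:
  assumes "separated_by C \<kappa> \<gamma> \<gamma>'" "C \<le> C'" "\<kappa> \<le> \<kappa>'" "0 \<le> C"
  shows "separated_by C' \<kappa>' \<gamma> \<gamma>'"
  unfolding separated_by_def
proof (intro allI)
  fix s t
  have "C * exp (\<kappa> * norm (\<gamma> s)) * exp (\<kappa> * norm (\<gamma>' t)) \<le> C' * exp (\<kappa>' * norm (\<gamma> s)) * exp (\<kappa>' * norm (\<gamma>' t))"
    using assms by (intro mult_mono) (auto intro: mult_right_mono)
  then show "norm (1 / (\<gamma> s - \<gamma>' t)) \<le> C' * exp (\<kappa>' * norm (\<gamma> s)) * exp (\<kappa>' * norm (\<gamma>' t))"
    using assms(1) unfolding separated_by_def by (meson order_trans)
qed

text \<open>With the rate raised to \<open>\<bar>K\<bar>\<close>, the exponential in the other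
  variable is at least 1 and may be multiplied in.\<close>

lemma tamely_separated_imp_separated_by:
  assumes "tamely_separated \<gamma> \<gamma>'"
  shows "\<exists>C \<kappa>. 0 \<le> C \<and> 0 \<le> \<kappa> \<and> separated_by C \<kappa> \<gamma> \<gamma>'"
proof -
  obtain c K where c: "0 < c" "\<And>s t. c * exp (- K * norm (\<gamma> s)) \<le> dist (\<gamma> s) (\<gamma>' t)"
    using assms unfolding tamely_separated_def by blast
  have "norm (1 / (\<gamma> s - \<gamma>' t)) \<le> 1 / c * exp (\<bar>K\<bar> * norm (\<gamma> s)) * exp (\<bar>K\<bar> * norm (\<gamma>' t))" for s t
  proof -
    have "norm (1 / (\<gamma> s - \<gamma>' t)) \<le> 1 / (c * exp (- K * norm (\<gamma> s)))"
      using c(2)[of s t] c(1) unfolding norm_divide norm_one dist_norm by (intro frac_le) auto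
    also have "\<dots> = 1 / c * exp (K * norm (\<gamma> s))" by (simp add: exp_minus field_simps)
    also have "\<dots> \<le> 1 / c * exp (\<bar>K\<bar> * norm (\<gamma> s))"
      using c(1) by (intro mult_left_mono) (auto intro: mult_right_mono)
    also have "\<dots> \<le> 1 / c * exp (\<bar>K\<bar> * norm (\<gamma> s)) * exp (\<bar>K\<bar> * norm (\<gamma>' t))"
      using c(1) mult_left_mono[of 1 "exp (\<bar>K\<bar> * norm (\<gamma>' t))" "1 / c * exp (\<bar>K\<bar> * norm (\<gamma> s))"] by simp
    finally show ?thesis .
  qed
  then show ?thesis using c(1) unfolding separated_by_def
    by (intro exI[of _ "1 / c"] exI[of _ "\<bar>K\<bar>"]) auto
qed

lemma left_right_separated_by:
  assumes "unbounded_contour (pi / 5) \<gamma>'" "range \<gamma>' \<subseteq> {w. 0 < Re w}" "range \<gamma> \<subseteq> {w. Re w < 0}"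
  shows "\<exists>C \<kappa>. 0 \<le> C \<and> 0 \<le> \<kappa> \<and> separated_by C \<kappa> \<gamma> \<gamma>'"
proof -
  obtain c where c: "0 < c" "\<And>t. c \<le> Re (\<gamma>' t)"
    using right_contour_Re_bounded_below[OF assms(1,2)] by blast
  have "norm (1 / (\<gamma> s - \<gamma>' t)) \<le> 1 / c" for s t
  proof -
    have "Re (\<gamma> s) < 0" using assms(3) by auto
    then have "c \<le> norm (\<gamma> s - \<gamma>' t)" using c(2)[of t] abs_Re_le_cmod[of "\<gamma> s - \<gamma>' t"] by simp
    then show ?thesis using c(1) unfolding norm_divide norm_one by (intro frac_le) auto
  qed
  then show ?thesis using c(1) unfolding separated_by_def
    by (intro exI[of _ "1 / c"] exI[of _ "0::real"]) auto
qed

lemma separated_by_uniform: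
  assumes "finite P" "\<And>\<gamma> \<gamma>'. (\<gamma>, \<gamma>') \<in> P \<Longrightarrow> \<exists>C \<kappa>. 0 \<le> C \<and> 0 \<le> \<kappa> \<and> separated_by C \<kappa> \<gamma> \<gamma>'"
  shows "\<exists>C \<kappa>. 0 \<le> C \<and> 0 \<le> \<kappa> \<and> (\<forall>(\<gamma>, \<gamma>')\<in>P. separated_by C \<kappa> \<gamma> \<gamma>')"
  using assms
proof (induction P rule: finite_induct)
  case (insert p P)
  obtain C \<kappa> where C: "0 \<le> C" "0 \<le> \<kappa>" "\<forall>(\<gamma>, \<gamma>')\<in>P. separated_by C \<kappa> \<gamma> \<gamma>'" using insert by blast
  obtain C' \<kappa>' where C': "0 \<le> C'" "0 \<le> \<kappa>'" "separated_by C' \<kappa>' (fst p) (snd p)"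
    using insert.prems[of "fst p" "snd p"] by auto
  have "\<forall>(\<gamma>, \<gamma>')\<in>insert p P. separated_by (C + C') (\<kappa> + \<kappa>') \<gamma> \<gamma>'"
    using C C' separated_by_mono[of C \<kappa> _ _ "C + C'" "\<kappa> + \<kappa>'"] separated_by_mono[of C' \<kappa>' _ _ "C + C'" "\<kappa> + \<kappa>'"]
    by auto
  then show ?case using C C' by (intro exI[of _ "C + C'"] exI[of _ "\<kappa> + \<kappa>'"]) auto
qed auto

text \<open>Every row and every column occurs once in each Leibniz term, so the product of the
  \<open>e\<close> is the same for all \<open>fact n\<close> terms.\<close>

lemma norm_cdet_le:
  assumes "\<And>i j. i < n \<Longrightarrow> j < n \<Longrightarrow> norm (1 / (a i - b j)) \<le> C * e (a i) * e (b j)"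
    and e: "\<And>w. (0::real) \<le> e w" and "0 \<le> C"
  shows "norm (cdet n a b) \<le> fact n * C ^ n * (\<Prod>i<n. e (a i)) * (\<Prod>i<n. e (b i))"
proof -
  have "norm (cdet n a b) \<le> (\<Sum>p | p permutes {..<n}. C ^ n * (\<Prod>i<n. e (a i)) * (\<Prod>i<n. e (b i)))"
    unfolding cdet_def
  proof (rule sum_norm_le)
    fix p assume "p \<in> {p. p permutes {..<n}}"
    then have p: "p permutes {..<n}" by simp
    have "norm (of_int (sign p) * (\<Prod>i<n. 1 / (a i - b (p i)))) = (\<Prod>i<n. norm (1 / (a i - b (p i))))"
      by (simp add: norm_mult prod_norm sign_def)
    also have "\<dots> \<le> (\<Prod>i<n. C * e (a i) * e (b (p i)))"
      using assms(1) permutes_in_image[OF p] by (intro prod_mono) auto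
    also have "\<dots> = C ^ n * (\<Prod>i<n. e (a i)) * (\<Prod>i<n. e (b (p i)))"
      by (simp add: prod.distrib)
    also have "(\<Prod>i<n. e (b (p i))) = (\<Prod>i<n. e (b i))"
      using prod.permute[OF p, of "\<lambda>i. e (b i)"] by (simp add: o_def)
    finally show "norm (of_int (sign p) * (\<Prod>i<n. 1 / (a i - b (p i)))) \<le> C ^ n * (\<Prod>i<n. e (a i)) * (\<Prod>i<n. e (b i))" .
  qed
  also have "\<dots> = fact n * C ^ n * (\<Prod>i<n. e (a i)) * (\<Prod>i<n. e (b i))"
    by (simp add: card_permutations[of "{..<n}" n])
  finally show ?thesis .
qed

lemma cint_eq_path_integral:
  "cint \<gamma> = path_integral \<gamma> (\<lambda>t. vector_derivative \<gamma> (at t) / (2 * of_real pi * \<i>))"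
  by (rule HOL.ext) (simp add: cint_def line_integral_def path_integral_def)

lemma prod_shift_telescope:
  fixes G :: "nat \<Rightarrow> 'c :: comm_monoid_mult"
  shows "(\<Prod>j=1..m. G (Suc j)) * G 1 = (\<Prod>j=1..m. G j) * G (Suc m)"
proof (induction m)
  case (Suc m)
  have "(\<Prod>j=1..Suc m. G (Suc j)) * G 1 = ((\<Prod>j=1..m. G (Suc j)) * G 1) * G (Suc (Suc m))"
    by (simp add: ac_simps)
  also have "\<dots> = ((\<Prod>j=1..m. G j) * G (Suc m)) * G (Suc (Suc m))" by (simp only: Suc.IH)
  finally show ?case by simp
qed simp

lemma prod_cat: "(\<Prod>i<M + N. e (cat M a b i)) = (\<Prod>i<M. e (a i)) * (\<Prod>l<N. (e (b l) :: 'c :: comm_monoid_mult))"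
  unfolding prod_lessThan_add by (simp add: cat_def)

lemma measurable_cdet:
  assumes "\<And>i. i < n \<Longrightarrow> (\<lambda>x. a x i) \<in> borel_measurable M" "\<And>i. i < n \<Longrightarrow> (\<lambda>x. b x i) \<in> borel_measurable M"
  shows "(\<lambda>x. cdet n (a x) (b x)) \<in> borel_measurable M"
  unfolding cdet_def
proof (intro borel_measurable_sum borel_measurable_times borel_measurable_prod borel_measurable_divide borel_measurable_diff borel_measurable_const)
  fix p i assume "p \<in> {p. p permutes {..<n}}" "i \<in> {..<n}"
  then show "(\<lambda>x. a x i) \<in> borel_measurable M" "(\<lambda>x. b x (p i)) \<in> borel_measurable M"
    using assms permutes_in_image[of p "{..<n}" i] by auto
qed

lemma measurable_U_coord: "(\<lambda>x. U_coord x j l) \<in> borel_measurable assignments"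
  and measurable_V_coord: "(\<lambda>x. V_coord x j l) \<in> borel_measurable assignments"
  unfolding U_coord_def V_coord_def by (intro measurable_component_singleton; simp)+

lemma continuous_F_fun: "continuous_on A (F_fun \<alpha> \<beta> j)"
proof (cases "j = 1")
  case True
  then have "F_fun \<alpha> \<beta> j = f_fun \<alpha> \<beta> 1" by (auto simp: F_fun_def)
  then show ?thesis unfolding f_fun_def by (auto intro!: continuous_intros)
next
  case False
  then have "F_fun \<alpha> \<beta> j = (\<lambda>w. f_fun \<alpha> \<beta> j w / f_fun \<alpha> \<beta> (j - 1) w)" by (auto simp: F_fun_def)
  then show ?thesis unfolding f_fun_def by (auto intro!: continuous_intros)
qed

lemma measurable_F_fun:
  assumes "f \<in> borel_measurable M" shows "(\<lambda>x. F_fun \<alpha> \<beta> j (f x)) \<in> borel_measurable M"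
proof -
  have "F_fun \<alpha> \<beta> j \<in> borel_measurable borel"
    by (rule borel_measurable_continuous_onI[OF continuous_F_fun])
  from measurable_compose[OF assms this] show ?thesis .
qed

section \<open>Domination of the full integrand\<close>

context contour_setting
begin

definition var_index :: "(nat \<times> nat) set" where "var_index = (SIGMA j:{1..m}. {..<N j})"
definition all_vars :: "var set" where
  "all_vars = (\<lambda>(j, l). U j (Suc l)) ` var_index \<union> (\<lambda>(j, l). V j (Suc l)) ` var_index"

text \<open>All contours open to the variable at once, so that one domination covers every choice
  \<open>S\<close>.\<close>

definition K :: "var \<Rightarrow> complex set" where
  "K a = range (contour {} a) \<union> (if a \<in> upper then range (contour {a} a) else {})"

definition E :: "var \<Rightarrow> complex \<Rightarrow> complex" where
  "E a w = (case a of U j _ \<Rightarrow> F j w | V j _ \<Rightarrow> 1 / F j w)"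

definition \<phi> :: "real \<Rightarrow> var \<Rightarrow> complex \<Rightarrow> real" where
  "\<phi> \<kappa> a w = exp (\<kappa> * norm w) * norm (E a w)"

abbreviation weight :: "var set \<Rightarrow> var \<Rightarrow> real \<Rightarrow> complex" where
  "weight S a \<equiv> \<lambda>t. vector_derivative (contour S a) (at t) / (2 * of_real pi * \<i>)"

lemma finite_all_vars: "finite all_vars"
  by (auto simp: all_vars_def var_index_def)

lemma U_in_all_vars: "U j l \<in> all_vars \<longleftrightarrow> 1 \<le> j \<and> j \<le> m \<and> 1 \<le> l \<and> l \<le> N j"
  by (cases l) (auto simp: all_vars_def var_index_def image_iff)

lemma V_in_all_vars: "V j l \<in> all_vars \<longleftrightarrow> 1 \<le> j \<and> j \<le> m \<and> 1 \<le> l \<and> l \<le> N j"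
  by (cases l) (auto simp: all_vars_def var_index_def image_iff)

lemma prod_all_vars:
  "(\<Prod>a\<in>all_vars. g a) = (\<Prod>j=1..m. (\<Prod>l<N j. g (U j (Suc l))) * (\<Prod>l<N j. g (V j (Suc l))))"
proof -
  have "(\<Prod>a\<in>all_vars. g a) = (\<Prod>a\<in>(\<lambda>(j, l). U j (Suc l)) ` var_index. g a) * (\<Prod>a\<in>(\<lambda>(j, l). V j (Suc l)) ` var_index. g a)"
    unfolding all_vars_def by (rule prod.union_disjoint) (auto simp: var_index_def)
  also have "(\<Prod>a\<in>(\<lambda>(j, l). U j (Suc l)) ` var_index. g a) = (\<Prod>(j, l)\<in>var_index. g (U j (Suc l)))"
    by (subst prod.reindex) (auto simp: inj_on_def case_prod_beta)
  also have "(\<Prod>a\<in>(\<lambda>(j, l). V j (Suc l)) ` var_index. g a) = (\<Prod>(j, l)\<in>var_index. g (V j (Suc l)))"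
    by (subst prod.reindex) (auto simp: inj_on_def case_prod_beta)
  finally show ?thesis
    unfolding var_index_def by (simp add: prod.Sigma[symmetric] prod.distrib)
qed

lemma contour_in_K: "S \<subseteq> upper \<Longrightarrow> contour S a t \<in> K a"
  by (auto simp: K_def contour_def split: var.splits)

text \<open>On each kind of contour the leading power in the exponent has negative real part in the
  limiting directions; the four cases are those of \<open>cos_values\<close>.\<close>

lemma E_bound:
  assumes "a \<in> all_vars" "S \<subseteq> upper"
  shows "\<exists>C. \<forall>t. norm (E a (contour S a t)) \<le> C * exp (- k * norm (contour S a t))"
proof (cases a)
  case (U j l)
  then have j: "j \<in> {1..m}" using assms by (simp add: U_in_all_vars)
  have c: "unbounded_contour (2 * pi / 3) (contour S a)" using contour_U[OF j assms(2)] U by simp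
  show ?thesis
  proof (cases "j = 1")
    case True
    then have eq: "E a w = exp (of_real (-1/3) * w ^ 3 + of_real (\<alpha> 1) * w\<^sup>2 + of_real (\<beta> 1) * w)" for w
      by (simp add: E_def U F_fun_def f_fun_def)
    show ?thesis using cos_values by (intro unbounded_contour_exp_cubic[OF c _ eq]) auto
  next
    case False
    then have "\<alpha> (j - 1) < \<alpha> j" using strict_mono_onD[OF \<alpha>_mono, of "j - 1" j] j by auto
    moreover have eq: "E a w = exp (of_real 0 * w ^ 3 + of_real (\<alpha> j - \<alpha> (j - 1)) * w\<^sup>2 + of_real (\<beta> j - \<beta> (j - 1)) * w)" for w
      using False j by (simp add: E_def U F_eq)
    ultimately show ?thesis using cos_values
      by (intro unbounded_contour_exp_cubic[OF c _ eq]) (auto simp: mult_pos_neg)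
  qed
next
  case (V j l)
  then have j: "j \<in> {1..m}" using assms by (simp add: V_in_all_vars)
  have c: "unbounded_contour (pi / 5) (contour S a)" using contour_V[OF j assms(2)] V by simp
  show ?thesis
  proof (cases "j = 1")
    case True
    then have "E a w = 1 / exp (of_real (-1/3) * w ^ 3 + of_real (\<alpha> 1) * w\<^sup>2 + of_real (\<beta> 1) * w)" for w
      by (simp add: E_def V F_fun_def f_fun_def)
    then have "E a w = exp (- (of_real (-1/3) * w ^ 3 + of_real (\<alpha> 1) * w\<^sup>2 + of_real (\<beta> 1) * w))" for w
      by (simp only: exp_minus inverse_eq_divide)
    then have eq: "E a w = exp (of_real (1/3) * w ^ 3 + of_real (- \<alpha> 1) * w\<^sup>2 + of_real (- \<beta> 1) * w)" for w
      by (simp add: algebra_simps)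
    show ?thesis using cos_values by (intro unbounded_contour_exp_cubic[OF c _ eq]) auto
  next
    case False
    then have "\<alpha> (j - 1) < \<alpha> j" using strict_mono_onD[OF \<alpha>_mono, of "j - 1" j] j by auto
    moreover have "E a w = 1 / exp (of_real (\<alpha> j - \<alpha> (j - 1)) * w\<^sup>2 + of_real (\<beta> j - \<beta> (j - 1)) * w)" for w
      using False j by (simp add: E_def V F_eq)
    then have "E a w = exp (- (of_real (\<alpha> j - \<alpha> (j - 1)) * w\<^sup>2 + of_real (\<beta> j - \<beta> (j - 1)) * w))" for w
      by (simp only: exp_minus inverse_eq_divide)
    then have eq: "E a w = exp (of_real 0 * w ^ 3 + of_real (- (\<alpha> j - \<alpha> (j - 1))) * w\<^sup>2 + of_real (- (\<beta> j - \<beta> (j - 1))) * w)" for w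
      by (simp add: algebra_simps)
    ultimately show ?thesis using cos_values
      by (intro unbounded_contour_exp_cubic[OF c _ eq]) (auto simp: mult_neg_pos)
  qed
qed

lemma contour_unbounded:
  assumes "a \<in> all_vars" "S \<subseteq> upper"
  obtains \<theta> where "unbounded_contour \<theta> (contour S a)"
  using assms contour_U[of _ S] contour_V[of _ S]
  by (cases a) (auto simp: U_in_all_vars V_in_all_vars, blast+)

lemma continuous_E: "continuous_on A (E a)"
  unfolding E_def using F_nonzero by (cases a) (auto intro!: continuous_intros continuous_F_fun)

lemma paths_contour:
  assumes S: "S \<subseteq> upper"
  shows "paths K (\<phi> \<kappa>) (contour S) (weight S) all_vars"
proof
  show "finite all_vars" by (rule finite_all_vars)
  fix a assume a: "a \<in> all_vars"
  obtain \<theta> where \<theta>: "unbounded_contour \<theta> (contour S a)" using contour_unbounded[OF a S] .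
  show "contour S a \<in> borel_measurable borel"
    using unbounded_contour_continuous[OF \<theta>] by (rule borel_measurable_continuous_onI)
  show "weight S a \<in> borel_measurable borel"
    using unbounded_contour_derivative_measurable[OF \<theta>] by (intro borel_measurable_divide) auto
  show "contour S a t \<in> K a" for t by (rule contour_in_K[OF S])
  have "integrable lborel (\<lambda>t. \<phi> \<kappa> a (contour S a t) * norm (vector_derivative (contour S a) (at t)))"
  proof (rule unbounded_contour_integrable[OF \<theta>])
    fix k
    \<comment> \<open>\<open>E\<close> decays at every rate, in particular at rate
      \<open>k + \<kappa>\<close>, which leaves \<open>k\<close> after the growth factor.\<close>
    obtain C where C: "\<And>t. norm (E a (contour S a t)) \<le> C * exp (- (k + \<kappa>) * norm (contour S a t))"
      using E_bound[OF a S] by blast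
    have "\<phi> \<kappa> a (contour S a t) \<le> C * exp (- k * norm (contour S a t))" for t
    proof -
      have "\<phi> \<kappa> a (contour S a t) \<le> exp (\<kappa> * norm (contour S a t)) * (C * exp (- (k + \<kappa>) * norm (contour S a t)))"
        unfolding \<phi>_def by (intro mult_left_mono C) auto
      also have "\<dots> = C * (exp (\<kappa> * norm (contour S a t)) * exp (- (k + \<kappa>) * norm (contour S a t)))" by simp
      also have "exp (\<kappa> * norm (contour S a t)) * exp (- (k + \<kappa>) * norm (contour S a t)) = exp (- k * norm (contour S a t))"
        unfolding exp_add[symmetric] by (simp add: algebra_simps)
      finally show ?thesis .
    qed
    then show "\<exists>C. \<forall>t. \<phi> \<kappa> a (contour S a t) \<le> C * exp (- k * norm (contour S a t))" by blast
  next
    show "0 \<le> \<phi> \<kappa> a (contour S a t)" for t by (simp add: \<phi>_def)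
    have "continuous_on (range (contour S a)) (\<phi> \<kappa> a)"
      unfolding \<phi>_def by (intro continuous_intros continuous_E)
    then show "(\<lambda>t. \<phi> \<kappa> a (contour S a t)) \<in> borel_measurable borel"
      by (intro borel_measurable_continuous_onI)
        (rule continuous_on_compose2[OF _ unbounded_contour_continuous[OF \<theta>]], auto)
  qed
  from integrable_mult_left[OF this, of "1 / (2 * pi)"]
  show "integrable lborel (\<lambda>t. \<phi> \<kappa> a (contour S a t) * norm (weight S a t))"
    by (simp add: norm_divide norm_mult)
qed

lemma K_U: "j \<in> {1..m} \<Longrightarrow> K (U j l) \<subseteq> {w. Re w < 0}"
  using contour_U[of j "{}" l] contour_U[of j "{U j l}" l] by (auto simp: K_def)

text \<open>The kinds of pairs that meet in the Cauchy determinants: a U with a V, or two variables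
  of the same kind on neighbouring levels. Two variables of the same kind and level never
  meet.\<close>

definition kernel_bounded :: "real \<Rightarrow> real \<Rightarrow> bool" where
  "kernel_bounded C \<kappa> \<longleftrightarrow> 0 \<le> C \<and>
     (\<forall>i\<in>{1..m}. \<forall>j\<in>{1..m}. \<forall>l l' w w'. w \<in> K (U i l) \<and> w' \<in> K (V j l') \<longrightarrow> norm (1 / (w - w')) \<le> C * exp (\<kappa> * norm w) * exp (\<kappa> * norm w')) \<and>
     (\<forall>j\<in>{1..<m}. \<forall>l l' w w'. w \<in> K (U j l) \<and> w' \<in> K (U (Suc j) l') \<longrightarrow> norm (1 / (w - w')) \<le> C * exp (\<kappa> * norm w) * exp (\<kappa> * norm w')) \<and>
     (\<forall>j\<in>{1..<m}. \<forall>l l' w w'. w \<in> K (V j l) \<and> w' \<in> K (V (Suc j) l') \<longrightarrow> norm (1 / (w - w')) \<le> C * exp (\<kappa> * norm w) * exp (\<kappa> * norm w'))"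

lemma kernel_bound: "\<exists>C \<kappa>. kernel_bounded C \<kappa>"
proof -
  define CU where "CU j = insert (Lin j) (if 2 \<le> j then {Lout j} else {})" for j
  define CV where "CV j = insert (Rout j) (if 2 \<le> j then {Rin j} else {})" for j
  have KU: "w \<in> K (U j l) \<Longrightarrow> \<exists>\<gamma>\<in>CU j. w \<in> range \<gamma>" for w j l
    by (auto simp: K_def CU_def contour_def upper_def split: if_splits)
  have KV: "w \<in> K (V j l) \<Longrightarrow> \<exists>\<gamma>\<in>CV j. w \<in> range \<gamma>" for w j l
    by (auto simp: K_def CV_def contour_def upper_def split: if_splits)
  define P where "P = (\<Union>i\<in>{1..m}. \<Union>j\<in>{1..m}. CU i \<times> CV j) \<union> (\<Union>j\<in>{1..<m}. CU j \<times> CU (Suc j)) \<union> (\<Union>j\<in>{1..<m}. CV j \<times> CV (Suc j))"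
  have "finite P" by (auto simp: P_def CU_def CV_def)
  moreover have "\<exists>C \<kappa>. 0 \<le> C \<and> 0 \<le> \<kappa> \<and> separated_by C \<kappa> \<gamma> \<gamma>'" if p: "(\<gamma>, \<gamma>') \<in> P" for \<gamma> \<gamma>'
  proof -
    have sym: "\<exists>C \<kappa>. 0 \<le> C \<and> 0 \<le> \<kappa> \<and> separated_by C \<kappa> \<gamma> \<gamma>'" if "tamely_separated \<gamma> \<gamma>' \<or> tamely_separated \<gamma>' \<gamma>"
      using that tamely_separated_imp_separated_by separated_by_sym by metis
    from p consider i j where "i \<in> {1..m}" "j \<in> {1..m}" "\<gamma> \<in> CU i" "\<gamma>' \<in> CV j"
      | j where "j \<in> {1..<m}" "\<gamma> \<in> CU j" "\<gamma>' \<in> CU (Suc j)" | j where "j \<in> {1..<m}" "\<gamma> \<in> CV j" "\<gamma>' \<in> CV (Suc j)"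
      unfolding P_def by blast
    then show ?thesis
    proof cases
      case 1
      have "range \<gamma> \<subseteq> {w. Re w < 0}"
        using 1 Lin_contour[of i] Lout_contour[of i] by (auto simp: CU_def split: if_splits)
      moreover have "unbounded_contour (pi / 5) \<gamma>' \<and> range \<gamma>' \<subseteq> {w. 0 < Re w}"
        using 1 Rout_contour[of j] Rin_contour[of j] by (auto simp: CV_def split: if_splits)
      ultimately show ?thesis using left_right_separated_by by blast
    next
      case 2
      show ?thesis
        by (rule sym) (use 2 left_order(1)[of j "Suc j"] left_order(2)[of j "Suc j"] left_order(2)[of "Suc j" j]
          left_order(3)[of j "Suc j"] in \<open>auto simp: CU_def split: if_splits\<close>)
    next
      case 3
      show ?thesis
        by (rule sym) (use 3 right_order(1)[of j "Suc j"] right_order(2)[of j "Suc j"] right_order(2)[of "Suc j" j]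
          right_order(3)[of j "Suc j"] in \<open>auto simp: CV_def split: if_splits\<close>)
    qed
  qed
  ultimately obtain C \<kappa> where C: "0 \<le> C" "0 \<le> \<kappa>" "\<forall>(\<gamma>, \<gamma>')\<in>P. separated_by C \<kappa> \<gamma> \<gamma>'"
    using separated_by_uniform[of P] by blast
  have bound: "norm (1 / (w - w')) \<le> C * exp (\<kappa> * norm w) * exp (\<kappa> * norm w')"
    if "(\<gamma>, \<gamma>') \<in> P" "w \<in> range \<gamma>" "w' \<in> range \<gamma>'" for \<gamma> \<gamma>' w w'
    using C(3) that unfolding separated_by_def by blast
  have "kernel_bounded C \<kappa>"
    unfolding kernel_bounded_def
  proof (intro conjI C(1) ballI allI impI; elim conjE)
    fix i j l l' w w' assume *: "i \<in> {1..m}" "j \<in> {1..m}" "w \<in> K (U i l)" "w' \<in> K (V j l')"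
    then obtain \<gamma> \<gamma>' where "\<gamma> \<in> CU i" "w \<in> range \<gamma>" "\<gamma>' \<in> CV j" "w' \<in> range \<gamma>'" using KU KV by blast
    then show "norm (1 / (w - w')) \<le> C * exp (\<kappa> * norm w) * exp (\<kappa> * norm w')"
      using * by (intro bound[of \<gamma> \<gamma>']) (auto simp: P_def)
  next
    fix j l l' w w' assume *: "j \<in> {1..<m}" "w \<in> K (U j l)" "w' \<in> K (U (Suc j) l')"
    then obtain \<gamma> \<gamma>' where "\<gamma> \<in> CU j" "w \<in> range \<gamma>" "\<gamma>' \<in> CU (Suc j)" "w' \<in> range \<gamma>'" using KU by blast
    then show "norm (1 / (w - w')) \<le> C * exp (\<kappa> * norm w) * exp (\<kappa> * norm w')"
      using * by (intro bound[of \<gamma> \<gamma>']) (auto simp: P_def)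
  next
    fix j l l' w w' assume *: "j \<in> {1..<m}" "w \<in> K (V j l)" "w' \<in> K (V (Suc j) l')"
    then obtain \<gamma> \<gamma>' where "\<gamma> \<in> CV j" "w \<in> range \<gamma>" "\<gamma>' \<in> CV (Suc j)" "w' \<in> range \<gamma>'" using KV by blast
    then show "norm (1 / (w - w')) \<le> C * exp (\<kappa> * norm w) * exp (\<kappa> * norm w')"
      using * by (intro bound[of \<gamma> \<gamma>']) (auto simp: P_def)
  qed
  then show ?thesis by blast
qed

text \<open>Every variable belongs to exactly two of the Cauchy determinants: on level 1 to the
  first determinant and to the first link, on a higher level to the links with both neighbouring
  levels. Hence the rate \<open>2 * \<kappa>\<close>.\<close>

lemma dominated_integrand:
  "\<exists>\<kappa>. \<forall>x. dominated K (\<phi> \<kappa>) all_vars (integrand m n \<alpha> \<beta>) x"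
proof -
  obtain C \<kappa> where kb: "kernel_bounded C \<kappa>" using kernel_bound by blast
  then have C: "0 \<le> C" by (simp add: kernel_bounded_def)
  have UV: "norm (1 / (w - w')) \<le> C * exp (\<kappa> * norm w) * exp (\<kappa> * norm w')"
    if "i \<in> {1..m}" "j \<in> {1..m}" "w \<in> K (U i l)" "w' \<in> K (V j l')" for i j l l' w w'
    using kb that unfolding kernel_bounded_def by blast
  have UU: "norm (1 / (w - w')) \<le> C * exp (\<kappa> * norm w) * exp (\<kappa> * norm w')"
    if "j \<in> {1..<m}" "w \<in> K (U j l)" "w' \<in> K (U (Suc j) l')" for j l l' w w'
    using kb that unfolding kernel_bounded_def by blast
  have VV: "norm (1 / (w - w')) \<le> C * exp (\<kappa> * norm w) * exp (\<kappa> * norm w')"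
    if "j \<in> {1..<m}" "w \<in> K (V j l)" "w' \<in> K (V (Suc j) l')" for j l l' w w'
    using kb that unfolding kernel_bounded_def by blast
  define e where "e w = exp (\<kappa> * norm w)" for w :: complex
  have e: "0 \<le> e w" for w by (simp add: e_def)
  have flip: "norm (1 / (w' - w)) \<le> C * e w' * e w" if "norm (1 / (w - w')) \<le> C * e w * e w'" for w w' :: complex
    using that by (simp add: norm_divide norm_minus_commute mult.assoc mult.commute mult.left_commute)
  define D where "D k = fact k * C ^ k" for k :: nat
  have D: "0 \<le> D k" for k using C by (simp add: D_def)
  define D0 where "D0 = D (N 1) * (\<Prod>j=1..m. D (N j + N (Suc j)))"
  have "dominated K (\<phi> (2 * \<kappa>)) all_vars (integrand m n \<alpha> \<beta>) x" for x
  proof (rule dominatedI[where C = D0])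
    fix y assume y: "\<And>a. a \<in> all_vars \<Longrightarrow> y a \<in> K a"
    have yu: "U_coord y j l \<in> K (U j (Suc l))" and yv: "V_coord y j l \<in> K (V j (Suc l))" if "j \<in> {1..m}" "l < N j" for j l
      using y that by (auto simp: U_coord_def V_coord_def U_in_all_vars V_in_all_vars)
    define eU where "eU j = (\<Prod>l<N j. e (U_coord y j l))" for j
    define eV where "eV j = (\<Prod>l<N j. e (V_coord y j l))" for j
    have nonneg: "0 \<le> eU j" "0 \<le> eV j" for j by (auto simp: eU_def eV_def intro!: prod_nonneg e)
    have m1: "1 \<in> {1..m}" using m_pos by simp
    have first: "norm (cdet (N 1) (V_coord y 1) (U_coord y 1)) \<le> D (N 1) * (eV 1 * eU 1)"
    proof -
      have "norm (cdet (N 1) (V_coord y 1) (U_coord y 1)) \<le> fact (N 1) * C ^ N 1 * (\<Prod>l<N 1. e (V_coord y 1 l)) * (\<Prod>l<N 1. e (U_coord y 1 l))"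
        by (rule norm_cdet_le[OF _ e C], rule flip) (use UV[OF m1 m1 yu yv] m1 in \<open>auto simp: e_def\<close>)
      then show ?thesis by (simp add: D_def eU_def eV_def mult.assoc)
    qed
    have link: "norm (link y j) \<le> D (N j + N (Suc j)) * (eU j * eV (Suc j) * (eV j * eU (Suc j)))" if j: "j \<in> {1..m}" for j
    proof -
      have sj: "Suc j \<in> {1..m}" "j \<in> {1..<m}" if "l < N (Suc j)" for l
        using that j by (auto simp: ext_def split: if_splits)
      have "norm (link y j) \<le> fact (N j + N (Suc j)) * C ^ (N j + N (Suc j)) *
          (\<Prod>i<N j + N (Suc j). e (cat (N j) (U_coord y j) (V_coord y (Suc j)) i)) *
          (\<Prod>i<N j + N (Suc j). e (cat (N j) (V_coord y j) (U_coord y (Suc j)) i))"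
        unfolding link_def
      proof (rule norm_cdet_le[OF _ e C])
        fix i i' assume i: "i < N j + N (Suc j)" "i' < N j + N (Suc j)"
        consider "i < N j" "i' < N j" | "i < N j" "i' - N j < N (Suc j)" "\<not> i' < N j"
          | "i - N j < N (Suc j)" "\<not> i < N j" "i' < N j"
          | "i - N j < N (Suc j)" "\<not> i < N j" "i' - N j < N (Suc j)" "\<not> i' < N j"
          using i by linarith
        then show "norm (1 / (cat (N j) (U_coord y j) (V_coord y (Suc j)) i - cat (N j) (V_coord y j) (U_coord y (Suc j)) i')) \<le>
           C * e (cat (N j) (U_coord y j) (V_coord y (Suc j)) i) * e (cat (N j) (V_coord y j) (U_coord y (Suc j)) i')"
        proof cases
          case 1
          then show ?thesis using UV[OF j j yu[OF j] yv[OF j], of i i'] by (simp add: cat_def e_def)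
        next
          case 2
          then show ?thesis
            using UU[OF sj(2) yu[OF j] yu[OF sj(1)], of "i' - N j" i "i' - N j" "i' - N j"] by (simp add: cat_def e_def)
        next
          case 3
          then show ?thesis
            using flip[OF VV[OF sj(2) yv[OF j] yv[OF sj(1)], folded e_def, of "i - N j" i' "i - N j" "i - N j"]] by (simp add: cat_def)
        next
          case 4
          then show ?thesis
            using flip[OF UV[OF sj(1) sj(1) yu[OF sj(1)] yv[OF sj(1)], folded e_def,
              of "i' - N j" "i - N j" "i' - N j" "i' - N j" "i - N j" "i - N j"]] by (simp add: cat_def)
        qed
      qed
      then show ?thesis unfolding prod_cat by (simp add: D_def eU_def eV_def mult.assoc)
    qed
    have "norm (integrand m n \<alpha> \<beta> y) = norm (cdet (N 1) (V_coord y 1) (U_coord y 1)) *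
       (\<Prod>j=1..m. norm (link y j) * (\<Prod>l<N j. norm (1 / F j (V_coord y j l)))) * (\<Prod>j=1..m. \<Prod>l<N j. norm (F j (U_coord y j l)))"
    proof -
      have "{1..<Suc m} = {1..m}" by auto
      then show ?thesis
        unfolding integrand_eq partial_integrand_def tail_sum_Suc_m by (simp add: norm_mult prod_norm[symmetric])
    qed
    also have "\<dots> \<le> (D (N 1) * (eV 1 * eU 1)) *
       (\<Prod>j=1..m. (D (N j + N (Suc j)) * (eU j * eV (Suc j) * (eV j * eU (Suc j)))) * (\<Prod>l<N j. norm (1 / F j (V_coord y j l)))) *
       (\<Prod>j=1..m. \<Prod>l<N j. norm (F j (U_coord y j l)))"
      using first link nonneg D
      by (intro mult_mono prod_mono mult_nonneg_nonneg prod_nonneg conjI ballI) auto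
    also have "\<dots> = D0 * (((\<Prod>j=1..m. eU (Suc j) * eV (Suc j)) * (eU 1 * eV 1)) * (\<Prod>j=1..m. eU j * eV j)) *
       (\<Prod>j=1..m. (\<Prod>l<N j. norm (1 / F j (V_coord y j l))) * (\<Prod>l<N j. norm (F j (U_coord y j l))))"
      unfolding D0_def prod.distrib by (simp only: mult.assoc mult.commute mult.left_commute)
    \<comment> \<open>The first determinant supplies the factor of level 1 that is missing among the
      upper ends of the links; level \<open>m + 1\<close> is empty and contributes 1.\<close>
    also have "(\<Prod>j=1..m. eU (Suc j) * eV (Suc j)) * (eU 1 * eV 1) = (\<Prod>j=1..m. eU j * eV j)"
      using prod_shift_telescope[of "\<lambda>j. eU j * eV j" m] by (simp add: eU_def eV_def N_Suc_m)
    also have "D0 * ((\<Prod>j=1..m. eU j * eV j) * (\<Prod>j=1..m. eU j * eV j)) *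
       (\<Prod>j=1..m. (\<Prod>l<N j. norm (1 / F j (V_coord y j l))) * (\<Prod>l<N j. norm (F j (U_coord y j l)))) =
       D0 * (\<Prod>a\<in>all_vars. \<phi> (2 * \<kappa>) a (y a))"
    proof -
      have e2: "exp (2 * \<kappa> * norm w) = e w * e w" for w
        by (simp add: e_def exp_add[symmetric])
      have "(\<Prod>l<N j. \<phi> (2 * \<kappa>) (U j (Suc l)) (y (U j (Suc l)))) = eU j * eU j * (\<Prod>l<N j. norm (F j (U_coord y j l)))" for j
        by (simp add: \<phi>_def e2 E_def eU_def U_coord_def prod.distrib)
      moreover have "(\<Prod>l<N j. \<phi> (2 * \<kappa>) (V j (Suc l)) (y (V j (Suc l)))) = eV j * eV j * (\<Prod>l<N j. norm (1 / F j (V_coord y j l)))" for j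
        unfolding \<phi>_def e2 E_def eV_def V_coord_def by (simp only: var.case prod.distrib)
      ultimately have "(\<Prod>a\<in>all_vars. \<phi> (2 * \<kappa>) a (y a)) = (\<Prod>j=1..m. (eU j * eU j * (\<Prod>l<N j. norm (F j (U_coord y j l)))) *
          (eV j * eV j * (\<Prod>l<N j. norm (1 / F j (V_coord y j l)))))"
        unfolding prod_all_vars by (simp only:)
      then show ?thesis
        by (simp only: prod.distrib mult.assoc mult.commute mult.left_commute)
    qed
    finally show "norm (integrand m n \<alpha> \<beta> y) \<le> D0 * (\<Prod>a\<in>all_vars. \<phi> (2 * \<kappa>) a (y a))" .
  qed
  then show ?thesis by blast
qed

lemma measurable_tail_product:
  assumes "\<And>l. (\<lambda>x. B x l) \<in> borel_measurable assignments"
  shows "(\<lambda>x. tail_product x i (B x)) \<in> borel_measurable assignments"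
  unfolding tail_product_def
proof (intro borel_measurable_prod borel_measurable_times borel_measurable_divide borel_measurable_const measurable_F_fun assms measurable_cdet measurable_U_coord)
  fix j l show "(\<lambda>x. if l < N (Suc j) then U_coord x (Suc j) l else B x l) \<in> borel_measurable assignments"
    by (cases "l < N (Suc j)") (auto intro: assms measurable_U_coord)
qed

lemma measurable_integrand: "integrand m n \<alpha> \<beta> \<in> borel_measurable assignments"
proof -
  have "(\<lambda>x. link x j) \<in> borel_measurable assignments" for j
    unfolding link_def
  proof (rule measurable_cdet)
    fix i
    show "(\<lambda>x. cat (N j) (U_coord x j) (V_coord x (Suc j)) i) \<in> borel_measurable assignments"
      "(\<lambda>x. cat (N j) (V_coord x j) (U_coord x (Suc j)) i) \<in> borel_measurable assignments"
      by (cases "i < N j"; simp add: cat_def measurable_U_coord measurable_V_coord)+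
  qed
  then have "(\<lambda>x. partial_integrand (Suc m) x) \<in> borel_measurable assignments"
    unfolding partial_integrand_def tail_sum_Suc_m
    by (intro borel_measurable_times borel_measurable_prod borel_measurable_divide borel_measurable_const measurable_F_fun
      measurable_cdet measurable_U_coord measurable_V_coord)
  then show ?thesis by (simp add: integrand_eq)
qed

end

section \<open>Integration over the circles\<close>

lemma distinct_concat_map:
  assumes "distinct xs" "\<And>x. x \<in> set xs \<Longrightarrow> distinct (f x)"
    "\<And>x y. x \<in> set xs \<Longrightarrow> y \<in> set xs \<Longrightarrow> x \<noteq> y \<Longrightarrow> set (f x) \<inter> set (f y) = {}"
  shows "distinct (concat (map f xs))"
  using assms
proof (induction xs)
  case (Cons x xs)
  have "set (f x) \<inter> set (f y) = {}" if "y \<in> set xs" for y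
    using Cons.prems(3)[of x y] Cons.prems(1) that by auto
  then have "set (f x) \<inter> (\<Union>y\<in>set xs. set (f y)) = {}" by blast
  moreover have "distinct (concat (map f xs))" using Cons.prems by (intro Cons.IH) auto
  ultimately show ?case using Cons.prems(2)[of x] by simp
qed simp

text \<open>\<open>A\<close> indexes the variables of level \<open>i + 1\<close>, \<open>S\<close>
  those whose U runs over the \<open>out\<close> contour. The factor \<open>1 - inverse z\<close> is
  the inverse of the weight \<open>- (z / (1 - z))\<close> of a V on its \<open>out\<close> contour.
  Apart from \<open>1 / z\<close> the remainder is holomorphic on the disc, and at 0 the weight of a
  U is 0 for \<open>out\<close> and 1 for \<open>in\<close>.\<close>

lemma contour_integral_circle_at_0:
  assumes r: "0 < r" "r < 1" and fin: "finite A"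
  shows "contour_integral (circlepath 0 r) (\<lambda>z. (1 - z) ^ k * (1 - inverse z) ^ card A *
      (\<Prod>l\<in>A. if l \<in> S then - (z / (1 - z)) else 1 / (1 - z)) * (\<Prod>l\<in>A. - (z / (1 - z))) * (1 / (2 * of_real pi * \<i> * z * (1 - z)))) =
      (if A \<inter> S = {} then 1 else 0)"
proof -
  define h where "h z = (1 - z) ^ k * (\<Prod>l\<in>A. if l \<in> S then - (z / (1 - z)) else 1 / (1 - z)) * (1 / (1 - z)) / (2 * of_real pi * \<i>)"
    for z :: complex
  have nz: "1 - z \<noteq> 0" if "z \<in> cball 0 r" for z :: complex using that r by auto
  have "contour_integral (circlepath 0 r) (\<lambda>z. (1 - z) ^ k * (1 - inverse z) ^ card A *
      (\<Prod>l\<in>A. if l \<in> S then - (z / (1 - z)) else 1 / (1 - z)) * (\<Prod>l\<in>A. - (z / (1 - z))) * (1 / (2 * of_real pi * \<i> * z * (1 - z)))) =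
     contour_integral (circlepath 0 r) (\<lambda>z. h z / (z - 0))"
  proof (rule contour_integral_eq)
    fix z assume "z \<in> path_image (circlepath 0 r)"
    then have z: "norm z = r" using r by simp
    then have z0: "z \<noteq> 0" "1 - z \<noteq> 0" using r by auto
    then have "(1 - inverse z) * (- (z / (1 - z))) = 1" by (simp add: field_simps)
    then have "(1 - inverse z) ^ card A * (\<Prod>l\<in>A. - (z / (1 - z))) = 1"
      by (simp add: power_mult_distrib[symmetric])
    moreover have "(1 - inverse z) ^ card A * (Q * ((\<Prod>l\<in>A. - (z / (1 - z))) * R)) =
        ((1 - inverse z) ^ card A * (\<Prod>l\<in>A. - (z / (1 - z)))) * (Q * R)" for Q R
      by (simp only: mult.assoc mult.commute mult.left_commute)
    ultimately have "(1 - inverse z) ^ card A * (Q * ((\<Prod>l\<in>A. - (z / (1 - z))) * R)) = Q * R" for Q R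
      by (simp only: mult_1_left)
    then show "(1 - z) ^ k * (1 - inverse z) ^ card A *
      (\<Prod>l\<in>A. if l \<in> S then - (z / (1 - z)) else 1 / (1 - z)) * (\<Prod>l\<in>A. - (z / (1 - z))) * (1 / (2 * of_real pi * \<i> * z * (1 - z)))
      = h z / (z - 0)"
      unfolding h_def by (simp only: mult.assoc) simp
  qed
  also have "\<dots> = 2 * of_real pi * \<i> * h 0"
  proof (rule contour_integral_unique[OF Cauchy_integral_circlepath_simple])
    have "(\<lambda>z. \<Prod>l\<in>A. if l \<in> S then - (z / (1 - z)) else 1 / (1 - z)) holomorphic_on cball 0 r"
    proof (rule holomorphic_on_prod)
      fix l show "(\<lambda>z. if l \<in> S then - (z / (1 - z)) else 1 / (1 - z)) holomorphic_on cball 0 r"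
        using nz by (cases "l \<in> S") (auto intro!: holomorphic_intros)
    qed
    then show "h holomorphic_on cball 0 r"
      unfolding h_def using nz by (auto intro!: holomorphic_intros)
  qed (use r in auto)
  also have "\<dots> = (\<Prod>l\<in>A. if l \<in> S then 0 else 1)"
  proof -
    have "(\<Prod>l\<in>A. if l \<in> S then - (0 / (1 - 0)) else 1 / (1 - 0)) = (\<Prod>l\<in>A. if l \<in> S then 0 else 1 :: complex)"
      by (rule prod.cong) auto
    then show ?thesis by (simp add: h_def)
  qed
  also have "\<dots> = (if A \<inter> S = {} then 1 else 0)"
  proof (cases "A \<inter> S = {}")
    case True
    then have "(\<Prod>l\<in>A. if l \<in> S then 0 else 1 :: complex) = (\<Prod>l\<in>A. 1)" by (intro prod.cong) auto
    then show ?thesis using True by simp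
  next
    case False
    then show ?thesis using fin by (auto intro!: prod_zero)
  qed
  finally show ?thesis .
qed

lemma contour_integrable_circle:
  assumes r: "0 < r" "r < 1" and fin: "finite A"
  shows "(\<lambda>z. (1 - z) ^ k * (1 - inverse z) ^ card A *
      (\<Prod>l\<in>A. if l \<in> S then - (z / (1 - z)) else 1 / (1 - z)) * (\<Prod>l\<in>A. - (z / (1 - z))) * (1 / (2 * of_real pi * \<i> * z * (1 - z))))
      contour_integrable_on circlepath 0 r"
proof (rule contour_integrable_continuous_circlepath)
  have nz: "1 - z \<noteq> 0" "z \<noteq> 0" if "z \<in> path_image (circlepath 0 r)" for z :: complex using that r by auto
  have "continuous_on (path_image (circlepath 0 r)) (\<lambda>z. \<Prod>l\<in>A. if l \<in> S then - (z / (1 - z)) else 1 / (1 - z))"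
  proof (rule continuous_on_prod)
    fix l show "continuous_on (path_image (circlepath 0 r)) (\<lambda>z. if l \<in> S then - (z / (1 - z)) else 1 / (1 - z))"
      using nz by (cases "l \<in> S") (auto intro!: continuous_intros)
  qed
  note P = this
  show "continuous_on (path_image (circlepath 0 r)) (\<lambda>z. (1 - z) ^ k * (1 - inverse z) ^ card A *
      (\<Prod>l\<in>A. if l \<in> S then - (z / (1 - z)) else 1 / (1 - z)) * (\<Prod>l\<in>A. - (z / (1 - z))) * (1 / (2 * of_real pi * \<i> * z * (1 - z))))"
    by (rule continuous_on_mult[OF continuous_on_mult[OF continuous_on_mult[OF _ P]]])
      (use nz in \<open>auto intro!: continuous_intros\<close>)
qed

section \<open>The sum over all choices of contours\<close>

context contour_setting
begin

text \<open>Together with \<open>V_order\<close> this is the order in which \<open>D_fun\<close>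
  lists the variables, with level 1 last; \<open>V_vars\<close> has it first.\<close>

definition U_order :: "var list" where
  "U_order = [U i l. i \<leftarrow> [2..<Suc m], l \<leftarrow> [1..<Suc (n i)]] @ [U 1 l. l \<leftarrow> [1..<Suc (n 1)]]"
definition V_order :: "var list" where
  "V_order = [V i l. i \<leftarrow> [2..<Suc m], l \<leftarrow> [1..<Suc (n i)]] @ [V 1 l. l \<leftarrow> [1..<Suc (n 1)]]"

lemma N_eq: "i \<le> m \<Longrightarrow> N i = n i"
  by (simp add: ext_def)

lemma set_U_order: "set U_order = {U i l | i l. 1 \<le> i \<and> i \<le> m \<and> 1 \<le> l \<and> l \<le> N i}"
proof -
  have "set U_order = {U i l | i l. (2 \<le> i \<and> i \<le> m \<or> i = 1) \<and> 1 \<le> l \<and> l \<le> n i}"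
    by (auto simp: U_order_def less_Suc_eq_le simp del: upt_Suc)
  also have "\<dots> = {U i l | i l. 1 \<le> i \<and> i \<le> m \<and> 1 \<le> l \<and> l \<le> N i}"
    using m_pos by (auto simp: N_eq)
  finally show ?thesis .
qed

lemma set_V_order: "set V_order = {V i l | i l. 1 \<le> i \<and> i \<le> m \<and> 1 \<le> l \<and> l \<le> N i}"
proof -
  have "set V_order = {V i l | i l. (2 \<le> i \<and> i \<le> m \<or> i = 1) \<and> 1 \<le> l \<and> l \<le> n i}"
    by (auto simp: V_order_def less_Suc_eq_le simp del: upt_Suc)
  also have "\<dots> = {V i l | i l. 1 \<le> i \<and> i \<le> m \<and> 1 \<le> l \<and> l \<le> N i}"
    using m_pos by (auto simp: N_eq)
  finally show ?thesis .
qed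

lemma distinct_U_order: "distinct U_order"
proof -
  have "distinct (map (U i) [1..<Suc k])" for i k
    by (simp add: distinct_map inj_on_def del: upt_Suc)
  moreover have "set (map (U i) [1..<Suc k]) \<inter> set (map (U j) [1..<Suc k']) = {}" if "i \<noteq> j" for i j k k'
    using that by (auto simp del: upt_Suc)
  ultimately have "distinct (concat (map (\<lambda>i. map (U i) [1..<Suc (n i)]) [2..<Suc m]))"
    by (intro distinct_concat_map distinct_upt) blast+
  moreover have "distinct (map (U 1) [1..<Suc (n 1)])" by (simp add: distinct_map inj_on_def del: upt_Suc)
  ultimately show ?thesis unfolding U_order_def distinct_append
    by (auto simp del: upt_Suc)
qed

lemma distinct_V_order: "distinct V_order"
proof -
  have "distinct (map (V i) [1..<Suc k])" for i k
    by (simp add: distinct_map inj_on_def del: upt_Suc)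
  moreover have "set (map (V i) [1..<Suc k]) \<inter> set (map (V j) [1..<Suc k']) = {}" if "i \<noteq> j" for i j k k'
    using that by (auto simp del: upt_Suc)
  ultimately have "distinct (concat (map (\<lambda>i. map (V i) [1..<Suc (n i)]) [2..<Suc m]))"
    by (intro distinct_concat_map distinct_upt) blast+
  moreover have "distinct (map (V 1) [1..<Suc (n 1)])" by (simp add: distinct_map inj_on_def del: upt_Suc)
  ultimately show ?thesis unfolding V_order_def distinct_append
    by (auto simp del: upt_Suc)
qed

lemma all_vars_eq: "all_vars = {U i l | i l. 1 \<le> i \<and> i \<le> m \<and> 1 \<le> l \<and> l \<le> N i} \<union> {V i l | i l. 1 \<le> i \<and> i \<le> m \<and> 1 \<le> l \<and> l \<le> N i}"
  (is "_ = ?R")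
proof -
  have "a \<in> all_vars \<longleftrightarrow> a \<in> ?R" for a
    by (cases a) (auto simp: U_in_all_vars V_in_all_vars)
  then show ?thesis by blast
qed

lemma set_order: "set (U_order @ V_order) = all_vars" "distinct (U_order @ V_order)"
  using distinct_U_order distinct_V_order by (auto simp: set_U_order set_V_order all_vars_eq)

lemma set_V_vars_eq: "set (V_vars m) = set V_order"
proof -
  have "a \<in> set (V_vars m) \<longleftrightarrow> a \<in> set V_order" for a
  proof (cases a)
    case (V j l)
    then show ?thesis by (cases l) (auto simp: set_V_vars set_V_order)
  qed (auto simp: set_V_vars set_V_order)
  then show ?thesis by blast
qed

lemma distinct_V_vars: "distinct (V_vars m)"
  unfolding V_vars_def
proof (rule distinct_concat_map)
  show "set (level_vars i) \<inter> set (level_vars j) = {}" if "i \<noteq> j" for i j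
    using that by (auto simp: set_level_vars)
qed (rule distinct_upt distinct_level_vars)+

lemma cint_contour_eq: "(\<lambda>a. cint (contour S a)) = (\<lambda>a. path_integral (contour S a) (weight S a))"
  by (rule HOL.ext) (rule cint_eq_path_integral)

text \<open>With U fixed on its contours the integrand is still dominated as a function of V, so
  that Fubini applies to the inner integral alone.\<close>

lemma V_integral_reorder:
  assumes S: "S \<subseteq> upper" and y: "\<And>a. a \<in> set U_order \<Longrightarrow> y a \<in> K a"
  shows "iterated_integral (\<lambda>a. cint (contour S a)) V_order (integrand m n \<alpha> \<beta>) y =
     iterated_integral (\<lambda>a. cint (contour S a)) (V_vars m) (integrand m n \<alpha> \<beta>) y"
proof -
  obtain \<kappa> where \<kappa>: "\<And>x. dominated K (\<phi> \<kappa>) all_vars (integrand m n \<alpha> \<beta>) x" using dominated_integrand by blast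
  interpret paths K "\<phi> \<kappa>" "contour S" "weight S" all_vars by (rule paths_contour[OF S])
  have sub: "set (V_vars m) \<subseteq> all_vars" using set_order(1) set_V_vars_eq by auto
  have "all_vars - set (V_vars m) \<subseteq> set U_order" using set_order(1) set_V_vars_eq by auto
  then have "dominated K (\<phi> \<kappa>) (set (V_vars m)) (integrand m n \<alpha> \<beta>) y"
    by (intro dominated_fix[OF \<kappa>[of y] sub finite_all_vars]) (use y in auto)
  then show ?thesis
    unfolding cint_contour_eq
    by (intro iterated_integral_reorder sub distinct_V_vars measurable_integrand distinct_V_order set_V_vars_eq[symmetric])
qed

definition choice_integral :: "var set \<Rightarrow> complex" where
  "choice_integral S = iterated_integral (\<lambda>a. cint (contour S a)) (U_order @ V_order) (integrand m n \<alpha> \<beta>) (\<lambda>_. 0)"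

lemma choice_integral_reorder:
  assumes S: "S \<subseteq> upper" and as: "set as = all_vars" "distinct as"
  shows "choice_integral S = iterated_integral (\<lambda>a. cint (contour S a)) as (integrand m n \<alpha> \<beta>) (\<lambda>_. 0)"
proof -
  obtain \<kappa> where \<kappa>: "\<And>x. dominated K (\<phi> \<kappa>) all_vars (integrand m n \<alpha> \<beta>) x" using dominated_integrand by blast
  interpret paths K "\<phi> \<kappa>" "contour S" "weight S" all_vars by (rule paths_contour[OF S])
  show ?thesis unfolding choice_integral_def cint_contour_eq
    using \<kappa> as set_order by (intro iterated_integral_reorder measurable_integrand) auto
qed

text \<open>U outermost, then V in the order of descent. The order among the U is left free, because
  \<open>D_fun\<close> and the second formula list them differently.\<close>

lemma choice_integral_eq:
  assumes S: "S \<subseteq> upper" and us: "set us = set U_order" "distinct us"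
  shows "choice_integral S = (if \<exists>j\<in>{2..m}. \<exists>l<N j. V j (Suc l) \<in> S then 0 else
    iterated_integral (\<lambda>a. cint (contour S a)) us
      (iterated_integral (\<lambda>a. cint (contour S a)) (level_vars 1) (partial_integrand 1)) (\<lambda>_. 0))"
proof -
  let ?J = "\<lambda>a. cint (contour S a)"
  have all: "set (us @ V_order) = all_vars" "distinct (us @ V_order)"
    using us set_order by auto
  have "choice_integral S = iterated_integral ?J us (\<lambda>y. if \<exists>j\<in>{2..m}. \<exists>l<N j. V j (Suc l) \<in> S then 0 else
      iterated_integral ?J (level_vars 1) (partial_integrand 1) y) (\<lambda>_. 0)"
    unfolding choice_integral_reorder[OF S all] iterated_integral_append
  proof (rule iterated_integral_cong[where K = "\<lambda>a. range (contour S a)"])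
    fix y assume y: "\<And>a. a \<in> set us \<Longrightarrow> y a \<in> range (contour S a)"
    have yK: "y a \<in> K a" if "a \<in> set U_order" for a using y[of a] that us(1) contour_in_K[OF S] by auto
    have "Re (U_coord y j l) < 0" if "j \<in> {1..m}" "l < N j" for j l
      using yK[of "U j (Suc l)"] K_U[OF that(1)] that by (auto simp: U_coord_def set_U_order)
    then show "iterated_integral ?J V_order (integrand m n \<alpha> \<beta>) y = (if \<exists>j\<in>{2..m}. \<exists>l<N j. V j (Suc l) \<in> S then 0 else
      iterated_integral ?J (level_vars 1) (partial_integrand 1) y)"
      using V_integral_reorder[OF S yK] iterated_integral_V[OF S] by simp
  qed (rule cint_cong)
  then show ?thesis
    by (cases "\<exists>j\<in>{2..m}. \<exists>l<N j. V j (Suc l) \<in> S") (simp_all only: if_True if_False iterated_integral_cint_zero)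
qed

text \<open>The coefficient of the contour that \<open>S\<close> selects for \<open>a\<close>.
  Membership in \<open>S\<close> means \<open>out\<close> for a U and \<open>in\<close> for a V; on
  level 1 it costs a factor 0, so that the sum may run over all sets of variables.\<close>

definition coef :: "(nat \<Rightarrow> complex) \<Rightarrow> var set \<Rightarrow> var \<Rightarrow> complex" where
  "coef z S a = (case a of
     U i l \<Rightarrow> if i = 1 then (if a \<in> S then 0 else 1) else if a \<in> S then - (z (i - 1) / (1 - z (i - 1))) else 1 / (1 - z (i - 1))
   | V i l \<Rightarrow> if i = 1 then (if a \<in> S then 0 else 1) else if a \<in> S then 1 / (1 - z (i - 1)) else - (z (i - 1) / (1 - z (i - 1))))"

text \<open>Each functional is a combination of at most two integrals with coefficients depending on
  \<open>z\<close> alone; expand. Intersecting with \<open>upper\<close> keeps the terms with a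
  level 1 variable in \<open>S\<close> meaningful, and their coefficient is 0.\<close>

lemma D_fun_eq:
  "D_fun m n \<alpha> \<beta> Lin Lout Rin Rout z = (\<Prod>i=1..<m. (1 - z i) ^ n i * (1 - inverse (z i)) ^ n (Suc i)) *
     (\<Sum>S\<in>Pow all_vars. (\<Prod>a\<in>all_vars. coef z S a) * choice_integral (S \<inter> upper))"
proof -
  let ?p1 = "\<lambda>a. contour ({a} \<inter> upper) a" and ?q1 = "\<lambda>a. weight ({a} \<inter> upper) a"
  obtain \<kappa> where \<kappa>: "\<And>x. dominated K (\<phi> \<kappa>) all_vars (integrand m n \<alpha> \<beta>) x" using dominated_integrand by blast
  have sel: "(if a \<in> S then ?p1 a else contour {} a) = contour (S \<inter> upper) a" for a S
    by (auto simp: contour_def split: var.splits)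
  have selq: "(if a \<in> S then ?q1 a else weight {} a) = weight (S \<inter> upper) a" for a S
    using sel[of a S] by (cases "a \<in> S") auto
  have J: "(\<lambda>a g. case a of
            U i l \<Rightarrow> if i = 1 then line_integral (Lin 1) g / (2 * of_real pi * \<i>)
                     else mixed_integral (z (i - 1)) (Lin i) (Lout i) g
          | V i l \<Rightarrow> if i = 1 then line_integral (Rout 1) g / (2 * of_real pi * \<i>)
                     else mixed_integral (z (i - 1)) (Rin i) (Rout i) g) a g =
      coef z {} a * path_integral (contour {} a) (weight {} a) g + coef z UNIV a * path_integral (?p1 a) (?q1 a) g"
    if "a \<in> all_vars" for a g
    unfolding cint_eq_path_integral[symmetric] using that
    by (cases a) (auto simp: coef_def contour_def mixed_integral_def cint_def upper_def U_in_all_vars V_in_all_vars)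
  have "iterated_integral
         (\<lambda>a g. case a of
            U i l \<Rightarrow> if i = 1 then line_integral (Lin 1) g / (2 * of_real pi * \<i>)
                     else mixed_integral (z (i - 1)) (Lin i) (Lout i) g
          | V i l \<Rightarrow> if i = 1 then line_integral (Rout 1) g / (2 * of_real pi * \<i>)
                     else mixed_integral (z (i - 1)) (Rin i) (Rout i) g) (U_order @ V_order) (integrand m n \<alpha> \<beta>) (\<lambda>_. 0) =
     iterated_integral (\<lambda>a g. coef z {} a * path_integral (contour {} a) (weight {} a) g + coef z UNIV a * path_integral (?p1 a) (?q1 a) g)
       (U_order @ V_order) (integrand m n \<alpha> \<beta>) (\<lambda>_. 0)"
  proof (rule iterated_integral_cong[where K = "\<lambda>_. UNIV"])
    fix a and g h :: "complex \<Rightarrow> complex"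
    assume a: "a \<in> set (U_order @ V_order)" and "\<And>w. w \<in> UNIV \<Longrightarrow> g w = h w"
    then have "g = h" by auto
    then show "(case a of
            U i l \<Rightarrow> if i = 1 then line_integral (Lin 1) g / (2 * of_real pi * \<i>)
                     else mixed_integral (z (i - 1)) (Lin i) (Lout i) g
          | V i l \<Rightarrow> if i = 1 then line_integral (Rout 1) g / (2 * of_real pi * \<i>)
                     else mixed_integral (z (i - 1)) (Rin i) (Rout i) g) =
       coef z {} a * path_integral (contour {} a) (weight {} a) h + coef z UNIV a * path_integral (?p1 a) (?q1 a) h"
      using J[of a g] a unfolding set_order by simp
  qed simp
  also have "\<dots> = (\<Sum>S\<in>Pow all_vars. (\<Prod>a\<in>all_vars. if a \<in> S then coef z UNIV a else coef z {} a) *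
       iterated_integral (\<lambda>a. path_integral (if a \<in> S then ?p1 a else contour {} a) (if a \<in> S then ?q1 a else weight {} a))
         (U_order @ V_order) (integrand m n \<alpha> \<beta>) (\<lambda>_. 0))"
    unfolding set_order(1)[symmetric]
  proof (rule iterated_integral_mixed[where K = K and \<phi> = "\<phi> \<kappa>"])
    show "finite all_vars" by (rule finite_all_vars)
    show "paths K (\<phi> \<kappa>) (\<lambda>a. if a \<in> S then ?p1 a else contour {} a) (\<lambda>a. if a \<in> S then ?q1 a else weight {} a) all_vars" for S
      unfolding sel selq by (rule paths_contour) simp
  qed (use set_order \<kappa> measurable_integrand in auto)
  also have "\<dots> = (\<Sum>S\<in>Pow all_vars. (\<Prod>a\<in>all_vars. coef z S a) * choice_integral (S \<inter> upper))"
  proof (rule sum.cong[OF refl])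
    fix S
    have "(if a \<in> S then coef z UNIV a else coef z {} a) = coef z S a" for a
      by (cases a) (auto simp: coef_def)
    then show "(\<Prod>a\<in>all_vars. if a \<in> S then coef z UNIV a else coef z {} a) *
       iterated_integral (\<lambda>a. path_integral (if a \<in> S then ?p1 a else contour {} a) (if a \<in> S then ?q1 a else weight {} a))
         (U_order @ V_order) (integrand m n \<alpha> \<beta>) (\<lambda>_. 0) = (\<Prod>a\<in>all_vars. coef z S a) * choice_integral (S \<inter> upper)"
      unfolding sel selq choice_integral_def cint_contour_eq by simp
  qed
  finally show ?thesis
    unfolding D_fun_def U_order_def V_order_def by simp
qed

end

section \<open>Separation of the circle variables\<close>

context contour_setting
begin

definition circle_factor :: "var set \<Rightarrow> nat \<Rightarrow> complex \<Rightarrow> complex" where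
  "circle_factor S i z = (1 - z) ^ n i * (1 - inverse z) ^ card {..<n (Suc i)} *
      (\<Prod>l\<in>{..<n (Suc i)}. if l \<in> {l. U (Suc i) (Suc l) \<in> S} then - (z / (1 - z)) else 1 / (1 - z)) *
      (\<Prod>l\<in>{..<n (Suc i)}. - (z / (1 - z))) * (1 / (2 * of_real pi * \<i> * z * (1 - z)))"

text \<open>The value 0 outside \<open>upper\<close> stands for the vanishing level 1 coefficients,
  which \<open>circle_factor\<close> does not record.\<close>

definition upper_integral :: "var set \<Rightarrow> complex" where
  "upper_integral S = (if S \<subseteq> upper then choice_integral S else 0)"

lemma prod_coef:
  assumes S: "S \<subseteq> upper" and V: "\<And>j l. j \<in> {2..m} \<Longrightarrow> l < N j \<Longrightarrow> V j (Suc l) \<notin> S"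
  shows "(\<Prod>a\<in>all_vars. coef z S a) = (\<Prod>i=1..<m. (\<Prod>l\<in>{..<n (Suc i)}.
      if l \<in> {l. U (Suc i) (Suc l) \<in> S} then - (z i / (1 - z i)) else 1 / (1 - z i)) *
      (\<Prod>l\<in>{..<n (Suc i)}. - (z i / (1 - z i))))"
proof -
  let ?f = "\<lambda>j. (\<Prod>l<N j. coef z S (U j (Suc l))) * (\<Prod>l<N j. coef z S (V j (Suc l)))"
  have split: "{1..m} = insert 1 {Suc 1..<Suc m}" using m_pos by auto
  have "U (Suc 0) l \<notin> S" "V (Suc 0) l \<notin> S" for l using S by (auto simp: upper_def)
  then have first: "?f 1 = 1" by (simp add: coef_def)
  have "(\<Prod>a\<in>all_vars. coef z S a) = ?f 1 * (\<Prod>j=Suc 1..<Suc m. ?f j)"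
    unfolding prod_all_vars split by (subst prod.insert) auto
  also have "\<dots> = (\<Prod>i=1..<m. ?f (Suc i))" unfolding first by (simp only: mult_1_left prod.shift_bounds_Suc_ivl)
  also have "\<dots> = (\<Prod>i=1..<m. (\<Prod>l\<in>{..<n (Suc i)}.
      if l \<in> {l. U (Suc i) (Suc l) \<in> S} then - (z i / (1 - z i)) else 1 / (1 - z i)) *
      (\<Prod>l\<in>{..<n (Suc i)}. - (z i / (1 - z i))))"
  proof (rule prod.cong[OF refl])
    fix i assume i: "i \<in> {1..<m}"
    then have N: "N (Suc i) = n (Suc i)" by (simp add: N_eq)
    have "(\<Prod>l<N (Suc i). coef z S (V (Suc i) (Suc l))) = (\<Prod>l\<in>{..<n (Suc i)}. - (z i / (1 - z i)))"
      using V[of "Suc i"] i N by (intro prod.cong) (auto simp: coef_def)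
    moreover have "(\<Prod>l<N (Suc i). coef z S (U (Suc i) (Suc l))) =
       (\<Prod>l\<in>{..<n (Suc i)}. if l \<in> {l. U (Suc i) (Suc l) \<in> S} then - (z i / (1 - z i)) else 1 / (1 - z i))"
      using i N by (intro prod.cong) (auto simp: coef_def)
    ultimately show "?f (Suc i) = (\<Prod>l\<in>{..<n (Suc i)}.
      if l \<in> {l. U (Suc i) (Suc l) \<in> S} then - (z i / (1 - z i)) else 1 / (1 - z i)) *
      (\<Prod>l\<in>{..<n (Suc i)}. - (z i / (1 - z i)))" by simp
  qed
  finally show ?thesis .
qed

text \<open>If \<open>S\<close> is not contained in \<open>upper\<close>, a coefficient vanishes; if
  some V runs over an \<open>in\<close> contour, the integral does. Otherwise all V are on
  \<open>out\<close> contours, and the coefficient is a product over \<open>i\<close> of functions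
  of \<open>z i\<close>.\<close>

lemma choice_term_eq:
  assumes S: "S \<subseteq> all_vars"
  shows "(\<Prod>i=1..<m. (1 - z i) ^ n i * (1 - inverse (z i)) ^ n (Suc i)) *
     ((\<Prod>a\<in>all_vars. coef z S a) * choice_integral (S \<inter> upper)) * (\<Prod>i=1..<m. 1 / (2 * of_real pi * \<i> * z i * (1 - z i))) =
     upper_integral S * (\<Prod>i\<in>set [1..<m]. circle_factor S i (z i))"
proof (cases "S \<subseteq> upper")
  case False
  then obtain a where a: "a \<in> S" "a \<notin> upper" by blast
  have "a \<in> all_vars" using a S by blast
  then have "coef z S a = 0"
    using a by (cases a) (auto simp: coef_def upper_def U_in_all_vars V_in_all_vars)
  then have "(\<Prod>a\<in>all_vars. coef z S a) = 0" using a S finite_all_vars by (intro prod_zero) auto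
  then show ?thesis using False by (simp add: upper_integral_def)
next
  case True
  then have inter: "S \<inter> upper = S" by blast
  show ?thesis
  proof (cases "\<exists>j\<in>{2..m}. \<exists>l<N j. V j (Suc l) \<in> S")
    case V: True
    have "choice_integral S = 0" unfolding choice_integral_eq[OF True refl distinct_U_order] if_P[OF V] ..
    then show ?thesis using True by (simp add: upper_integral_def inter)
  next
    case False
    have "(\<Prod>a\<in>all_vars. coef z S a) = (\<Prod>i=1..<m. (\<Prod>l\<in>{..<n (Suc i)}.
      if l \<in> {l. U (Suc i) (Suc l) \<in> S} then - (z i / (1 - z i)) else 1 / (1 - z i)) *
      (\<Prod>l\<in>{..<n (Suc i)}. - (z i / (1 - z i))))"
      by (rule prod_coef[OF True]) (use False in blast)
    then show ?thesis
      unfolding circle_factor_def set_upt inter upper_integral_def if_P[OF True] card_lessThan prod.distrib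
      by (simp only: mult.assoc mult.commute mult.left_commute)
  qed
qed

lemma D_hat_eq:
  assumes r: "\<forall>i\<in>{1..<m}. 0 < r i \<and> r i < 1"
  shows "D_hat m n \<alpha> \<beta> Lin Lout Rin Rout r = choice_integral {}"
proof -
  let ?J = "\<lambda>i. contour_integral (circlepath 0 (r i))"
  have "D_hat m n \<alpha> \<beta> Lin Lout Rin Rout r = iterated_integral ?J [1..<m]
      (\<lambda>z. \<Sum>S\<in>Pow all_vars. upper_integral S * (\<Prod>i\<in>set [1..<m]. circle_factor S i (z i)) * 1) (\<lambda>_. 0)"
    unfolding D_hat_def
  proof (rule arg_cong[where f = "\<lambda>G. iterated_integral ?J [1..<m] G (\<lambda>_. 0)"], rule HOL.ext)
    fix z
    show "D_fun m n \<alpha> \<beta> Lin Lout Rin Rout z * (\<Prod>i=1..<m. 1 / (2 * of_real pi * \<i> * z i * (1 - z i))) =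
      (\<Sum>S\<in>Pow all_vars. upper_integral S * (\<Prod>i\<in>set [1..<m]. circle_factor S i (z i)) * 1)"
      unfolding D_fun_eq sum_distrib_left sum_distrib_right
      by (rule sum.cong[OF refl]) (simp only: choice_term_eq PowD mult_1_right)
  qed
  also have "\<dots> = (\<Sum>S\<in>Pow all_vars. upper_integral S * (\<Prod>i\<in>set [1..<m]. ?J i (circle_factor S i)) * 1)"
  \<comment> \<open>Nothing depends on \<open>z\<close> besides the circle factors, hence
    \<open>H\<close> is 1, with the constants as admissible functions.\<close>
  proof (rule iterated_integral_sum_prod[where good = "\<lambda>_ h. \<exists>c. h = (\<lambda>_. c)" and b = "\<lambda>_ _. 0" and H = "\<lambda>_. 1"])
    show "finite (Pow all_vars)" using finite_all_vars by simp
    fix i and k :: "var set \<Rightarrow> complex" and h :: "var set \<Rightarrow> complex \<Rightarrow> complex"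
    assume i: "i \<in> set [1..<m]" and h: "\<And>S. S \<in> Pow all_vars \<Longrightarrow> \<exists>c. h S = (\<lambda>_. c)"
    have ri: "0 < r i" "r i < 1" using r i by auto
    have const: "h S w = h S 0" if "S \<in> Pow all_vars" for S w using h[OF that] by auto
    have int: "circle_factor S i contour_integrable_on circlepath 0 (r i)" for S
      using contour_integrable_circle[OF ri, of "{..<n (Suc i)}" "n i" "{l. U (Suc i) (Suc l) \<in> S}"]
      unfolding circle_factor_def[abs_def] by simp
    have "?J i (\<lambda>w. \<Sum>S\<in>Pow all_vars. k S * circle_factor S i w * h S w) =
      ?J i (\<lambda>w. \<Sum>S\<in>Pow all_vars. (k S * h S 0) * circle_factor S i w)"
      by (rule contour_integral_eq, rule sum.cong[OF refl], subst const) (simp_all only: mult.assoc mult.commute mult.left_commute)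
    also have "\<dots> = (\<Sum>S\<in>Pow all_vars. ?J i (\<lambda>w. (k S * h S 0) * circle_factor S i w))"
      using finite_all_vars by (intro contour_integral_sum contour_integrable_lmul int) auto
    also have "\<dots> = (\<Sum>S\<in>Pow all_vars. k S * ?J i (circle_factor S i) * h S 0)"
      by (rule sum.cong[OF refl], subst contour_integral_lmul[OF int]) (simp only: mult.assoc mult.commute mult.left_commute)
    finally show "?J i (\<lambda>w. \<Sum>S\<in>Pow all_vars. k S * circle_factor S i w * h S w) =
      (\<Sum>S\<in>Pow all_vars. k S * ?J i (circle_factor S i) * h S 0)" .
  qed auto
  \<comment> \<open>Any element of \<open>S\<close> decides: a U of level \<open>j\<close> on an
    \<open>out\<close> contour annihilates the integral over the circle of index
    \<open>j - 1\<close>, a V on an \<open>in\<close> contour the integral over U and V.\<close>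
  also have "\<dots> = (\<Sum>S\<in>{{}}. upper_integral S * (\<Prod>i\<in>set [1..<m]. ?J i (circle_factor S i)) * 1)"
  proof (rule sum.mono_neutral_right)
    show "finite (Pow all_vars)" using finite_all_vars by simp
    show "\<forall>S\<in>Pow all_vars - {{}}. upper_integral S * (\<Prod>i\<in>set [1..<m]. ?J i (circle_factor S i)) * 1 = 0"
    proof
      fix S assume "S \<in> Pow all_vars - {{}}"
      then obtain a where S: "S \<subseteq> all_vars" and a: "a \<in> S" by blast
      show "upper_integral S * (\<Prod>i\<in>set [1..<m]. ?J i (circle_factor S i)) * 1 = 0"
      proof (cases "S \<subseteq> upper")
        case True
        then have au: "a \<in> upper" using a by blast
        show ?thesis
        proof (cases a)
          case (U j l)
          then obtain i l' where i: "j = Suc i" "l = Suc l'" "i \<in> {1..<m}" "l' < n (Suc i)"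
            using au subsetD[OF S a] by (cases j; cases l) (auto simp: U_in_all_vars upper_def N_eq)
          have ri: "0 < r i" "r i < 1" using r i by auto
          have "?J i (circle_factor S i) = 0"
            using contour_integral_circle_at_0[OF ri, of "{..<n (Suc i)}" "n i" "{l. U (Suc i) (Suc l) \<in> S}"] a U i
            unfolding circle_factor_def[abs_def] by auto
          then have "(\<Prod>i\<in>set [1..<m]. ?J i (circle_factor S i)) = 0"
            using i by (intro prod_zero) auto
          then show ?thesis by simp
        next
          case (V j l)
          then have "\<exists>j\<in>{2..m}. \<exists>l<N j. V j (Suc l) \<in> S"
            using au subsetD[OF S a] a by (cases l) (auto simp: V_in_all_vars upper_def Suc_le_eq)
          then have "choice_integral S = 0" unfolding choice_integral_eq[OF True refl distinct_U_order] by (rule if_P)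
          then show ?thesis by (simp add: upper_integral_def)
        qed
      qed (simp add: upper_integral_def)
    qed
  qed auto
  also have "\<dots> = choice_integral {}"
  proof -
    have "?J i (circle_factor {} i) = 1" if "i \<in> set [1..<m]" for i
    proof -
      have ri: "0 < r i" "r i < 1" using r that by auto
      show ?thesis
        using contour_integral_circle_at_0[OF ri, of "{..<n (Suc i)}" "n i" "{l. U (Suc i) (Suc l) \<in> {}}"]
        unfolding circle_factor_def[abs_def] by simp
    qed
    then have "(\<Prod>i\<in>set [1..<m]. ?J i (circle_factor {} i)) = 1" by (intro prod.neutral) blast
    then show ?thesis by (simp add: upper_integral_def)
  qed
  finally show ?thesis .
qed

end

section \<open>The reduced integral\<close>

lemma iterated_integral_cint_cmult:
  "iterated_integral (\<lambda>a. cint (\<gamma> a)) as (\<lambda>y. c * G y) x = c * iterated_integral (\<lambda>a. cint (\<gamma> a)) as G x"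
  by (induction as arbitrary: x) (auto simp: cint_def line_integral_def mult.assoc)

text \<open>An entry is either one of finitely many fixed numbers, at \<open>c j\<close>, or has its
  two arguments on opposite sides of the imaginary axis, at distance at least
  \<open>- Re (a i)\<close>. The bound \<open>M\<close> adds up both possibilities.\<close>

lemma cdet_bounded:
  assumes "\<And>i. i < k \<Longrightarrow> Re (a i) < 0"
  shows "\<exists>C\<ge>0. \<forall>b. (\<forall>j<k. b j = c j \<or> 0 < Re (b j)) \<longrightarrow> norm (cdet k a b) \<le> C \<and> norm (cdet k b a) \<le> C"
proof -
  define M where "M = (\<Sum>i<k. 1 / (- Re (a i)) + (\<Sum>j<k. norm (1 / (a i - c j))))"
  have pos: "0 \<le> 1 / (- Re (a i)) + (\<Sum>j<k. norm (1 / (a i - c j)))" if "i < k" for i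
    using assms[OF that] by (intro add_nonneg_nonneg sum_nonneg) (auto simp: divide_nonneg_pos)
  then have M: "0 \<le> M" unfolding M_def by (intro sum_nonneg) auto
  have le: "norm (1 / (a i - b j)) \<le> M" if b: "\<forall>j<k. b j = c j \<or> 0 < Re (b j)" and ij: "i < k" "j < k" for b i j
  proof -
    have "norm (1 / (a i - b j)) \<le> 1 / (- Re (a i)) + (\<Sum>j<k. norm (1 / (a i - c j)))"
    proof (cases "b j = c j")
      case True
      then have "norm (1 / (a i - b j)) \<le> (\<Sum>j<k. norm (1 / (a i - c j)))"
        using ij member_le_sum[of j "{..<k}" "\<lambda>j. norm (1 / (a i - c j))"] by simp
      moreover have "0 \<le> 1 / (- Re (a i))" using assms[OF ij(1)] by (simp add: divide_nonneg_pos)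
      ultimately show ?thesis by linarith
    next
      case False
      then have "0 < Re (b j)" using b ij by auto
      then have "- Re (a i) \<le> norm (a i - b j)" using abs_Re_le_cmod[of "a i - b j"] by simp
      then have "norm (1 / (a i - b j)) \<le> 1 / (- Re (a i))"
        unfolding norm_divide norm_one using assms[OF ij(1)] by (intro frac_le) auto
      moreover have "0 \<le> (\<Sum>j<k. norm (1 / (a i - c j)))" by (intro sum_nonneg) auto
      ultimately show ?thesis by linarith
    qed
    also have "\<dots> \<le> M"
      unfolding M_def using ij pos by (intro member_le_sum) auto
    finally show ?thesis .
  qed
  have "norm (cdet k a b) \<le> fact k * M ^ k \<and> norm (cdet k b a) \<le> fact k * M ^ k"
    if b: "\<forall>j<k. b j = c j \<or> 0 < Re (b j)" for b
  proof
    have "norm (cdet k a b) \<le> fact k * M ^ k * (\<Prod>i<k. 1) * (\<Prod>i<k. 1)"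
      by (rule norm_cdet_le[where e = "\<lambda>_. 1"]) (use le[OF b] M in auto)
    then show "norm (cdet k a b) \<le> fact k * M ^ k" by simp
    have "norm (1 / (b i - a j)) \<le> M" if "i < k" "j < k" for i j
      using le[OF b that(2,1)] by (simp add: norm_divide norm_minus_commute)
    then have "norm (cdet k b a) \<le> fact k * M ^ k * (\<Prod>i<k. 1) * (\<Prod>i<k. 1)"
      by (intro norm_cdet_le[where e = "\<lambda>_. 1"]) (use M in auto)
    then show "norm (cdet k b a) \<le> fact k * M ^ k" by simp
  qed
  moreover have "0 \<le> fact k * M ^ k" using M by simp
  ultimately show ?thesis by blast
qed

section \<open>Collapsing the antisymmetrization on level 1\<close>

context contour_setting
begin

definition ordered_integrand :: "(var \<Rightarrow> complex) \<Rightarrow> (nat \<Rightarrow> complex) \<Rightarrow> complex" where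
  "ordered_integrand x B = cdet (N 1) B (U_coord x 1) * tail_product x 1 B * (\<Prod>j=1..m. \<Prod>l<N j. F j (U_coord x j l))"

text \<open>The first Cauchy determinant is antisymmetric in level 1 and absorbs the signs.\<close>

lemma partial_integrand_1:
  "partial_integrand 1 x = tail_count 1 * (\<Sum>\<rho> | \<rho> permutes {..<N 1}. ordered_integrand x (V_coord x 1 \<circ> \<rho>))"
proof -
  have "of_int (sign \<rho>) * cdet (N 1) (V_coord x 1) (U_coord x 1) = cdet (N 1) (V_coord x 1 \<circ> \<rho>) (U_coord x 1)"
    if "\<rho> permutes {..<N 1}" for \<rho>
    using cdet_permute_left[OF that] by simp
  then have "ordered_integrand x (V_coord x 1 \<circ> \<rho>) = cdet (N 1) (V_coord x 1) (U_coord x 1) *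
      (of_int (sign \<rho>) * tail_product x 1 (V_coord x 1 \<circ> \<rho>)) * (\<Prod>j=1..m. \<Prod>l<N j. F j (U_coord x j l))"
    if "\<rho> permutes {..<N 1}" for \<rho>
    unfolding ordered_integrand_def using that by (simp only: flip: mult.assoc) (simp only: mult.commute)
  then have "(\<Sum>\<rho> | \<rho> permutes {..<N 1}. ordered_integrand x (V_coord x 1 \<circ> \<rho>)) =
      (\<Sum>\<rho> | \<rho> permutes {..<N 1}. cdet (N 1) (V_coord x 1) (U_coord x 1) *
      (of_int (sign \<rho>) * tail_product x 1 (V_coord x 1 \<circ> \<rho>)) * (\<Prod>j=1..m. \<Prod>l<N j. F j (U_coord x j l)))"
    by (intro sum.cong refl) blast
  also have "\<dots> = cdet (N 1) (V_coord x 1) (U_coord x 1) *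
      (\<Sum>\<rho> | \<rho> permutes {..<N 1}. of_int (sign \<rho>) * tail_product x 1 (V_coord x 1 \<circ> \<rho>)) * (\<Prod>j=1..m. \<Prod>l<N j. F j (U_coord x j l))"
    by (simp only: sum_distrib_left sum_distrib_right)
  finally show ?thesis
    unfolding partial_integrand_def tail_sum_def
    by (simp only: atLeastLessThan_empty[OF order_refl] prod.empty mult_1_right mult_1_left mult.assoc mult.commute mult.left_commute)
qed

lemma K_level_1: "K (V (Suc 0) l) = range (Rout (Suc 0))"
  by (auto simp: K_def contour_def upper_def)

text \<open>After the descent the factors of all levels are evaluated on the contour of level 1,
  along which they decay as well.\<close>

lemma inverse_F_bounded:
  assumes "j \<in> {2..m}" shows "\<exists>C\<ge>0. \<forall>t. norm (1 / F j (Rout 1 t)) \<le> C"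
proof -
  have "\<alpha> (j - 1) < \<alpha> j" using strict_mono_onD[OF \<alpha>_mono, of "j - 1" j] assms by auto
  moreover have "1 / F j w = 1 / exp (of_real (\<alpha> j - \<alpha> (j - 1)) * w\<^sup>2 + of_real (\<beta> j - \<beta> (j - 1)) * w)" for w
    using assms by (simp add: F_eq)
  then have "1 / F j w = exp (- (of_real (\<alpha> j - \<alpha> (j - 1)) * w\<^sup>2 + of_real (\<beta> j - \<beta> (j - 1)) * w))" for w
    by (simp only: exp_minus inverse_eq_divide)
  then have eq: "1 / F j w = exp (of_real 0 * w ^ 3 + of_real (- (\<alpha> j - \<alpha> (j - 1))) * w\<^sup>2 + of_real (- (\<beta> j - \<beta> (j - 1))) * w)" for w
    by (simp add: algebra_simps)
  have c: "unbounded_contour (pi / 5) (Rout 1)" using Rout_contour[of 1] m_pos by simp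
  have "\<exists>C. \<forall>t. norm (1 / F j (Rout 1 t)) \<le> C * exp (- 0 * norm (Rout 1 t))"
    using cos_values calculation by (intro unbounded_contour_exp_cubic[OF c _ eq]) (auto simp: mult_neg_pos)
  then obtain C where "\<And>t. norm (1 / F j (Rout 1 t)) \<le> C" by auto
  then show ?thesis using norm_ge_zero order_trans by blast
qed

lemma N_decreasing:
  assumes dec: "\<And>j. j \<in> {1..m} \<Longrightarrow> N (Suc j) \<le> N j" and "1 \<le> i" "i \<le> j" "j \<le> Suc m"
  shows "N j \<le> N i"
  using assms(3,4)
proof (induction j rule: dec_induct)
  case (step k)
  then show ?case using dec[of k] assms(2) by simp
qed simp

text \<open>As the level sizes decrease, only level 1 variables are read. With U frozen in the left
  half plane the determinants are bounded, and so are the \<open>1 / F j\<close> with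
  \<open>j \<ge> 2\<close>; the remaining \<open>1 / F 1\<close> is the dominating function itself,
  with rate 0.\<close>

lemma dominated_ordered:
  assumes dec: "\<And>j. j \<in> {1..m} \<Longrightarrow> N (Suc j) \<le> N j"
    and U: "\<And>j l. j \<in> {1..m} \<Longrightarrow> l < N j \<Longrightarrow> Re (U_coord x j l) < 0"
    and \<rho>: "\<rho> permutes {..<N 1}"
  shows "dominated K (\<phi> 0) (set (level_vars 1)) (\<lambda>y. ordered_integrand y (V_coord y 1 \<circ> \<rho>)) x"
proof -
  let ?Q = "\<lambda>j b. cdet (N j) (U_coord x j) (\<lambda>l. if l < N (Suc j) then U_coord x (Suc j) l else b l)"
  have m1: "1 \<in> {1..m}" using m_pos by simp
  obtain C0 where C0: "0 \<le> C0" "\<And>b. (\<forall>l<N 1. 0 < Re (b l)) \<Longrightarrow> norm (cdet (N 1) b (U_coord x 1)) \<le> C0"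
    using cdet_bounded[of "N 1" "U_coord x 1"] U[OF m1] by metis
  have "\<exists>C\<ge>0. \<forall>b. (\<forall>l<N j. 0 < Re (b l)) \<longrightarrow> norm (?Q j b) \<le> C" if j: "j \<in> {1..m}" for j
  proof -
    obtain C where "0 \<le> C" "\<And>b. (\<forall>l<N j. b l = U_coord x (Suc j) l \<or> 0 < Re (b l)) \<Longrightarrow> norm (cdet (N j) (U_coord x j) b) \<le> C"
      using cdet_bounded[of "N j" "U_coord x j" "U_coord x (Suc j)"] U[OF j] by metis
    then show ?thesis by (intro exI[of _ C]) auto
  qed
  then obtain C1 where C1: "\<And>j. j \<in> {1..m} \<Longrightarrow> 0 \<le> C1 j"
      "\<And>j b. j \<in> {1..m} \<Longrightarrow> (\<forall>l<N j. 0 < Re (b l)) \<Longrightarrow> norm (?Q j b) \<le> C1 j"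
    by metis
  obtain C2 where C2: "\<And>j. j \<in> {2..m} \<Longrightarrow> 0 \<le> C2 j" "\<And>j t. j \<in> {2..m} \<Longrightarrow> norm (1 / F j (Rout 1 t)) \<le> C2 j"
    using inverse_F_bounded by metis
  define C where "C = C0 * ((\<Prod>j=1..m. C1 j) * (\<Prod>j=2..m. C2 j ^ N j)) * norm (\<Prod>j=1..m. \<Prod>l<N j. F j (U_coord x j l))"
  show ?thesis
  proof (rule dominatedI[where C = C])
    fix y assume y: "\<And>a. a \<in> set (level_vars 1) \<Longrightarrow> y a \<in> K a" "\<And>a. a \<notin> set (level_vars 1) \<Longrightarrow> y a = x a"
    define B where "B = V_coord y 1 \<circ> \<rho>"
    have uy: "U_coord y = U_coord x" using y(2) by (auto simp: U_coord_def set_level_vars fun_eq_iff)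
    have "V_coord y 1 l \<in> range (Rout 1)" if "l < N 1" for l
      using y(1)[of "V 1 (Suc l)"] K_level_1 that by (auto simp: V_coord_def set_level_vars)
    then have B: "B l \<in> range (Rout 1)" if "l < N 1" for l
      using permutes_in_image[OF \<rho>, of l] that by (simp add: B_def)
    have BRe: "0 < Re (B l)" if "l < N 1" for l
      using B[OF that] Rout_contour[OF m1] by auto
    have Nj: "N j \<le> N 1" if "j \<in> {1..m}" for j
      using N_decreasing[OF dec, of 1 j] that by simp
    let ?G = "\<Prod>l<N 1. norm (1 / F 1 (B l))"
    have "norm (tail_product x 1 B) \<le> (\<Prod>j=1..m. C1 j) * (?G * (\<Prod>j=2..m. C2 j ^ N j))"
    proof -
      have split: "{1..m} = insert 1 {2..m}" using m_pos by auto
      have "norm (tail_product x 1 B) = (\<Prod>j=1..m. norm (?Q j B)) * (\<Prod>j=1..m. \<Prod>l<N j. norm (1 / F j (B l)))"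
        unfolding tail_product_def prod_norm[symmetric] norm_mult prod.distrib ..
      also have "(\<Prod>j=1..m. \<Prod>l<N j. norm (1 / F j (B l))) = ?G * (\<Prod>j=2..m. \<Prod>l<N j. norm (1 / F j (B l)))"
        unfolding split by (subst prod.insert) auto
      also have "(\<Prod>j=1..m. norm (?Q j B)) * (?G * (\<Prod>j=2..m. \<Prod>l<N j. norm (1 / F j (B l)))) \<le>
         (\<Prod>j=1..m. C1 j) * (?G * (\<Prod>j=2..m. C2 j ^ N j))"
      proof (rule mult_mono)
        show "(\<Prod>j=1..m. norm (?Q j B)) \<le> (\<Prod>j=1..m. C1 j)"
        proof (rule prod_mono)
          fix j assume j: "j \<in> {1..m}"
          then have "\<forall>l<N j. 0 < Re (B l)" using Nj[OF j] BRe by auto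
          then show "0 \<le> norm (?Q j B) \<and> norm (?Q j B) \<le> C1 j" using C1(2)[OF j, of B] by simp
        qed
        show "?G * (\<Prod>j=2..m. \<Prod>l<N j. norm (1 / F j (B l))) \<le> ?G * (\<Prod>j=2..m. C2 j ^ N j)"
        proof (rule mult_left_mono)
          show "(\<Prod>j=2..m. \<Prod>l<N j. norm (1 / F j (B l))) \<le> (\<Prod>j=2..m. C2 j ^ N j)"
          proof (rule prod_mono)
            fix j assume j: "j \<in> {2..m}"
            have "norm (1 / F j (B l)) \<le> C2 j" if "l < N j" for l
            proof -
              have "l < N 1" using Nj[of j] j that by simp
              then obtain t where "B l = Rout 1 t" using B by blast
              then show ?thesis using C2(2)[OF j, of t] by simp
            qed
            then have "(\<Prod>l<N j. norm (1 / F j (B l))) \<le> (\<Prod>l<N j. C2 j)"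
              by (intro prod_mono) auto
            then show "0 \<le> (\<Prod>l<N j. norm (1 / F j (B l))) \<and> (\<Prod>l<N j. norm (1 / F j (B l))) \<le> C2 j ^ N j"
              by (simp add: prod_nonneg)
          qed
        qed (simp add: prod_nonneg)
        show "0 \<le> (\<Prod>j=1..m. C1 j)" using C1(1) by (rule prod_nonneg)
        show "0 \<le> ?G * (\<Prod>j=2..m. \<Prod>l<N j. norm (1 / F j (B l)))" by (intro mult_nonneg_nonneg prod_nonneg) auto
      qed
      finally show ?thesis .
    qed
    moreover have "norm (cdet (N 1) B (U_coord x 1)) \<le> C0" using C0(2) BRe by blast
    moreover have "0 \<le> norm (tail_product x 1 B)" by simp
    ultimately have "norm (cdet (N 1) B (U_coord x 1)) * norm (tail_product x 1 B) \<le> C0 * ((\<Prod>j=1..m. C1 j) * (?G * (\<Prod>j=2..m. C2 j ^ N j)))"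
      using C0(1) by (intro mult_mono) auto
    then have "norm (ordered_integrand y B) \<le> C0 * ((\<Prod>j=1..m. C1 j) * (?G * (\<Prod>j=2..m. C2 j ^ N j))) * norm (\<Prod>j=1..m. \<Prod>l<N j. F j (U_coord x j l))"
      unfolding ordered_integrand_def uy norm_mult tail_product_cong[of y x, unfolded uy, OF refl]
      by (intro mult_right_mono) auto
    also have "?G = (\<Prod>l<N 1. norm (1 / F 1 (V_coord y 1 l)))"
      using prod.permute[OF \<rho>, of "\<lambda>l. norm (1 / F 1 (V_coord y 1 l))"] by (simp add: B_def o_def)
    also have "\<dots> = (\<Prod>a\<in>set (level_vars 1). \<phi> 0 a (y a))"
      unfolding prod_level_vars by (simp add: \<phi>_def E_def V_coord_def)
    finally show "norm (ordered_integrand y (V_coord y 1 \<circ> \<rho>)) \<le> C * (\<Prod>a\<in>set (level_vars 1). \<phi> 0 a (y a))"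
      unfolding B_def[symmetric] C_def by (simp only: mult.assoc mult.commute mult.left_commute)
  qed
qed

lemma measurable_ordered: "(\<lambda>y. ordered_integrand y (V_coord y 1 \<circ> \<rho>)) \<in> borel_measurable assignments"
proof -
  have v: "(\<lambda>y. (V_coord y 1 \<circ> \<rho>) l) \<in> borel_measurable assignments" for l
    by (simp add: measurable_V_coord)
  have "(\<lambda>y. cdet (N 1) (V_coord y 1 \<circ> \<rho>) (U_coord y 1)) \<in> borel_measurable assignments"
    by (rule measurable_cdet[OF v measurable_U_coord])
  moreover have "(\<lambda>y. tail_product y 1 (V_coord y 1 \<circ> \<rho>)) \<in> borel_measurable assignments"
    by (rule measurable_tail_product[OF v])
  moreover have "(\<lambda>y. \<Prod>j=1..m. \<Prod>l<N j. F j (U_coord y j l)) \<in> borel_measurable assignments"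
    by (intro borel_measurable_prod measurable_F_fun measurable_U_coord)
  ultimately show ?thesis unfolding ordered_integrand_def by (intro borel_measurable_times)
qed

lemma level_1_subset: "set (level_vars 1) \<subseteq> all_vars"
  using m_pos unfolding set_level_vars by (intro image_subsetI) (simp add: V_in_all_vars Suc_le_eq)

text \<open>All level 1 variables run over the same contour, so relabelling them by
  \<open>\<rho>\<close> and reordering the integrals shows that the \<open>fact (N 1)\<close> terms
  are equal.\<close>

lemma iterated_integral_symmetrised:
  assumes dec: "\<And>j. j \<in> {1..m} \<Longrightarrow> N (Suc j) \<le> N j"
    and U: "\<And>j l. j \<in> {1..m} \<Longrightarrow> l < N j \<Longrightarrow> Re (U_coord x j l) < 0"
  shows "iterated_integral (\<lambda>a. cint (contour {} a)) (level_vars 1) (partial_integrand 1) x =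
     tail_count 1 * fact (N 1) * iterated_integral (\<lambda>a. cint (contour {} a)) (level_vars 1) (\<lambda>y. ordered_integrand y (V_coord y 1)) x"
proof -
  let ?J = "\<lambda>a. cint (contour {} a)"
  interpret paths K "\<phi> 0" "contour {}" "weight {}" all_vars by (rule paths_contour[OF empty_subsetI])
  have perm: "iterated_integral ?J (level_vars 1) (\<lambda>y. ordered_integrand y (V_coord y 1 \<circ> \<rho>)) x =
     iterated_integral ?J (level_vars 1) (\<lambda>y. ordered_integrand y (V_coord y 1)) x" if \<rho>: "\<rho> permutes {..<N 1}" for \<rho>
  proof -
    \<comment> \<open>The variables carry indices from 1, so \<open>\<rho>\<close> acts through a
      shift by one; index 0 is left alone, which makes \<open>f\<close> injective on all
      variables.\<close>
    define f where "f a = (case a of V i l \<Rightarrow> V i (if i = 1 \<and> l \<noteq> 0 then Suc (\<rho> (l - 1)) else l) | U i l \<Rightarrow> U i l)" for a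
    have inj: "inj f"
    proof (rule injI)
      fix a b assume "f a = f b"
      then show "a = b"
        by (cases a; cases b) (auto simp: f_def inj_eq[OF permutes_inj[OF \<rho>]] split: if_splits)
    qed
    have img: "f ` set (level_vars 1) = set (level_vars 1)"
      using permutes_image[OF \<rho>] unfolding set_level_vars image_image
      by (auto simp: f_def image_iff)
    have "iterated_integral ?J (map f (level_vars 1)) (\<lambda>y. ordered_integrand y (V_coord y 1 \<circ> \<rho>)) x =
       iterated_integral ?J (level_vars 1) (\<lambda>y. ordered_integrand y (V_coord y 1)) x"
    proof (rule iterated_integral_rename[where D = "UNIV" and P = "\<lambda>_. True"])
      show "inj_on f UNIV" by (rule inj)
      show "?J (f a) = ?J a" if "a \<in> set (level_vars 1)" for a
        using that by (auto simp: set_level_vars f_def contour_def)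
      show "x a = x (f a)" if a: "a \<in> UNIV - set (level_vars 1)" for a
      proof (cases a)
        case (V i l)
        then show ?thesis using a permutes_not_in[OF \<rho>, of "l - 1"]
          by (cases l) (auto simp: f_def set_level_vars image_iff)
      qed (simp add: f_def)
    next
      fix X Y :: "var \<Rightarrow> complex" assume XY: "\<And>a. a \<in> UNIV \<Longrightarrow> Y a = X (f a)"
      have "U_coord X = U_coord Y" using XY by (auto simp: U_coord_def f_def fun_eq_iff)
      moreover have "V_coord X 1 \<circ> \<rho> = V_coord Y 1" using XY by (auto simp: V_coord_def f_def fun_eq_iff)
      ultimately show "ordered_integrand X (V_coord X 1 \<circ> \<rho>) = ordered_integrand Y (V_coord Y 1)"
        by (simp only: ordered_integrand_def tail_product_def)
    qed auto
    moreover have "iterated_integral ?J (map f (level_vars 1)) (\<lambda>y. ordered_integrand y (V_coord y 1 \<circ> \<rho>)) x =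
       iterated_integral ?J (level_vars 1) (\<lambda>y. ordered_integrand y (V_coord y 1 \<circ> \<rho>)) x"
      unfolding cint_contour_eq
      by (rule iterated_integral_reorder[OF dominated_ordered[OF dec U \<rho>] level_1_subset distinct_level_vars measurable_ordered])
        (use img inj distinct_level_vars in \<open>auto simp: distinct_map inj_on_def inj_def\<close>)
    ultimately show ?thesis by simp
  qed
  have "iterated_integral ?J (level_vars 1) (partial_integrand 1) x =
     tail_count 1 * iterated_integral ?J (level_vars 1) (\<lambda>y. \<Sum>\<rho> | \<rho> permutes {..<N 1}. ordered_integrand y (V_coord y 1 \<circ> \<rho>)) x"
    unfolding partial_integrand_1[abs_def] by (rule iterated_integral_cint_cmult)
  also have "iterated_integral ?J (level_vars 1) (\<lambda>y. \<Sum>\<rho> | \<rho> permutes {..<N 1}. ordered_integrand y (V_coord y 1 \<circ> \<rho>)) x =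
     (\<Sum>\<rho> | \<rho> permutes {..<N 1}. iterated_integral ?J (level_vars 1) (\<lambda>y. ordered_integrand y (V_coord y 1 \<circ> \<rho>)) x)"
    unfolding cint_contour_eq
    by (rule iterated_integral_sum) (use dominated_ordered[OF dec U] level_1_subset distinct_level_vars measurable_ordered in auto)
  also have "\<dots> = (\<Sum>\<rho> | \<rho> permutes {..<N 1}. iterated_integral ?J (level_vars 1) (\<lambda>y. ordered_integrand y (V_coord y 1)) x)"
    by (rule sum.cong[OF refl]) (simp only: perm mem_Collect_eq)
  also have "\<dots> = fact (N 1) * iterated_integral ?J (level_vars 1) (\<lambda>y. ordered_integrand y (V_coord y 1)) x"
    using card_permutations[of "{..<N 1}" "N 1"] by (simp only: sum_constant card_lessThan finite_lessThan of_nat_fact)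
  finally show ?thesis by (simp only: mult.assoc)
qed

end

lemma cauchy_det_append_eq:
  assumes "length W = k" "length W1 + length W2 = k" "\<And>i. i < k \<Longrightarrow> W ! i = a i"
    "\<And>i. i < length W1 \<Longrightarrow> W1 ! i = u i" "\<And>i. i < length W2 \<Longrightarrow> W2 ! i = b (length W1 + i)"
  shows "cauchy_det W (W1 @ W2) = cdet k a (\<lambda>l. if l < length W1 then u l else b l)"
  using assms by (intro cauchy_det_eq_cdet) (auto simp: nth_append)

section \<open>The vectors with a hat as blocks of level 1\<close>

context contour_setting
begin

text \<open>
  The vector written \<open>V\<^sup>(\<^sup>1\<^sup>)\<close> in the integral is the concatenation of the vectors with a hat, from index
  \<open>m\<close> down to \<open>1\<close>.
\<close>

definition hat_vars :: "var list" where
  "hat_vars = [V i l. i \<leftarrow> [1..<Suc m], l \<leftarrow> [1..<Suc (gap m n i)]]"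

text \<open>For decreasing level sizes the blocks of index above \<open>i\<close> fill the first
  \<open>N (i + 1)\<close> positions, because their lengths telescope to that number.\<close>

definition hat_embedding :: "var \<Rightarrow> var" where
  "hat_embedding a = (case a of V i l \<Rightarrow> V 1 (N (Suc i) + l) | U i l \<Rightarrow> U i l)"

lemma set_hat_vars: "set hat_vars = {V i l | i l. 1 \<le> i \<and> i \<le> m \<and> 1 \<le> l \<and> l \<le> gap m n i}"
  by (auto simp: hat_vars_def less_Suc_eq_le simp del: upt_Suc)

lemma distinct_hat_vars: "distinct hat_vars"
  unfolding hat_vars_def
proof (rule distinct_concat_map)
  show "distinct (map (V i) [1..<Suc (gap m n i)])" for i
    by (simp add: distinct_map inj_on_def del: upt_Suc)
  show "set (map (V i) [1..<Suc (gap m n i)]) \<inter> set (map (V j) [1..<Suc (gap m n j)]) = {}" if "i \<noteq> j" for i j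
    using that by (auto simp del: upt_Suc)
qed (rule distinct_upt)

context
  assumes dec: "\<And>j. j \<in> {1..m} \<Longrightarrow> N (Suc j) \<le> N j"
begin

lemma gap_eq: "j \<in> {1..m} \<Longrightarrow> N (Suc j) + gap m n j = N j"
  using dec by (simp add: gap_def)

lemma inj_on_hat_embedding: "inj_on hat_embedding (range (case_prod U) \<union> set hat_vars)"
proof (rule inj_onI)
  fix a b assume a: "a \<in> range (case_prod U) \<union> set hat_vars" and b: "b \<in> range (case_prod U) \<union> set hat_vars"
    and eq: "hat_embedding a = hat_embedding b"
  \<comment> \<open>Block \<open>i\<close> occupies the positions \<open>N (i + 1) + 1\<close> to
    \<open>N i\<close>, and these ranges are disjoint since the sizes decrease.\<close>
  have less: False if "i < j" "1 \<le> i" "j \<le> m" "1 \<le> l" "l' \<le> gap m n j" "N (Suc i) + l = N (Suc j) + l'" for i j l l'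
  proof -
    have "N (Suc j) + l' \<le> N j" using gap_eq[of j] that by simp
    also have "N j \<le> N (Suc i)" using N_decreasing[OF dec, of "Suc i" j] that by simp
    finally show False using that by simp
  qed
  show "a = b"
  proof (cases a)
    case (U i l)
    then show ?thesis using eq by (cases b) (auto simp: hat_embedding_def)
  next
    case (V i l)
    then obtain i' l' where b': "b = V i' l'" using eq by (cases b) (auto simp: hat_embedding_def)
    have "1 \<le> i" "i \<le> m" "1 \<le> l" "l \<le> gap m n i" "1 \<le> i'" "i' \<le> m" "1 \<le> l'" "l' \<le> gap m n i'"
      using a b V b' by (auto simp: set_hat_vars)
    moreover have "N (Suc i) + l = N (Suc i') + l'" using eq V b' by (simp add: hat_embedding_def)
    ultimately have "i = i' \<and> l = l'"
      using less[of i i' l l'] less[of i' i l' l] by (metis add_left_cancel linorder_neqE_nat)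
    then show ?thesis using V b' by simp
  qed
qed

lemma hat_embedding_image: "hat_embedding ` set hat_vars = set (level_vars 1)"
proof
  show "hat_embedding ` set hat_vars \<subseteq> set (level_vars 1)"
  proof
    fix b assume "b \<in> hat_embedding ` set hat_vars"
    then obtain i l where b: "b = V 1 (N (Suc i) + l)" "1 \<le> i" "i \<le> m" "1 \<le> l" "l \<le> gap m n i"
      by (auto simp: set_hat_vars hat_embedding_def)
    then have "N (Suc i) + l \<le> N i" using gap_eq[of i] by simp
    also have "N i \<le> N 1" using N_decreasing[OF dec, of 1 i] b by simp
    finally show "b \<in> set (level_vars 1)"
      using b unfolding set_level_vars by (intro image_eqI[of _ _ "N (Suc i) + l - 1"]) auto
  qed
  show "set (level_vars 1) \<subseteq> hat_embedding ` set hat_vars"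
  proof
    fix b assume "b \<in> set (level_vars 1)"
    then obtain l where b: "b = V 1 (Suc l)" "l < N 1" by (auto simp: set_level_vars)
    \<comment> \<open>Some level size must drop to \<open>l\<close> or below, since
      \<open>N (m + 1)\<close> is 0; the last level before that is the index of the block.\<close>
    have "\<exists>i\<in>{1..m}. N (Suc i) \<le> l \<and> l < N i"
    proof (rule ccontr)
      assume *: "\<not> ?thesis"
      have "l < N (Suc i)" if "i \<le> m" for i
        using that by (induction i) (use b * in \<open>auto simp: not_le\<close>)
      then show False using N_Suc_m by (metis not_less_zero order_refl)
    qed
    then obtain i where i: "i \<in> {1..m}" "N (Suc i) \<le> l" "l < N i" by blast
    then have "V i (Suc l - N (Suc i)) \<in> set hat_vars"
      using gap_eq[of i] by (auto simp: set_hat_vars)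
    moreover have "hat_embedding (V i (Suc l - N (Suc i))) = b"
      using i b by (simp add: hat_embedding_def)
    ultimately show "b \<in> hat_embedding ` set hat_vars" by (metis imageI)
  qed
qed

lemma prod_split:
  fixes g :: "nat \<Rightarrow> complex"
  assumes "i \<in> {1..m}"
  shows "(\<Prod>l<N i. g l) = (\<Prod>l\<in>{N (Suc i)..<N i}. g l) * (\<Prod>l<N (Suc i). g l)"
proof -
  have "{..<N i} = {N (Suc i)..<N i} \<union> {..<N (Suc i)}" using dec[OF assms] by auto
  then have "prod g {..<N i} = prod g ({N (Suc i)..<N i} \<union> {..<N (Suc i)})" by (rule arg_cong)
  also have "\<dots> = prod g {N (Suc i)..<N i} * prod g {..<N (Suc i)}" by (rule prod.union_disjoint) auto
  finally show ?thesis .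
qed

text \<open>A position in block \<open>i\<close> occurs on the levels 1 to \<open>i\<close>, where
  the product of the \<open>F\<close> telescopes to \<open>f_fun \<alpha> \<beta> i\<close>. The
  last factor accounts for the positions that continue beyond level \<open>k\<close>.\<close>

lemma prod_F_telescope:
  assumes "1 \<le> k" "k \<le> m"
  shows "(\<Prod>j=1..k. \<Prod>l<N j. 1 / F j (b l)) =
    (\<Prod>i=1..k. \<Prod>l\<in>{N (Suc i)..<N i}. 1 / f_fun \<alpha> \<beta> i (b l)) * (\<Prod>l<N (Suc k). 1 / f_fun \<alpha> \<beta> k (b l))"
  using assms
proof (induction k rule: dec_induct)
  case base
  then show ?case using prod_split[of 1 "\<lambda>l. 1 / f_fun \<alpha> \<beta> 1 (b l)"] by (simp add: F_fun_def)
next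
  case (step k)
  have "F (Suc k) w = f_fun \<alpha> \<beta> (Suc k) w / f_fun \<alpha> \<beta> k w" for w using step by (simp add: F_fun_def)
  moreover have "f_fun \<alpha> \<beta> k w \<noteq> 0" for w by (simp add: f_fun_def)
  ultimately have "(\<Prod>l<N (Suc k). 1 / f_fun \<alpha> \<beta> k (b l)) * (\<Prod>l<N (Suc k). 1 / F (Suc k) (b l)) =
     (\<Prod>l<N (Suc k). 1 / f_fun \<alpha> \<beta> (Suc k) (b l))"
    unfolding prod.distrib[symmetric] by (intro prod.cong refl) simp
  also have "\<dots> = (\<Prod>l\<in>{N (Suc (Suc k))..<N (Suc k)}. 1 / f_fun \<alpha> \<beta> (Suc k) (b l)) *
      (\<Prod>l<N (Suc (Suc k)). 1 / f_fun \<alpha> \<beta> (Suc k) (b l))"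
    using step by (intro prod_split) auto
  finally have eq: "(\<Prod>l<N (Suc k). 1 / f_fun \<alpha> \<beta> k (b l)) * (\<Prod>l<N (Suc k). 1 / F (Suc k) (b l)) = \<dots>" .
  have ins: "{1..Suc k} = insert (Suc k) {1..k}" by auto
  have IH: "(\<Prod>j=1..k. \<Prod>l<N j. 1 / F j (b l)) =
    (\<Prod>i=1..k. \<Prod>l\<in>{N (Suc i)..<N i}. 1 / f_fun \<alpha> \<beta> i (b l)) * (\<Prod>l<N (Suc k). 1 / f_fun \<alpha> \<beta> k (b l))"
    using step by simp
  have "(\<Prod>j=1..Suc k. \<Prod>l<N j. 1 / F j (b l)) =
      (\<Prod>i=1..k. \<Prod>l\<in>{N (Suc i)..<N i}. 1 / f_fun \<alpha> \<beta> i (b l)) *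
      ((\<Prod>l<N (Suc k). 1 / f_fun \<alpha> \<beta> k (b l)) * (\<Prod>l<N (Suc k). 1 / F (Suc k) (b l)))"
    unfolding ins by (subst prod.insert) (simp_all only: IH finite_atLeastAtMost mult.assoc mult.commute mult.left_commute, auto)
  also have "\<dots> = (\<Prod>i=1..Suc k. \<Prod>l\<in>{N (Suc i)..<N i}. 1 / f_fun \<alpha> \<beta> i (b l)) *
      (\<Prod>l<N (Suc (Suc k)). 1 / f_fun \<alpha> \<beta> (Suc k) (b l))"
    unfolding ins eq by (subst prod.insert) (auto simp only: finite_atLeastAtMost mult.assoc mult.commute mult.left_commute atLeastAtMost_iff)
  finally show ?case .
qed

lemma reduced_integrand_eq:
  assumes U: "\<And>j l. Y (U j l) = X (U j l)"
    and V: "\<And>i l. V i l \<in> set hat_vars \<Longrightarrow> Y (V i l) = X (hat_embedding (V i l))"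
  shows "reduced_integrand m n \<alpha> \<beta> Y = ordered_integrand X (V_coord X 1)"
proof -
  let ?B = "V_coord X 1" and ?Us = "\<lambda>i. Uvec Y (N i) i" and ?Vs = "\<lambda>i. Vvec Y (gap m n i) i"
  have uY: "U_coord Y j l = U_coord X j l" for j l using U by (simp add: U_coord_def)
  have vY: "V_coord Y i l = ?B (N (Suc i) + l)" if "i \<in> {1..m}" "l < gap m n i" for i l
    using V[of i "Suc l"] that by (simp add: V_coord_def set_hat_vars hat_embedding_def)
  \<comment> \<open>Downward from the empty list at \<open>i = m + 1\<close>: each step appends the
    block of index \<open>i\<close> to those of higher index.\<close>
  have conc: "concat (map ?Vs (rev [i..<Suc m])) = map ?B [0..<N i]" if "1 \<le> i" "i \<le> Suc m" for i
    using that(2,1)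
  proof (induction i rule: inc_induct)
    case base
    then show ?case by (simp add: N_Suc_m)
  next
    case (step i)
    have "?Vs i = map ?B [N (Suc i)..<N i]"
    proof (rule nth_equalityI)
      show "length (?Vs i) = length (map ?B [N (Suc i)..<N i])"
        using gap_eq[of i] step by (simp add: nth_Vvec)
      fix l assume "l < length (?Vs i)"
      then have l: "l < gap m n i" by (simp add: nth_Vvec)
      then show "?Vs i ! l = map ?B [N (Suc i)..<N i] ! l"
        using vY[of i l] gap_eq[of i] step by (simp add: nth_Vvec)
    qed
    moreover have "[i..<Suc m] = i # [Suc i..<Suc m]" using step by (simp add: upt_conv_Cons)
    moreover have "[0..<N i] = [0..<N (Suc i)] @ [N (Suc i)..<N i]"
      using gap_eq[of i] step upt_add_eq_append[of 0 "N (Suc i)" "gap m n i"] by simp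
    ultimately show ?case using step by simp
  qed
  have 1: "cauchy_det (concat (map ?Vs (rev [1..<Suc m]))) (?Us 1) = cdet (N 1) ?B (U_coord X 1)"
    by (rule cauchy_det_eq_cdet) (use conc[of 1] m_pos uY in \<open>auto simp: nth_Uvec simp del: upt_Suc\<close>)
  have 2: "cauchy_det (?Us j) (?Us (Suc j) @ ?Vs j) = cdet (N j) (U_coord X j) (\<lambda>l. if l < N (Suc j) then U_coord X (Suc j) l else ?B l)"
    if j: "j \<in> {1..m}" for j
  proof -
    have "cauchy_det (?Us j) (?Us (Suc j) @ ?Vs j) = cdet (N j) (U_coord X j) (\<lambda>l. if l < length (?Us (Suc j)) then U_coord X (Suc j) l else ?B l)"
      by (rule cauchy_det_append_eq) (use gap_eq[OF j] vY[OF j] uY in \<open>auto simp: nth_Uvec nth_Vvec\<close>)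
    then show ?thesis by (simp only: nth_Uvec(2))
  qed
  have 3: "(\<Prod>i=1..m. (\<Prod>l=1..n i. F i (Y (U i l))) / (\<Prod>l=1..gap m n i. f_fun \<alpha> \<beta> i (Y (V i l)))) =
     (\<Prod>i=1..m. \<Prod>l<N i. F i (U_coord X i l)) * (\<Prod>i=1..m. \<Prod>l<N i. 1 / F i (?B l))"
  proof -
    have "(\<Prod>i=1..m. \<Prod>l<N i. 1 / F i (?B l)) = (\<Prod>i=1..m. \<Prod>l\<in>{N (Suc i)..<N i}. 1 / f_fun \<alpha> \<beta> i (?B l))"
      using prod_F_telescope[OF m_pos order_refl] by (simp add: N_Suc_m)
    moreover have "(\<Prod>l=1..n i. F i (Y (U i l))) / (\<Prod>l=1..gap m n i. f_fun \<alpha> \<beta> i (Y (V i l))) =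
       (\<Prod>l<N i. F i (U_coord X i l)) * (\<Prod>l\<in>{N (Suc i)..<N i}. 1 / f_fun \<alpha> \<beta> i (?B l))" if i: "i \<in> {1..m}" for i
    proof -
      have "(\<Prod>l=1..n i. F i (Y (U i l))) = (\<Prod>l<N i. F i (U_coord X i l))"
        using i U by (simp add: prod.atLeast1_atMost_eq U_coord_def N_eq)
      moreover have "(\<Prod>l\<in>{N (Suc i)..<N i}. 1 / f_fun \<alpha> \<beta> i (?B l)) = (\<Prod>l<gap m n i. 1 / f_fun \<alpha> \<beta> i (?B (N (Suc i) + l)))"
        by (rule prod.reindex_bij_witness[where i = "\<lambda>l. N (Suc i) + l" and j = "\<lambda>l. l - N (Suc i)"])
          (use gap_eq[OF i] in auto)
      moreover have "(\<Prod>l=1..gap m n i. f_fun \<alpha> \<beta> i (Y (V i l))) = (\<Prod>l<gap m n i. f_fun \<alpha> \<beta> i (?B (N (Suc i) + l)))"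
      proof -
        have "(\<Prod>l=1..gap m n i. f_fun \<alpha> \<beta> i (Y (V i l))) = (\<Prod>l<gap m n i. f_fun \<alpha> \<beta> i (V_coord Y i l))"
          by (simp add: prod.atLeast1_atMost_eq V_coord_def)
        then show ?thesis using vY[OF i] by simp
      qed
      ultimately show ?thesis by (simp add: prod_dividef)
    qed
    ultimately show ?thesis by (simp add: prod.distrib)
  qed
  have 4: "(\<Prod>i=1..m. cauchy_det (?Us i) (?Us (Suc i) @ ?Vs i)) =
      (\<Prod>j=1..m. cdet (N j) (U_coord X j) (\<lambda>l. if l < N (Suc j) then U_coord X (Suc j) l else ?B l))"
    by (rule prod.cong[OF refl 2])
  show ?thesis
    unfolding reduced_integrand_def Let_def 1 3 4 ordered_integrand_def tail_product_def prod.distrib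
    by (simp only: mult.assoc mult.commute mult.left_commute)
qed

text \<open>Renaming along \<open>hat_embedding\<close> lists level 1 block by block, from index 1
  to \<open>m\<close>; Fubini restores the order of \<open>level_vars 1\<close>.\<close>

lemma iterated_integral_hat:
  assumes U: "\<And>j l. j \<in> {1..m} \<Longrightarrow> l < N j \<Longrightarrow> Re (U_coord x j l) < 0"
    and J': "\<And>i l. J' (V i l) = cint (Rout 1)"
  shows "iterated_integral J' hat_vars (reduced_integrand m n \<alpha> \<beta>) x =
    iterated_integral (\<lambda>a. cint (contour {} a)) (level_vars 1) (\<lambda>y. ordered_integrand y (V_coord y 1)) x"
proof -
  let ?J = "\<lambda>a. cint (contour {} a)" and ?G = "\<lambda>y. ordered_integrand y (V_coord y 1)"
  interpret paths K "\<phi> 0" "contour {}" "weight {}" all_vars by (rule paths_contour[OF empty_subsetI])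
  have "iterated_integral ?J (map hat_embedding hat_vars) ?G x = iterated_integral J' hat_vars (reduced_integrand m n \<alpha> \<beta>) x"
  proof (rule iterated_integral_rename[OF inj_on_hat_embedding, where P = "\<lambda>_. True"])
    show "?J (hat_embedding a) = J' a" if "a \<in> set hat_vars" for a
      using that by (auto simp: set_hat_vars hat_embedding_def contour_def J')
    show "x a = x (hat_embedding a)" if "a \<in> range (case_prod U) \<union> set hat_vars - set hat_vars" for a
      using that by (auto simp: hat_embedding_def)
  next
    fix X Y :: "var \<Rightarrow> complex" assume XY: "\<And>a. a \<in> range (case_prod U) \<union> set hat_vars \<Longrightarrow> Y a = X (hat_embedding a)"
    have "Y (U j l) = X (U j l)" for j l
      using XY[of "U j l"] by (force simp: hat_embedding_def)
    then show "ordered_integrand X (V_coord X 1) = reduced_integrand m n \<alpha> \<beta> Y"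
      using XY by (intro reduced_integrand_eq[symmetric]) auto
  qed auto
  moreover have "iterated_integral ?J (map hat_embedding hat_vars) ?G x = iterated_integral ?J (level_vars 1) ?G x"
    unfolding cint_contour_eq
  proof (rule iterated_integral_reorder[OF _ level_1_subset distinct_level_vars])
    show "dominated K (\<phi> 0) (set (level_vars 1)) ?G x"
      using dominated_ordered[OF dec U permutes_id] by simp
    show "?G \<in> borel_measurable assignments" using measurable_ordered[of id] by simp
    show "set (map hat_embedding hat_vars) = set (level_vars 1)" using hat_embedding_image by simp
    show "distinct (map hat_embedding hat_vars)"
      using inj_on_subset[OF inj_on_hat_embedding, of "set hat_vars"] distinct_hat_vars by (simp add: distinct_map)
  qed
  ultimately show ?thesis by simp
qed

text \<open>The factor \<open>fact (N 1)\<close> completes the shifted product of the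
  \<open>fact (N (j + 1))\<close> to that of all \<open>fact (N j)\<close>. The quotient of index
  \<open>m\<close> is 1, because \<open>gap m n m = N m\<close>.\<close>

lemma tail_count_1: "tail_count 1 * fact (N 1) = (\<Prod>i=1..<m. fact (n i) / fact (gap m n i))"
proof -
  have "tail_count 1 = (\<Prod>j=1..m. fact (N (Suc j)) / fact (gap m n j))"
    unfolding tail_count_def gap_def using dec by (intro prod.cong refl) auto
  then have "tail_count 1 * fact (N 1) = ((\<Prod>j=1..m. fact (N (Suc j))) * fact (N 1)) / (\<Prod>j=1..m. fact (gap m n j))"
    by (simp add: prod_dividef)
  also have "(\<Prod>j=1..m. fact (N (Suc j))) * fact (N 1) = (\<Prod>j=1..m. fact (N j) :: complex)"
    using prod_shift_telescope[of "\<lambda>j. fact (N j) :: complex" m] by (simp add: N_Suc_m)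
  also have "(\<Prod>j=1..m. fact (N j)) / (\<Prod>j=1..m. fact (gap m n j)) = (\<Prod>j=1..m. fact (N j) / fact (gap m n j) :: complex)"
    by (simp add: prod_dividef)
  also have "\<dots> = (\<Prod>j=1..<m. fact (n j) / fact (gap m n j))"
  proof -
    have "{1..m} = insert m {1..<m}" using m_pos by auto
    moreover have "fact (N m) / fact (gap m n m) = (1 :: complex)" by (simp add: gap_def N_Suc_m)
    ultimately have "(\<Prod>j=1..m. fact (N j) / fact (gap m n j) :: complex) = (\<Prod>j=1..<m. fact (N j) / fact (gap m n j))"
      by simp
    also have "\<dots> = (\<Prod>j=1..<m. fact (n j) / fact (gap m n j))" by (intro prod.cong refl) (simp add: N_eq)
    finally show ?thesis .
  qed
  finally show ?thesis .
qed

end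

end

theorem lemma2p3:
  fixes m :: nat and n :: "nat \<Rightarrow> nat" and \<alpha> \<beta> r :: "nat \<Rightarrow> real"
    and Lin Lout Rin Rout :: "nat \<Rightarrow> real \<Rightarrow> complex"
  assumes "m \<ge> 1"
    and "strict_mono_on {1..m} \<alpha>"
    and "left_contours m Lin Lout"
    and "right_contours m Rin Rout"
    and "\<forall>i\<in>{1..<m}. 0 < r i \<and> r i < 1"
  shows
    "D_hat m n \<alpha> \<beta> Lin Lout Rin Rout r =
       iterated_integral
         (\<lambda>a g. case a of
            U i l \<Rightarrow> line_integral (Lin i) g / (2 * of_real pi * \<i>)
          | V i l \<Rightarrow> line_integral (Rout i) g / (2 * of_real pi * \<i>))
         [a. i \<leftarrow> [1..<Suc m], l \<leftarrow> [1..<Suc (n i)], a \<leftarrow> [U i l, V i l]]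
         (integrand m n \<alpha> \<beta>) (\<lambda>_. 0)
     \<and>
     ((\<forall>i\<in>{1..<m}. n (Suc i) \<le> n i) \<longrightarrow>
        D_hat m n \<alpha> \<beta> Lin Lout Rin Rout r =
          (\<Prod>i=1..<m. fact (n i) / fact (gap m n i)) *
          iterated_integral
            (\<lambda>a g. case a of
               U i l \<Rightarrow> line_integral (Lin i) g / (2 * of_real pi * \<i>)
             | V i l \<Rightarrow> line_integral (Rout 1) g / (2 * of_real pi * \<i>))
            ([U i l. i \<leftarrow> [1..<Suc m], l \<leftarrow> [1..<Suc (n i)]]
             @ [V i l. i \<leftarrow> [1..<Suc m], l \<leftarrow> [1..<Suc (gap m n i)]])
            (reduced_integrand m n \<alpha> \<beta>) (\<lambda>_. 0))
     \<and>
     (\<not> (\<forall>i\<in>{1..<m}. n (Suc i) \<le> n i) \<longrightarrow>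
        D_hat m n \<alpha> \<beta> Lin Lout Rin Rout r = 0)"
proof -
  interpret contour_setting m n \<alpha> \<beta> Lin Lout Rin Rout
    by standard (use assms in auto)
  let ?J = "\<lambda>a. cint (contour {} a)"
  let ?us = "[U i l. i \<leftarrow> [1..<Suc m], l \<leftarrow> [1..<Suc (n i)]]"
  let ?uv = "[a. i \<leftarrow> [1..<Suc m], l \<leftarrow> [1..<Suc (n i)], a \<leftarrow> [U i l, V i l]]"
  have Dhat: "D_hat m n \<alpha> \<beta> Lin Lout Rin Rout r = choice_integral {}"
    by (rule D_hat_eq[OF assms(5)])
  have J: "(\<lambda>a g. case a of
            U i l \<Rightarrow> line_integral (Lin i) g / (2 * of_real pi * \<i>)
          | V i l \<Rightarrow> line_integral (Rout i) g / (2 * of_real pi * \<i>)) = ?J"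
    by (auto simp: fun_eq_iff cint_def contour_def split: var.splits)
  have "set ?uv = all_vars"
    by (force simp: all_vars_eq N_eq less_Suc_eq_le simp del: upt_Suc)
  moreover have "distinct ?uv"
    by (intro distinct_concat_map distinct_upt) (auto simp del: upt_Suc)
  ultimately have i: "choice_integral {} = iterated_integral ?J ?uv (integrand m n \<alpha> \<beta>) (\<lambda>_. 0)"
    by (rule choice_integral_reorder[OF empty_subsetI])
  have set_us: "set ?us = set U_order"
    by (force simp: set_U_order N_eq less_Suc_eq_le simp del: upt_Suc)
  have distinct_us: "distinct ?us"
    by (intro distinct_concat_map distinct_upt) (auto simp: distinct_map inj_on_def simp del: upt_Suc)
  \<comment> \<open>U outside and level 1 of V inside: the common starting point of the second
    formula and of the vanishing statement.\<close>
  have ii: "choice_integral {} = iterated_integral ?J ?us (iterated_integral ?J (level_vars 1) (partial_integrand 1)) (\<lambda>_. 0)"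
    using choice_integral_eq[OF empty_subsetI set_us distinct_us] by simp
  have left_half: "Re (U_coord y j l) < 0"
    if y: "\<And>a. a \<in> set ?us \<Longrightarrow> y a \<in> range (contour {} a)" and "j \<in> {1..m}" "l < N j" for y j l
  proof -
    have "U j (Suc l) \<in> set ?us" unfolding set_us set_U_order using that by auto
    then obtain t where "y (U j (Suc l)) = contour {} (U j (Suc l)) t" using y by blast
    then have "y (U j (Suc l)) \<in> K (U j (Suc l))" using contour_in_K[of "{}"] by simp
    then show ?thesis using K_U[OF that(2)] by (auto simp: U_coord_def)
  qed
  \<comment> \<open>Since \<open>N (m + 1)\<close> is 0, the additional comparison at
    \<open>j = m\<close> holds automatically.\<close>
  have mono_iff: "(\<forall>i\<in>{1..<m}. n (Suc i) \<le> n i) \<longleftrightarrow> (\<forall>j\<in>{1..m}. N (Suc j) \<le> N j)"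
  proof -
    have "{1..m} = insert m {1..<m}" using m_pos by auto
    then show ?thesis by (simp add: N_Suc_m N_eq)
  qed
  have "choice_integral {} = (\<Prod>i=1..<m. fact (n i) / fact (gap m n i)) *
          iterated_integral
            (\<lambda>a g. case a of
               U i l \<Rightarrow> line_integral (Lin i) g / (2 * of_real pi * \<i>)
             | V i l \<Rightarrow> line_integral (Rout 1) g / (2 * of_real pi * \<i>))
            (?us @ [V i l. i \<leftarrow> [1..<Suc m], l \<leftarrow> [1..<Suc (gap m n i)]])
            (reduced_integrand m n \<alpha> \<beta>) (\<lambda>_. 0)"
    if "\<forall>j\<in>{1..m}. N (Suc j) \<le> N j"
  proof -
    have dec: "N (Suc j) \<le> N j" if "j \<in> {1..m}" for j using \<open>\<forall>j\<in>{1..m}. N (Suc j) \<le> N j\<close> that by blast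
    \<comment> \<open>On the U this agrees with \<open>?J\<close>; every V, whatever its upper
      index, runs over the contour of level 1.\<close>
    let ?J' = "\<lambda>a. cint (case a of U i l \<Rightarrow> Lin i | V i l \<Rightarrow> Rout 1)"
    have J': "(\<lambda>a g. case a of
               U i l \<Rightarrow> line_integral (Lin i) g / (2 * of_real pi * \<i>)
             | V i l \<Rightarrow> line_integral (Rout 1) g / (2 * of_real pi * \<i>)) = ?J'"
      by (auto simp: fun_eq_iff cint_def split: var.splits)
    have "choice_integral {} = iterated_integral ?J' ?us
       (\<lambda>y. (\<Prod>i=1..<m. fact (n i) / fact (gap m n i)) * iterated_integral ?J' hat_vars (reduced_integrand m n \<alpha> \<beta>) y) (\<lambda>_. 0)"
      unfolding ii
    \<comment> \<open>The inner integral is rewritten for U on the contours only, which is where the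
      left half plane condition is available.\<close>
    proof (rule iterated_integral_cong[where K = "\<lambda>a. range (contour {} a)"])
      fix a and g h :: "complex \<Rightarrow> complex" assume "a \<in> set ?us" "\<And>w. w \<in> range (contour {} a) \<Longrightarrow> g w = h w"
      then show "?J a g = ?J' a h"
        using cint_cong[of "contour {} a" g h] by (auto simp: contour_def set_us set_U_order)
    next
      fix y assume "\<And>a. a \<in> set ?us \<Longrightarrow> y a \<in> range (contour {} a)"
      note U = left_half[OF this]
      have "iterated_integral ?J (level_vars 1) (partial_integrand 1) y =
          tail_count 1 * fact (N 1) * iterated_integral ?J (level_vars 1) (\<lambda>y. ordered_integrand y (V_coord y 1)) y"
        by (rule iterated_integral_symmetrised[OF dec U])
      also have "tail_count 1 * fact (N 1) = (\<Prod>i=1..<m. fact (n i) / fact (gap m n i))"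
        by (rule tail_count_1[OF dec])
      also have "iterated_integral ?J (level_vars 1) (\<lambda>y. ordered_integrand y (V_coord y 1)) y =
          iterated_integral ?J' hat_vars (reduced_integrand m n \<alpha> \<beta>) y"
        by (rule iterated_integral_hat[OF dec U, symmetric]) (simp_all only: var.case)
      finally show "iterated_integral ?J (level_vars 1) (partial_integrand 1) y =
        (\<Prod>i=1..<m. fact (n i) / fact (gap m n i)) * iterated_integral ?J' hat_vars (reduced_integrand m n \<alpha> \<beta>) y" .
    qed
    also have "\<dots> = (\<Prod>i=1..<m. fact (n i) / fact (gap m n i)) * iterated_integral ?J' (?us @ hat_vars) (reduced_integrand m n \<alpha> \<beta>) (\<lambda>_. 0)"
      unfolding iterated_integral_append by (rule iterated_integral_cint_cmult)
    finally show ?thesis unfolding J' hat_vars_def .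
  qed
  moreover have "choice_integral {} = 0" if "\<not> (\<forall>j\<in>{1..m}. N (Suc j) \<le> N j)"
  proof -
    obtain j where "j \<in> {1..m}" "\<not> N (Suc j) \<le> N j" using \<open>\<not> (\<forall>j\<in>{1..m}. N (Suc j) \<le> N j)\<close> by blast
    \<comment> \<open>One increase in the level sizes puts a zero factor into
      \<open>tail_count 1\<close>, which multiplies the whole remaining integrand.\<close>
    then have "tail_count 1 = 0" using tail_count_nonzero_decreasing[of 1 j] by auto
    then have "partial_integrand 1 = (\<lambda>_. 0)" by (simp add: fun_eq_iff partial_integrand_1[simplified])
    then show ?thesis unfolding ii by (simp add: iterated_integral_cint_zero[abs_def])
  qed
  ultimately show ?thesis unfolding Dhat J i[symmetric] mono_iff by blast
qed

end
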